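(* Let $k$ be a field of characteristic $0$. For each dga $(A,\phi)$ over $k$ there exists a (cohomological) spectral sequence with $$E_2^{p,q}\simeq H^p\big(\Delta_-^q HH^*_{dg}(A)\big)$$ that converges to the cyclic cohomology $HC^{p+q}_{dg}(A)$.
   Context: **Dgas.** A dga $(A,\phi)$ over $k$ is a unital associative graded $k$-algebra $A=\bigoplus_{m\ge 0}A^m$ with a $k$-linear map $\phi$ lowering degree by one such that $\phi^2=0$ and $\phi(xy)=\phi(x)y+(-1)^{|x|}x\phi(y)$, where $|x|$ is the degree of a homogeneous element. $(A^{\otimes n})^m$ is the total-degree-$m$ part of $A^{\otimes n}$, and $\phi^{\otimes n}$ denotes the induced differential $\phi^{\otimes n}(a_1\otimes\dots\otimes a_n)=\sum_i(-1)^{|a_1|+\dots+|a_{i-1}|}a_1\otimes\dots\otimes\phi(a_i)\otimes\dots\otimes a_n$. For $n,m\ge 0$ put $C^n(A)^m=\mathrm{Hom}_k((A^{\otimes n+1})^m,k)$. **Operators** (on homogeneous $a_i$, with $\gamma_n=|a_n|(|a_0|+\dots+|a_{n-1}|)$): - $\delta:C^n(A)^m\to C^n(A)^{m+1}$, $\delta f=(-1)^m f\circ\phi^{\otimes n+1}$. - $b:C^{n-1}(A)^m\to C^n(A)^m$, $b(f)(a_0\otimes\dots\otimes a_n)=\sum_{i=0}^{n-1}(-1)^i f(a_0\otimes\dots\otimes a_ia_{i+1}\otimes\dots\otimes a_n)+(-1)^{n+\gamma_n}f(a_na_0\otimes a_1\otimes\dots\otimes a_{n-1})$. - $\tau:C^n(A)^m\to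 C^n(A)^m$, $\tau(f)(a_0\otimes\dots\otimes a_n)=(-1)^{n+\gamma_n}f(a_n\otimes a_0\otimes\dots\otimes a_{n-1})$; $N=\sum_{i=0}^n\tau^i$ on $C^n(A)^m$. - $s:C^{n+1}(A)^m\to C^n(A)^m$, $s(f)(a_0\otimes\dots\otimes a_n)=(-1)^n f(a_0\otimes\dots\otimes a_n\otimes 1)$. - $B=Ns(\mathbf 1-\tau):C^{n+1}(A)^m\to C^n(A)^m$ (and $B=0$ on $C^0(A)^m$). **Hochschild cohomology.** $\mathcal T(EH(A))^n=\bigoplus_{p+q=n}C^p(A)^q$ with differential $b+(-1)^p\delta$ on $C^p(A)^q$; $HH^n_{dg}(A)=H^n(\mathcal T(EH(A)))$. **Cyclic cohomology.** $EC(A)$ is the tricomplex with $EC(A)^{p,q,r}=C^{q-p}(A)^r$ for $0\le p\le q$, $r\ge 0$, and $0$ otherwise. $\mathcal T(EC(A))^n=\bigoplus_{p+q+r=n}EC(A)^{p,q,r}$ has differential $b+B+(-1)^{q-p}\delta$, where $b$ raises $q$, $B$ raises $p$, $\delta$ raises $r$ by one. $HC^n_{dg}(A)=H^n(\mathcal T(EC(A)))$. **Truncation.** For a graded vector space $V$, the $k$-th negative truncation is $(\Delta_-^kV)^n=V^{k-n}$ if $n\le k$ and $0$ if $n>k$ (here $n\ge 0$). $\Delta_-^qHH^*_{dg}(A)$ is regarded as a cochain complex $HH^q_{dg}(A)\to HH^{q-1}_{dg}(A)\to\dots\to HH^0_{dg}(A)\to 0$, with $HH^{q-n}_{dg}(A)$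 in degree $n$, whose differential is induced by $B$ (which anticommutes with the differential of $\mathcal T(EH(A))$). **Convergence.** A spectral sequence $(E_r^{p,q},d_r)$, $d_r:E_r^{p,q}\to E_r^{p+r,q-r+1}$, converges to $H^*$ if there is a decreasing filtration of each $H^n$, finite in each degree, with $E_\infty^{p,q}\simeq F^pH^{p+q}/F^{p+1}H^{p+q}$. *)

theory Defs
  imports
    "HOL-Algebra.Module"
    "HOL-Algebra.AbelCoset"
    "HOL-Algebra.Algebraic_Closure_Type"
    "HOL-Library.Poly_Mapping"
begin

section \<open>Vector spaces with explicit carrier\<close>

text \<open>
  Derived vector spaces (tensor powers, duals, cohomology, pages of spectral sequences) are
  \<^typ>\<open>('k, 'v) module\<close> records over the field \<^typ>\<open>'k\<close>, which is turned into a ring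
  record by \<^term>\<open>ring_of_type_algebra\<close>.  The fields \<open>mult\<close> and \<open>one\<close> of such records are not used.
\<close>

definition vspace :: "'v set \<Rightarrow> 'v \<Rightarrow> ('v \<Rightarrow> 'v \<Rightarrow> 'v) \<Rightarrow> ('k \<Rightarrow> 'v \<Rightarrow> 'v) \<Rightarrow> ('k, 'v) module" where
  "vspace V z a s = \<lparr>carrier = V, monoid.mult = undefined, monoid.one = undefined, ring.zero = z, ring.add = a, module.smult = s\<rparr>"

abbreviation is_vspace :: "('k::field, 'v) module \<Rightarrow> bool" where
  "is_vspace M \<equiv> Module.module (ring_of_type_algebra :: 'k ring) M"

abbreviation is_subspace :: "'v set \<Rightarrow> ('k::field, 'v) module \<Rightarrow> bool" where
  "is_subspace U M \<equiv> submodule U (ring_of_type_algebra :: 'k ring) M"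

definition lin :: "('k, 'v) module \<Rightarrow> ('k, 'w) module \<Rightarrow> ('v \<Rightarrow> 'w) \<Rightarrow> bool" where
  "lin M N h \<longleftrightarrow>
     h \<in> carrier M \<rightarrow> carrier N \<and>
     (\<forall>x\<in>carrier M. \<forall>y\<in>carrier M. h (x \<oplus>\<^bsub>M\<^esub> y) = h x \<oplus>\<^bsub>N\<^esub> h y) \<and>
     (\<forall>c. \<forall>x\<in>carrier M. h (c \<odot>\<^bsub>M\<^esub> x) = c \<odot>\<^bsub>N\<^esub> h x)"

definition vspace_iso :: "('k, 'v) module \<Rightarrow> ('k, 'w) module \<Rightarrow> bool" (infix "\<simeq>\<^sub>k" 50) where
  "M \<simeq>\<^sub>k N \<longleftrightarrow> (\<exists>h. lin M N h \<and> bij_betw h (carrier M) (carrier N))"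

definition zero_space :: "('k, 'v) module \<Rightarrow> ('k, 'v) module" where
  "zero_space M = M\<lparr>carrier := {\<zero>\<^bsub>M\<^esub>}\<rparr>"

definition scalars :: "('k::field, 'k) module" where
  "scalars = vspace UNIV 0 (+) (*)"

definition quotient :: "('k, 'v) module \<Rightarrow> 'v set \<Rightarrow> ('k, 'v set) module" where
  "quotient M U = vspace (a_rcosets\<^bsub>M\<^esub> U) U (set_add M) (\<lambda>c w. \<Union>x\<in>w. U +>\<^bsub>M\<^esub> (c \<odot>\<^bsub>M\<^esub> x))"

text \<open>Linear maps are normalised to vanish outside the carrier, so that equal maps are equal functions.\<close>

definition Hom_set :: "('k, 'v) module \<Rightarrow> ('k, 'w) module \<Rightarrow> ('v \<Rightarrow> 'w) set" where
  "Hom_set M N = {h. lin M N h \<and> (\<forall>x. x \<notin> carrier M \<longrightarrow> h x = \<zero>\<^bsub>N\<^esub>)}"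

definition dual :: "('k::field, 'v) module \<Rightarrow> ('k, 'v \<Rightarrow> 'k) module" where
  "dual M = vspace (Hom_set M scalars) (\<lambda>_. 0) (\<lambda>f g x. f x + g x) (\<lambda>c f x. c * f x)"

definition dsum :: "'i set \<Rightarrow> ('i \<Rightarrow> ('k, 'v) module) \<Rightarrow> ('k, 'i \<Rightarrow> 'v) module" where
  "dsum I M = vspace
     {x. (\<forall>i\<in>I. x i \<in> carrier (M i)) \<and> (\<forall>i. i \<notin> I \<longrightarrow> x i = \<zero>\<^bsub>M i\<^esub>) \<and> finite {i. x i \<noteq> \<zero>\<^bsub>M i\<^esub>}}
     (\<lambda>i. \<zero>\<^bsub>M i\<^esub>) (\<lambda>x y i. x i \<oplus>\<^bsub>M i\<^esub> y i) (\<lambda>c x i. c \<odot>\<^bsub>M i\<^esub> x i)"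


section \<open>Cochain complexes and their cohomology\<close>

text \<open>\<open>C n\<close> is the term in degree \<open>n\<close>, and \<open>d n : C n \<rightarrow> C (n + 1)\<close> the differential.\<close>

definition cobound :: "(int \<Rightarrow> ('k, 'v) module) \<Rightarrow> (int \<Rightarrow> 'v \<Rightarrow> 'v) \<Rightarrow> int \<Rightarrow> 'v set" where
  "cobound C d n = d (n - 1) ` carrier (C (n - 1))"

definition cohom :: "(int \<Rightarrow> ('k, 'v) module) \<Rightarrow> (int \<Rightarrow> 'v \<Rightarrow> 'v) \<Rightarrow> int \<Rightarrow> ('k, 'v set) module" where
  "cohom C d n = quotient ((C n)\<lparr>carrier := a_kernel (C n) (C (n + 1)) (d n)\<rparr>) (cobound C d n)"

text \<open>The map on cohomology classes, with values in degree \<open>n\<close>, induced by a map \<open>f\<close> of cochains.\<close>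

definition cohom_map ::
  "(int \<Rightarrow> ('k, 'v) module) \<Rightarrow> (int \<Rightarrow> 'v \<Rightarrow> 'v) \<Rightarrow> int \<Rightarrow> ('v \<Rightarrow> 'v) \<Rightarrow> 'v set \<Rightarrow> 'v set" where
  "cohom_map C d n f w = (\<Union>x\<in>w. cobound C d n +>\<^bsub>C n\<^esub> f x)"

definition neg_trunc :: "int \<Rightarrow> (int \<Rightarrow> ('k, 'v) module) \<Rightarrow> int \<Rightarrow> ('k, 'v) module" where
  "neg_trunc k V n = (if 0 \<le> n \<and> n \<le> k then V (k - n) else zero_space (V (k - n)))"


section \<open>Spectral sequences\<close>

text \<open>
  Pages are indexed from 2 on.  A spectral sequence beginning at an earlier page restricts to
  such a one; conversely one may prolong downwards by zero differentials.
\<close>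

definition spectral_sequence ::
  "(nat \<Rightarrow> int \<Rightarrow> int \<Rightarrow> ('k::field, 'e) module) \<Rightarrow> (nat \<Rightarrow> int \<Rightarrow> int \<Rightarrow> 'e \<Rightarrow> 'e) \<Rightarrow> bool" where
  "spectral_sequence E d \<longleftrightarrow> (\<forall>r\<ge>2. \<forall>p q.
     is_vspace (E r p q) \<and>
     lin (E r p q) (E r (p + int r) (q - int r + 1)) (d r p q) \<and>
     (\<forall>x\<in>carrier (E r p q).
        d r (p + int r) (q - int r + 1) (d r p q x) = \<zero>\<^bsub>E r (p + 2 * int r) (q - 2 * int r + 2)\<^esub>) \<and>
     E (Suc r) p q \<simeq>\<^sub>k
       quotient
         ((E r p q)\<lparr>carrier := a_kernel (E r p q) (E r (p + int r) (q - int r + 1)) (d r p q)\<rparr>)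
         (d r (p - int r) (q + int r - 1) ` carrier (E r (p - int r) (q + int r - 1))))"

text \<open>
  All differentials into and out of position \<open>(p, q)\<close> vanish from page \<open>r\<close> on; then
  \<open>E\<^sub>\<infinity>\<close> at \<open>(p, q)\<close> is the common value (up to isomorphism) of these pages.
\<close>

definition stable_from ::
  "(nat \<Rightarrow> int \<Rightarrow> int \<Rightarrow> ('k, 'e) module) \<Rightarrow> (nat \<Rightarrow> int \<Rightarrow> int \<Rightarrow> 'e \<Rightarrow> 'e) \<Rightarrow> int \<Rightarrow> int \<Rightarrow> nat \<Rightarrow> bool" where
  "stable_from E d p q r \<longleftrightarrow> 2 \<le> r \<and> (\<forall>s\<ge>r.
     (\<forall>x\<in>carrier (E s p q). d s p q x = \<zero>\<^bsub>E s (p + int s) (q - int s + 1)\<^esub>) \<and>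
     (\<forall>x\<in>carrier (E s (p - int s) (q + int s - 1)).
        d s (p - int s) (q + int s - 1) x = \<zero>\<^bsub>E s p q\<^esub>))"

definition E_infinity ::
  "(nat \<Rightarrow> int \<Rightarrow> int \<Rightarrow> ('k, 'e) module) \<Rightarrow> (nat \<Rightarrow> int \<Rightarrow> int \<Rightarrow> 'e \<Rightarrow> 'e) \<Rightarrow> int \<Rightarrow> int \<Rightarrow> ('k, 'e) module" where
  "E_infinity E d p q = E (LEAST r. stable_from E d p q r) p q"

definition converges_to ::
  "(nat \<Rightarrow> int \<Rightarrow> int \<Rightarrow> ('k::field, 'e) module) \<Rightarrow> (nat \<Rightarrow> int \<Rightarrow> int \<Rightarrow> 'e \<Rightarrow> 'e) \<Rightarrow>
   (int \<Rightarrow> ('k, 'h) module) \<Rightarrow> bool" where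
  "converges_to E d H \<longleftrightarrow>
     (\<forall>p q. \<exists>r. stable_from E d p q r) \<and>
     (\<exists>F :: int \<Rightarrow> int \<Rightarrow> 'h set.
        (\<forall>n p. is_subspace (F n p) (H n) \<and> F n (p + 1) \<subseteq> F n p) \<and>
        (\<forall>n. (\<exists>p. F n p = carrier (H n)) \<and> (\<exists>p. F n p = {\<zero>\<^bsub>H n\<^esub>})) \<and>
        (\<forall>p q. E_infinity E d p q \<simeq>\<^sub>k
           quotient ((H (p + q))\<lparr>carrier := F (p + q) p\<rparr>) (F (p + q) (p + 1))))"


section \<open>Differential graded algebras\<close>

text \<open>The sort \<open>{ring, monoid_mult}\<close> is that of unital rings, the zero ring included.\<close>

locale dga = vector_space scale
  for scale :: "'k::field \<Rightarrow> 'a::{ring, monoid_mult} \<Rightarrow> 'a" (infixr "*s" 75) +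
  fixes A :: "nat \<Rightarrow> 'a set" and \<phi> :: "'a \<Rightarrow> 'a"
  assumes scale_mult_left: "(c *s x) * y = c *s (x * y)"
    and scale_mult_right: "x * (c *s y) = c *s (x * y)"
    and subspace_A: "subspace (A m)"
    and direct_sum_A: "\<exists>!g. (\<forall>m. g m \<in> A m) \<and> finite {m. g m \<noteq> 0} \<and> x = (\<Sum>m | g m \<noteq> 0. g m)"
    and one_A: "1 \<in> A 0"
    and mult_A: "x \<in> A i \<Longrightarrow> y \<in> A j \<Longrightarrow> x * y \<in> A (i + j)"
    and linear_\<phi>: "Vector_Spaces.linear scale scale \<phi>"
    and \<phi>_A: "x \<in> A (Suc m) \<Longrightarrow> \<phi> x \<in> A m"
    and \<phi>_A0: "x \<in> A 0 \<Longrightarrow> \<phi> x = 0"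
    and \<phi>_\<phi>: "\<phi> (\<phi> x) = 0"
    and leibniz: "x \<in> A i \<Longrightarrow> \<phi> (x * y) = \<phi> x * y + (- 1) ^ i *s (x * \<phi> y)"

text \<open>
  A homogeneous element is represented by a pair \<open>(|a|, a)\<close>, a pure tensor
  \<open>a\<^sub>1 \<otimes> \<dots> \<otimes> a\<^sub>n\<close> of homogeneous elements by the list of these pairs.
\<close>

type_synonym ('k, 'a) tensor = "((nat \<times> 'a) list \<Rightarrow>\<^sub>0 'k) set"
type_synonym ('k, 'a) cochain = "('k, 'a) tensor \<Rightarrow> 'k"

definition deg :: "(nat \<times> 'a) list \<Rightarrow> nat" where
  "deg xs = sum_list (map fst xs)"

definition hmult :: "nat \<times> 'a \<Rightarrow> nat \<times> 'a \<Rightarrow> nat \<times> 'a::times" where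
  "hmult x y = (fst x + fst y, snd x * snd y)"

text \<open>The exponent \<open>\<gamma>\<^sub>n = |a\<^sub>n| (|a\<^sub>0| + \<dots> + |a\<^sub>n\<^sub>-\<^sub>1|)\<close>.\<close>

definition koszul :: "(nat \<times> 'a) list \<Rightarrow> nat" where
  "koszul xs = fst (last xs) * deg (butlast xs)"

context dga
begin

subsection \<open>Tensor powers\<close>

definition hlists :: "nat \<Rightarrow> nat \<Rightarrow> (nat \<times> 'a) list set" where
  "hlists n m = {xs. length xs = n \<and> deg xs = m \<and> (\<forall>(e, x)\<in>set xs. x \<in> A e)}"

definition free_space :: "nat \<Rightarrow> nat \<Rightarrow> ('k, (nat \<times> 'a) list \<Rightarrow>\<^sub>0 'k) module" where
  "free_space n m =
     vspace {u. Poly_Mapping.keys u \<subseteq> hlists n m} 0 (+) (\<lambda>c. Poly_Mapping.map ((*) c))"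

definition multilinearity :: "nat \<Rightarrow> nat \<Rightarrow> ((nat \<times> 'a) list \<Rightarrow>\<^sub>0 'k) set" where
  "multilinearity n m =
     {Poly_Mapping.single (xs[i := (e, x + y)]) 1
        - Poly_Mapping.single (xs[i := (e, x)]) 1 - Poly_Mapping.single (xs[i := (e, y)]) 1 | xs i e x y.
        xs \<in> hlists n m \<and> i < n \<and> e = fst (xs ! i) \<and> x \<in> A e \<and> y \<in> A e} \<union>
     {Poly_Mapping.single (xs[i := (e, c *s x)]) 1 - Poly_Mapping.single (xs[i := (e, x)]) c | xs i e c x.
        xs \<in> hlists n m \<and> i < n \<and> e = fst (xs ! i) \<and> x \<in> A e}"

definition tensor_rels :: "nat \<Rightarrow> nat \<Rightarrow> ((nat \<times> 'a) list \<Rightarrow>\<^sub>0 'k) set" where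
  "tensor_rels n m = (\<lambda>U. is_subspace U (free_space n m)) hull multilinearity n m"

text \<open>
  The total-degree-\<open>m\<close> part of the \<open>n\<close>-th tensor power of \<open>A\<close>, that is, the direct sum of
  \<open>A\<^sup>m\<^sup>1 \<otimes> \<dots> \<otimes> A\<^sup>m\<^sup>n\<close> over all \<open>m1 + \<dots> + mn = m\<close>.
\<close>

definition tensor_power :: "nat \<Rightarrow> nat \<Rightarrow> ('k, ('k, 'a) tensor) module" where
  "tensor_power n m = quotient (free_space n m) (tensor_rels n m)"

definition tensor_class :: "nat \<Rightarrow> nat \<Rightarrow> ((nat \<times> 'a) list \<Rightarrow>\<^sub>0 'k) \<Rightarrow> ('k, 'a) tensor" where
  "tensor_class n m u = tensor_rels n m +>\<^bsub>free_space n m\<^esub> u"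

definition pure :: "(nat \<times> 'a) list \<Rightarrow> ('k, 'a) tensor" where
  "pure xs = tensor_class (length xs) (deg xs) (Poly_Mapping.single xs 1)"

text \<open>The linear map with prescribed (multilinear) values on pure tensors of homogeneous elements.\<close>

definition lin_ext :: "nat \<Rightarrow> nat \<Rightarrow> ('k, 'w) module \<Rightarrow> ((nat \<times> 'a) list \<Rightarrow> 'w) \<Rightarrow> ('k, 'a) tensor \<Rightarrow> 'w" where
  "lin_ext n m W g = (THE h. h \<in> Hom_set (tensor_power n m) W \<and> (\<forall>xs\<in>hlists n m. h (pure xs) = g xs))"

text \<open>
  The differential \<open>\<phi>\<^sup>\<otimes>\<^sup>n\<close> from total degree \<open>m + 1\<close> to \<open>m\<close>.  Summands with \<open>|a\<^sub>i| = 0\<close>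
  vanish, as \<open>\<phi>\<close> vanishes on \<open>A\<^sup>0\<close>, and are left out.
\<close>

definition tensor_diff :: "nat \<Rightarrow> nat \<Rightarrow> ('k, 'a) tensor \<Rightarrow> ('k, 'a) tensor" where
  "tensor_diff n m = lin_ext n (Suc m) (tensor_power n m)
     (\<lambda>xs. tensor_class n m
        (\<Sum>i | i < n \<and> 0 < fst (xs ! i).
           Poly_Mapping.single (xs[i := (fst (xs ! i) - 1, \<phi> (snd (xs ! i)))]) ((- 1) ^ deg (take i xs))))"


subsection \<open>Cochains and operators\<close>

definition cochains :: "nat \<Rightarrow> nat \<Rightarrow> ('k, ('k, 'a) cochain) module" where
  "cochains n m = dual (tensor_power (Suc n) m)"

abbreviation cochain_of :: "nat \<Rightarrow> nat \<Rightarrow> ((nat \<times> 'a) list \<Rightarrow> 'k) \<Rightarrow> ('k, 'a) cochain" where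
  "cochain_of n m \<equiv> lin_ext (Suc n) m scalars"

text \<open>\<open>op_delta n m : C\<^sup>n(A)\<^sup>m \<rightarrow> C\<^sup>n(A)\<^sup>m\<^sup>+\<^sup>1\<close>\<close>

definition op_delta :: "nat \<Rightarrow> nat \<Rightarrow> ('k, 'a) cochain \<Rightarrow> ('k, 'a) cochain" where
  "op_delta n m f = (\<lambda>w. (- 1) ^ m * f (tensor_diff (Suc n) m w))"

text \<open>\<open>op_b n m : C\<^sup>n(A)\<^sup>m \<rightarrow> C\<^sup>n\<^sup>+\<^sup>1(A)\<^sup>m\<close>\<close>

definition op_b :: "nat \<Rightarrow> nat \<Rightarrow> ('k, 'a) cochain \<Rightarrow> ('k, 'a) cochain" where
  "op_b n m f = cochain_of (Suc n) m
     (\<lambda>xs. (\<Sum>i = 0..n. (- 1) ^ i *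
              f (pure (take i xs @ [hmult (xs ! i) (xs ! Suc i)] @ drop (i + 2) xs)))
          + (- 1) ^ (Suc n + koszul xs) * f (pure (hmult (last xs) (hd xs) # butlast (tl xs))))"

definition op_tau :: "nat \<Rightarrow> nat \<Rightarrow> ('k, 'a) cochain \<Rightarrow> ('k, 'a) cochain" where
  "op_tau n m f = cochain_of n m (\<lambda>xs. (- 1) ^ (n + koszul xs) * f (pure (last xs # butlast xs)))"

definition op_N :: "nat \<Rightarrow> nat \<Rightarrow> ('k, 'a) cochain \<Rightarrow> ('k, 'a) cochain" where
  "op_N n m f = (\<lambda>w. \<Sum>i = 0..n. (op_tau n m ^^ i) f w)"

text \<open>\<open>op_s n m, op_B n m : C\<^sup>n\<^sup>+\<^sup>1(A)\<^sup>m \<rightarrow> C\<^sup>n(A)\<^sup>m\<close>\<close>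

definition op_s :: "nat \<Rightarrow> nat \<Rightarrow> ('k, 'a) cochain \<Rightarrow> ('k, 'a) cochain" where
  "op_s n m f = cochain_of n m (\<lambda>xs. (- 1) ^ n * f (pure (xs @ [(0, 1)])))"

definition op_B :: "nat \<Rightarrow> nat \<Rightarrow> ('k, 'a) cochain \<Rightarrow> ('k, 'a) cochain" where
  "op_B n m f = op_N n m (op_s n m (\<lambda>w. f w - op_tau (Suc n) m f w))"


subsection \<open>Hochschild cohomology\<close>

definition EH :: "int \<Rightarrow> ('k, nat \<times> nat \<Rightarrow> ('k, 'a) cochain) module" where
  "EH n = dsum {(p, q). int p + int q = n} (\<lambda>(p, q). cochains p q)"

definition EH_diff :: "(nat \<times> nat \<Rightarrow> ('k, 'a) cochain) \<Rightarrow> nat \<times> nat \<Rightarrow> ('k, 'a) cochain" where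
  "EH_diff x = (\<lambda>(p, q) w.
     (if 0 < p then op_b (p - 1) q (x (p - 1, q)) w else 0) +
     (if 0 < q then (- 1) ^ p * op_delta p (q - 1) (x (p, q - 1)) w else 0))"

definition EH_B :: "(nat \<times> nat \<Rightarrow> ('k, 'a) cochain) \<Rightarrow> nat \<times> nat \<Rightarrow> ('k, 'a) cochain" where
  "EH_B x = (\<lambda>(p, q). op_B p q (x (Suc p, q)))"

definition HH :: "int \<Rightarrow> ('k, (nat \<times> nat \<Rightarrow> ('k, 'a) cochain) set) module" where
  "HH = cohom EH (\<lambda>_. EH_diff)"

text \<open>\<open>HH_B n : HH\<^sup>n \<rightarrow> HH\<^sup>n\<^sup>-\<^sup>1\<close>\<close>

definition HH_B ::
  "int \<Rightarrow> (nat \<times> nat \<Rightarrow> ('k, 'a) cochain) set \<Rightarrow> (nat \<times> nat \<Rightarrow> ('k, 'a) cochain) set" where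
  "HH_B n = cohom_map EH (\<lambda>_. EH_diff) (n - 1) EH_B"

definition trunc_diff ::
  "int \<Rightarrow> int \<Rightarrow> (nat \<times> nat \<Rightarrow> ('k, 'a) cochain) set \<Rightarrow> (nat \<times> nat \<Rightarrow> ('k, 'a) cochain) set" where
  "trunc_diff k n = (if 0 \<le> n \<and> n < k then HH_B (k - n) else (\<lambda>_. \<zero>\<^bsub>neg_trunc k HH (n + 1)\<^esub>))"


subsection \<open>Cyclic cohomology\<close>

definition EC3 :: "nat \<times> nat \<times> nat \<Rightarrow> ('k, ('k, 'a) cochain) module" where
  "EC3 = (\<lambda>(p, q, r). if p \<le> q then cochains (q - p) r else zero_space (cochains 0 r))"

definition EC :: "int \<Rightarrow> ('k, nat \<times> nat \<times> nat \<Rightarrow> ('k, 'a) cochain) module" where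
  "EC n = dsum {(p, q, r). int p + int q + int r = n} EC3"

definition EC_diff :: "(nat \<times> nat \<times> nat \<Rightarrow> ('k, 'a) cochain) \<Rightarrow> nat \<times> nat \<times> nat \<Rightarrow> ('k, 'a) cochain" where
  "EC_diff x = (\<lambda>(p, q, r) w. if p \<le> q then
     (if p < q then op_b (q - p - 1) r (x (p, q - 1, r)) w else 0) +
     (if 0 < p then op_B (q - p) r (x (p - 1, q, r)) w else 0) +
     (if 0 < r then (- 1) ^ (q - p) * op_delta (q - p) (r - 1) (x (p, q, r - 1)) w else 0)
     else 0)"

definition HC :: "int \<Rightarrow> ('k, (nat \<times> nat \<times> nat \<Rightarrow> ('k, 'a) cochain) set) module" where
  "HC = cohom EC (\<lambda>_. EC_diff)"

end

end

theory Submission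
  imports Defs "HOL-Library.Function_Algebras"
begin

text \<open>
  The cyclic complex is filtered by its first index \<open>p\<close>.  Write \<open>x\<^sub>p\<close> for the \<open>p\<close>-th column of a
  cyclic cochain \<open>x\<close> of degree \<open>n\<close>; it is a Hochschild cochain of degree \<open>n - 2p\<close>, and the
  \<open>p\<close>-th column of the differential of \<open>x\<close> is \<open>D x\<^sub>p + B x\<^sub>p\<^sub>-\<^sub>1\<close>, where \<open>D\<close> is the differential of
  the Hochschild complex.  So the graded pieces of the filtration are shifted Hochschild complexes,
  the first page of the spectral sequence of the filtration has \<open>HH\<^sup>q\<^sup>-\<^sup>p\<close> in position \<open>(p, q)\<close>, its
  differential is induced by \<open>B\<close>, and taking cohomology once more gives the second page of the
  theorem.  Concretely, an element of \<open>Z\<^sub>2\<^sup>p\<close> has a first column \<open>x\<^sub>p\<close> with \<open>D x\<^sub>p = 0\<close> and a second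
  column with \<open>B x\<^sub>p = - D x\<^sub>p\<^sub>+\<^sub>1\<close>, so that \<open>x\<^sub>p\<close> represents a class of the kernel of \<open>B\<close> on \<open>HH\<close>
  (\<open>page_2_iso_inside\<close>).  The columns with \<open>p < 0\<close> or \<open>2p > n\<close> are zero, so that the filtration is
  finite in each degree and the spectral sequence converges (\<open>pages_converge\<close>).

  What makes this work is that the cyclic differential squares to zero, that is, \<open>b\<^sup>2 = B\<^sup>2 = \<delta>\<^sup>2 = 0\<close>,
  \<open>b B + B b = 0\<close>, and \<open>\<delta>\<close> commutes with \<open>b\<close> and \<open>B\<close>.  A cochain on a tensor power is the same as a
  multilinear function of lists of homogeneous elements, by the universal property of the tensor
  power (\<open>functional_exists\<close>, \<open>mlin_cochain_eval\<close>).  On such functions the operators are signed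
  substitutions in the argument, and the identities reduce to the relations between the faces
  \<open>d\<^sub>i\<close> (multiplication of neighbours) and the rotation \<open>t\<close> (with its Koszul sign): the simplicial
  identities (\<open>face_face\<close>), \<open>t d\<^sub>i\<^sub>+\<^sub>1 = d\<^sub>i t\<close> (\<open>rot_face\<close>), and \<open>t\<close> has finite order (\<open>rot_pow\<close>).
  From them \<open>b\<^sup>2 = 0\<close>, \<open>(1 - \<tau>) b = b' (1 - \<tau>)\<close> and \<open>N b' = b N\<close> follow as for ungraded algebras,
  and adjoining the unit is a contracting homotopy of \<open>b'\<close>; hence \<open>b B + B b = N (1 - \<tau>) = 0\<close>.
\<close>

section \<open>Subquotients of a vector space\<close>

abbreviation subquotient ::
  "('k::field \<Rightarrow> 'v \<Rightarrow> 'v) \<Rightarrow> 'v set \<Rightarrow> 'v set \<Rightarrow> ('k, 'v::ab_group_add set) module" where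
  "subquotient s Z U \<equiv> quotient (vspace Z 0 (+) s) U"

definition coset :: "'v::ab_group_add set \<Rightarrow> 'v \<Rightarrow> 'v set" where
  "coset U x = (\<lambda>u. u + x) ` U"

lemma mem_coset: "x \<in> coset U y \<longleftrightarrow> x - y \<in> U"
  by (auto simp: coset_def image_iff intro: bexI[of _ "x - y"])

lemma vspace_sel [simp]:
  "carrier (vspace V z a s) = V" "zero (vspace V z a s) = z" "add (vspace V z a s) = a"
  "module.smult (vspace V z a s) = s"
  by (simp_all add: vspace_def)

lemma vspace_update [simp]: "(vspace V z a s)\<lparr>carrier := W\<rparr> = vspace W z a s"
  by (simp add: vspace_def)

lemma r_coset_vspace [simp]: "U +>\<^bsub>vspace V z (+) s\<^esub> x = coset U x"
  by (auto simp: a_r_coset_def r_coset_def coset_def)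

lemma quotient_sel:
  "carrier (quotient M U) = (\<lambda>x. U +>\<^bsub>M\<^esub> x) ` carrier M"
  "zero (quotient M U) = U"
  "w \<oplus>\<^bsub>quotient M U\<^esub> w' = (\<Union>x\<in>w. (\<lambda>y. x \<oplus>\<^bsub>M\<^esub> y) ` w')"
  "c \<odot>\<^bsub>quotient M U\<^esub> w = (\<Union>x\<in>w. U +>\<^bsub>M\<^esub> (c \<odot>\<^bsub>M\<^esub> x))"
  by (auto simp: quotient_def A_RCOSETS_def RCOSETS_def a_r_coset_def set_add_def set_mult_def)

lemma quotient_update:
  "(subquotient s Z U)\<lparr>carrier := coset U ` K\<rparr> = subquotient s K U"
  by (auto simp: quotient_def vspace_def A_RCOSETS_def RCOSETS_def a_r_coset_def set_add_def set_mult_def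
     r_coset_def coset_def fun_eq_iff)

lemma carrier_subquotient [simp]: "carrier (subquotient s Z U) = coset U ` Z"
  by (simp add: quotient_sel)

lemma zero_quotient [simp]: "\<zero>\<^bsub>quotient M U\<^esub> = U"
  by (simp add: quotient_sel)

lemma vspace_iso_refl: "M \<simeq>\<^sub>k M"
  unfolding vspace_iso_def lin_def by (rule exI[of _ id]) auto

lemma vspace_iso_trans: "M \<simeq>\<^sub>k N \<Longrightarrow> N \<simeq>\<^sub>k P \<Longrightarrow> M \<simeq>\<^sub>k P"
  unfolding vspace_iso_def
proof (elim exE conjE)
  fix f g assume a: "lin M N f" "bij_betw f (carrier M) (carrier N)"
    "lin N P g" "bij_betw g (carrier N) (carrier P)"
  then have "lin M P (g \<circ> f)" by (auto simp: lin_def Pi_iff)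
  with bij_betw_trans[OF a(2) a(4)] show "\<exists>h. lin M P h \<and> bij_betw h (carrier M) (carrier P)" by blast
qed

lemma vspace_iso_sym:
  assumes closed: "\<And>x y. x \<in> carrier M \<Longrightarrow> y \<in> carrier M \<Longrightarrow> x \<oplus>\<^bsub>M\<^esub> y \<in> carrier M"
      "\<And>c x. x \<in> carrier M \<Longrightarrow> c \<odot>\<^bsub>M\<^esub> x \<in> carrier M"
    and iso: "M \<simeq>\<^sub>k N"
  shows "N \<simeq>\<^sub>k M"
proof -
  obtain h where h: "lin M N h" "bij_betw h (carrier M) (carrier N)"
    using iso by (auto simp: vspace_iso_def)
  define g where "g = the_inv_into (carrier M) h"
  have g: "bij_betw g (carrier N) (carrier M)"
    unfolding g_def by (rule bij_betw_the_inv_into[OF h(2)])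
  have gh: "g (h x) = x" if "x \<in> carrier M" for x
    using h(2) that by (simp add: g_def bij_betw_def the_inv_into_f_f)
  have N: "carrier N = h ` carrier M" using h(2) by (simp add: bij_betw_def)
  have "g (h x \<oplus>\<^bsub>N\<^esub> h y) = x \<oplus>\<^bsub>M\<^esub> y" if "x \<in> carrier M" "y \<in> carrier M" for x y
    using h(1) that gh[of "x \<oplus>\<^bsub>M\<^esub> y"] closed by (simp add: lin_def)
  moreover have "g (c \<odot>\<^bsub>N\<^esub> h x) = c \<odot>\<^bsub>M\<^esub> x" if "x \<in> carrier M" for c x
    using h(1) that gh[of "c \<odot>\<^bsub>M\<^esub> x"] closed by (simp add: lin_def)
  ultimately have "lin N M g" unfolding lin_def N by (auto simp: gh)
  with g show ?thesis by (auto simp: vspace_iso_def)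
qed

context vector_space
begin

lemma vspace_axioms_of_ops:
  fixes M :: "('a, 'w) module"
  assumes "\<And>x y. x \<in> carrier M \<Longrightarrow> y \<in> carrier M \<Longrightarrow> x \<oplus>\<^bsub>M\<^esub> y \<in> carrier M"
    and "\<zero>\<^bsub>M\<^esub> \<in> carrier M"
    and "\<And>c x. x \<in> carrier M \<Longrightarrow> c \<odot>\<^bsub>M\<^esub> x \<in> carrier M"
    and "\<And>x y z. x \<in> carrier M \<Longrightarrow> y \<in> carrier M \<Longrightarrow> z \<in> carrier M \<Longrightarrow> (x \<oplus>\<^bsub>M\<^esub> y) \<oplus>\<^bsub>M\<^esub> z = x \<oplus>\<^bsub>M\<^esub> (y \<oplus>\<^bsub>M\<^esub> z)"
    and "\<And>x y. x \<in> carrier M \<Longrightarrow> y \<in> carrier M \<Longrightarrow> x \<oplus>\<^bsub>M\<^esub> y = y \<oplus>\<^bsub>M\<^esub> x"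
    and "\<And>x. x \<in> carrier M \<Longrightarrow> \<zero>\<^bsub>M\<^esub> \<oplus>\<^bsub>M\<^esub> x = x"
    and "\<And>x. x \<in> carrier M \<Longrightarrow> \<exists>y\<in>carrier M. y \<oplus>\<^bsub>M\<^esub> x = \<zero>\<^bsub>M\<^esub>"
    and "\<And>c d x. x \<in> carrier M \<Longrightarrow> (c + d) \<odot>\<^bsub>M\<^esub> x = c \<odot>\<^bsub>M\<^esub> x \<oplus>\<^bsub>M\<^esub> d \<odot>\<^bsub>M\<^esub> x"
    and "\<And>c x y. x \<in> carrier M \<Longrightarrow> y \<in> carrier M \<Longrightarrow> c \<odot>\<^bsub>M\<^esub> (x \<oplus>\<^bsub>M\<^esub> y) = c \<odot>\<^bsub>M\<^esub> x \<oplus>\<^bsub>M\<^esub> c \<odot>\<^bsub>M\<^esub> y"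
    and "\<And>c d x. x \<in> carrier M \<Longrightarrow> (c * d) \<odot>\<^bsub>M\<^esub> x = c \<odot>\<^bsub>M\<^esub> (d \<odot>\<^bsub>M\<^esub> x)"
    and "\<And>x. x \<in> carrier M \<Longrightarrow> 1 \<odot>\<^bsub>M\<^esub> x = x"
  shows "is_vspace M"
  by (rule moduleI[OF cring_from_type_algebra abelian_groupI])
     (insert assms, simp_all add: ring_of_type_algebra_def)

lemma is_vspace_subspace: "subspace V \<Longrightarrow> is_vspace (vspace V 0 (+) scale)"
  by (rule vspace_axioms_of_ops)
     (auto simp: subspace_add subspace_0 subspace_scale scale_left_distrib scale_right_distrib
       ac_simps intro!: bexI[of _ "- _"] subspace_neg)

lemma is_subspace_iff:
  assumes V: "subspace V"
  shows "is_subspace W (vspace V 0 (+) scale) \<longleftrightarrow> subspace W \<and> W \<subseteq> V"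
proof
  interpret Module.module "ring_of_type_algebra" "vspace V 0 (+) scale"
    by (rule is_vspace_subspace[OF V])
  have inv: "\<ominus>\<^bsub>vspace V 0 (+) scale\<^esub> x = - x" if "x \<in> V" for x
    using that V by (intro minus_equality) (auto intro: subspace_neg)
  show "subspace W \<and> W \<subseteq> V" if W: "is_subspace W (vspace V 0 (+) scale)"
  proof -
    interpret submodule W "ring_of_type_algebra" "vspace V 0 (+) scale" by (rule W)
    have "c *s x \<in> W" if "x \<in> W" for c x
      using smult_closed[of c x] that by (simp add: ring_of_type_algebra_def)
    then show ?thesis
      using subset m_closed one_closed by (auto simp: subspace_def)
  qed
  show "is_subspace W (vspace V 0 (+) scale)" if "subspace W \<and> W \<subseteq> V"
    using that by (intro submoduleI) (auto simp: inv subset_iff subspace_0 subspace_add subspace_scale subspace_neg)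
qed

lemma coset_eq_iff:
  assumes U: "subspace U"
  shows "coset U x = coset U y \<longleftrightarrow> x - y \<in> U"
proof
  assume "coset U x = coset U y"
  then have "0 + x \<in> coset U y" unfolding coset_def using subspace_0[OF U] by blast
  then show "x - y \<in> U" by (auto simp: coset_def)
next
  assume xy: "x - y \<in> U"
  show "coset U x = coset U y"
    using subspace_add[OF U _ xy] subspace_diff[OF U _ xy] by (fastforce simp: mem_coset)
qed

lemma coset_0 [simp]: "coset U 0 = U"
  by (simp add: coset_def)

lemma coset_self: "subspace U \<Longrightarrow> x \<in> coset U x"
  unfolding coset_def using subspace_0 by force

lemma coset_UN:
  assumes "subspace U" "\<And>x. x \<in> coset U x0 \<Longrightarrow> F x = F x0"
  shows "(\<Union>x\<in>coset U x0. F x) = F x0"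
  using coset_self[OF assms(1)] assms(2) by blast

lemma coset_eq_zero: "subspace U \<Longrightarrow> coset U x = U \<longleftrightarrow> x \<in> U"
  using coset_eq_iff[of U x 0] by simp

lemma coset_image_self: "subspace U \<Longrightarrow> coset U ` U = {U}"
proof -
  assume U: "subspace U"
  have "coset U ` U = (\<lambda>_. U) ` U"
    by (rule image_cong) (simp_all only: coset_eq_zero[OF U])
  then show ?thesis using subspace_0[OF U] by auto
qed

lemma coset_scale: "subspace U \<Longrightarrow> y \<in> coset U x \<Longrightarrow> coset U (c *s y) = coset U (c *s x)"
  using subspace_scale[of U "y - x" c] by (simp add: mem_coset coset_eq_iff scale_right_diff_distrib)

lemma add_coset:
  assumes U: "subspace U"
  shows "coset U x \<oplus>\<^bsub>subquotient scale Z U\<^esub> coset U y = coset U (x + y)"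
proof -
  have "w \<in> (\<Union>a\<in>coset U x. (\<lambda>b. a + b) ` coset U y)" if w: "w \<in> coset U (x + y)" for w
  proof -
    have "w = x + (w - x)" by simp
    moreover have "w - x \<in> coset U y" using w by (simp add: mem_coset algebra_simps)
    ultimately show ?thesis using coset_self[OF U, of x] by blast
  qed
  moreover have "a + b \<in> coset U (x + y)" if "a \<in> coset U x" "b \<in> coset U y" for a b
    using subspace_add[OF U, of "a - x" "b - y"] that by (simp add: mem_coset algebra_simps)
  ultimately show ?thesis by (auto simp: quotient_sel)
qed

lemma smult_coset:
  assumes U: "subspace U"
  shows "c \<odot>\<^bsub>subquotient scale Z U\<^esub> coset U x = coset U (c *s x)"
proof -
  have "(\<Union>y\<in>coset U x. coset U (c *s y)) = coset U (c *s x)"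
    by (rule coset_UN[OF U coset_scale[OF U]])
  then show ?thesis by (simp add: quotient_sel)
qed

lemma is_vspace_subquotient:
  assumes Z: "subspace Z" and U: "subspace U"
  shows "is_vspace (subquotient scale Z U)"
proof -
  note [simp] = add_coset[OF U] smult_coset[OF U]
  have 0: "U = coset U 0" by simp
  have 1: "(\<zero>\<^bsub>subquotient scale Z U\<^esub>) = coset U 0" by simp
  show ?thesis
  proof (rule vspace_axioms_of_ops, goal_cases)
    case (2) show ?case using subspace_0[OF Z] 0 by force
  next
    case (7 x)
    then obtain y where "y \<in> Z" "x = coset U y" by auto
    then have "coset U (- y) \<oplus>\<^bsub>subquotient scale Z U\<^esub> x = \<zero>\<^bsub>subquotient scale Z U\<^esub>" "- y \<in> Z"
      using subspace_neg[OF Z] by simp_all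
    then show ?case by auto
  next
    case (6 x)
    then obtain y where "y \<in> Z" "x = coset U y" by auto
    then show ?case unfolding 1 by (simp del: coset_0)
  qed (auto simp: subspace_add[OF Z] subspace_scale[OF Z] scale_left_distrib scale_right_distrib ac_simps)
qed

text \<open>The third isomorphism theorem; a coset of cosets corresponds to its union.\<close>

lemma subquotient_subquotient:
  assumes U: "subspace U" and L: "subspace L" and K: "subspace K" and UL: "U \<subseteq> L" and LK: "L \<subseteq> K"
  shows "quotient (subquotient scale K U) (coset U ` L) \<simeq>\<^sub>k subquotient scale K L"
    and "subquotient scale K L \<simeq>\<^sub>k quotient (subquotient scale K U) (coset U ` L)"
proof -
  let ?Q = "subquotient scale K U" and ?cc = "\<lambda>x. coset U ` coset L x"
  let ?R = "quotient ?Q (coset U ` L)"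
  have rc: "(coset U ` L) +>\<^bsub>?Q\<^esub> coset U x = ?cc x" for x
    unfolding a_r_coset_def r_coset_def
    using add_coset[OF U] by (force simp: coset_def[of L])
  have un: "\<Union>(?cc x) = coset L x" for x
  proof (intro equalityI subsetI)
    fix w assume "w \<in> \<Union>(?cc x)"
    then obtain y where "w - y \<in> U" "y - x \<in> L" by (auto simp: mem_coset)
    then show "w \<in> coset L x" using UL subspace_add[OF L, of "w - y" "y - x"] by (auto simp: mem_coset)
  qed (use coset_self[OF U] in blast)
  have car: "carrier ?R = ?cc ` K"
    by (simp add: quotient_sel(1)[of ?Q] image_image rc)
  have add: "?cc x \<oplus>\<^bsub>?R\<^esub> ?cc y = ?cc (x + y)" for x y
  proof -
    have "coset L (x + y) = (\<Union>a\<in>coset L x. (\<lambda>b. a + b) ` coset L y)"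
      using add_coset[OF L, of UNIV x y] by (simp add: quotient_sel)
    then show ?thesis
      by (simp add: quotient_sel(3)[of ?Q] add_coset[OF U] image_UN image_image)
  qed
  have sm: "c \<odot>\<^bsub>?R\<^esub> ?cc x = ?cc (c *s x)" for c x
  proof -
    have "(\<Union>y\<in>coset L x. ?cc (c *s y)) = ?cc (c *s x)"
      by (rule coset_UN[OF L], rule arg_cong[of _ _ "(`) _"], rule coset_scale[OF L])
    then show ?thesis by (simp add: quotient_sel(4)[of ?Q] smult_coset[OF U] rc)
  qed
  have "lin ?R (subquotient scale K L) Union"
    unfolding lin_def car by (auto simp: un add sm add_coset[OF L] smult_coset[OF L])
  moreover have "bij_betw Union (carrier ?R) (carrier (subquotient scale K L))"
  proof (rule bij_betw_imageI)
    show "inj_on Union (carrier ?R)" unfolding car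
    proof (rule inj_onI)
      fix v w assume "v \<in> ?cc ` K" "w \<in> ?cc ` K" "\<Union>v = \<Union>w"
      then show "v = w" by (auto simp: un)
    qed
    show "Union ` carrier ?R = carrier (subquotient scale K L)"
      by (simp add: car image_image un)
  qed
  ultimately show iso: "?R \<simeq>\<^sub>k subquotient scale K L" by (auto simp: vspace_iso_def)
  show "subquotient scale K L \<simeq>\<^sub>k ?R"
    by (rule vspace_iso_sym[OF _ _ iso])
       (auto simp: car add sm subspace_add[OF K] subspace_scale[OF K])
qed

end

context vector_space_pair
begin

lemma subspace_image_on:
  assumes "vs1.subspace Z" "\<And>x y. x \<in> Z \<Longrightarrow> y \<in> Z \<Longrightarrow> f (x + y) = f x + f y"
    and "\<And>c x. x \<in> Z \<Longrightarrow> f (s1 c x) = s2 c (f x)"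
  shows "vs2.subspace (f ` Z)"
proof -
  have "f 0 = 0" using assms(3)[OF vs1.subspace_0[OF assms(1)], of 0] by simp
  then show ?thesis
    using assms vs1.subspace_0[OF assms(1)] vs1.subspace_add[OF assms(1)] vs1.subspace_scale[OF assms(1)]
    unfolding vs2.subspace_def by (auto simp: image_iff) (metis, metis)
qed

lemma subspace_preimage_on:
  assumes "vs1.subspace Z" "vs2.subspace W" "\<And>x y. x \<in> Z \<Longrightarrow> y \<in> Z \<Longrightarrow> f (x + y) = f x + f y"
    and "\<And>c x. x \<in> Z \<Longrightarrow> f (s1 c x) = s2 c (f x)"
  shows "vs1.subspace {x \<in> Z. f x \<in> W}"
proof -
  have "f 0 = 0" using assms(4)[OF vs1.subspace_0[OF assms(1)], of 0] by simp
  then show ?thesis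
    using assms vs1.subspace_0[OF assms(1)] vs1.subspace_add[OF assms(1)] vs1.subspace_scale[OF assms(1)]
      vs2.subspace_0[OF assms(2)] vs2.subspace_add[OF assms(2)] vs2.subspace_scale[OF assms(2)]
    by (intro vs1.subspaceI) simp_all
qed

text \<open>
  The union on the left is how a map \<open>f\<close> of representatives acts on classes in \<^const>\<open>cohom_map\<close>; all
  members of the union are equal.
\<close>

lemma coset_image:
  assumes "vs1.subspace Z" "vs1.subspace U" "vs2.subspace U'" "U \<subseteq> Z"
    and add: "\<And>x y. x \<in> Z \<Longrightarrow> y \<in> Z \<Longrightarrow> f (x + y) = f x + f y"
    and U: "\<And>x. x \<in> U \<Longrightarrow> f x \<in> U'"
    and x: "x \<in> Z"
  shows "(\<Union>y\<in>coset U x. coset U' (f y)) = coset U' (f x)"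
proof (rule vs1.coset_UN[OF assms(2)])
  fix y assume "y \<in> coset U x"
  then obtain u where u: "u \<in> U" "y = u + x" by (auto simp: coset_def)
  then have "f y = f u + f x" using assms by auto
  then show "coset U' (f y) = coset U' (f x)"
    using u U by (simp add: vs2.coset_eq_iff[OF assms(3)])
qed

lemma lin_subquotient:
  assumes Z: "vs1.subspace Z" and Us: "vs1.subspace U" "vs2.subspace U'" "U \<subseteq> Z"
    and f: "\<And>x. x \<in> Z \<Longrightarrow> f x \<in> Z'"
    and add: "\<And>x y. x \<in> Z \<Longrightarrow> y \<in> Z \<Longrightarrow> f (x + y) = f x + f y"
    and scale: "\<And>c x. x \<in> Z \<Longrightarrow> f (s1 c x) = s2 c (f x)"
    and U: "\<And>x. x \<in> U \<Longrightarrow> f x \<in> U'"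
  shows "lin (subquotient s1 Z U) (subquotient s2 Z' U') (\<lambda>w. \<Union>y\<in>w. coset U' (f y))"
proof -
  note im = coset_image[OF Z Us, of f, OF add U]
  show ?thesis
    unfolding lin_def
    by (auto simp: im vs1.add_coset[OF Us(1)] vs1.smult_coset[OF Us(1)] vs2.add_coset[OF Us(2)]
      vs2.smult_coset[OF Us(2)] f vs1.subspace_add[OF Z] vs1.subspace_scale[OF Z] add scale simp del: UN_simps)
qed

text \<open>
  The isomorphisms below come from maps of representatives that are injective and surjective modulo
  the subspaces divided out.
\<close>

lemma subquotient_iso:
  assumes Z: "vs1.subspace Z" and Us: "vs1.subspace U" "vs2.subspace U'" "U \<subseteq> Z"
    and f: "\<And>x. x \<in> Z \<Longrightarrow> f x \<in> Z'"
    and add: "\<And>x y. x \<in> Z \<Longrightarrow> y \<in> Z \<Longrightarrow> f (x + y) = f x + f y"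
    and scale: "\<And>c x. x \<in> Z \<Longrightarrow> f (s1 c x) = s2 c (f x)"
    and inj: "\<And>x. x \<in> Z \<Longrightarrow> f x \<in> U' \<longleftrightarrow> x \<in> U"
    and surj: "\<And>y. y \<in> Z' \<Longrightarrow> \<exists>x\<in>Z. y - f x \<in> U'"
  shows "subquotient s1 Z U \<simeq>\<^sub>k subquotient s2 Z' U'"
proof -
  let ?h = "\<lambda>w. \<Union>y\<in>w. coset U' (f y)"
  have U: "f x \<in> U'" if "x \<in> U" for x using that inj Us(3) by blast
  note im = coset_image[OF Z Us, of f, OF add U]
  have "bij_betw ?h (coset U ` Z) (coset U' ` Z')"
  proof (rule bij_betw_imageI)
    show "inj_on ?h (coset U ` Z)"
    proof (rule inj_onI)
      fix v w assume "v \<in> coset U ` Z" "w \<in> coset U ` Z" and eq: "?h v = ?h w"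
      then obtain x y where xy: "x \<in> Z" "y \<in> Z" "v = coset U x" "w = coset U y" by blast
      have d: "x - y \<in> Z" using xy vs1.subspace_diff[OF Z] by blast
      have "f x = f (x - y) + f y" using add[OF d xy(2)] by simp
      moreover have "f x - f y \<in> U'" using eq xy im by (simp add: vs2.coset_eq_iff[OF Us(2)])
      ultimately have "x - y \<in> U" using inj[OF d] by simp
      then show "v = w" by (simp add: xy vs1.coset_eq_iff[OF Us(1)])
    qed
    have "coset U' y \<in> (\<lambda>x. coset U' (f x)) ` Z" if "y \<in> Z'" for y
      using surj[OF that] by (auto simp: vs2.coset_eq_iff[OF Us(2)])
    then show "?h ` coset U ` Z = coset U' ` Z'"
      using f by (auto simp: image_image im simp del: UN_simps)
  qed
  then show ?thesis
    using lin_subquotient[OF Z Us f add scale U] by (auto simp: vspace_iso_def)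
qed

end

section \<open>The spectral sequence of a filtered complex\<close>

lemma (in vector_space) is_subspace_subquotient:
  assumes Z: "subspace Z" and U: "subspace U" and K: "subspace K" and KZ: "K \<subseteq> Z"
  shows "is_subspace (coset U ` K) (subquotient scale Z U)"
proof -
  interpret Module.module "ring_of_type_algebra" "subquotient scale Z U"
    by (rule is_vspace_subquotient[OF Z U])
  have inv: "\<ominus>\<^bsub>subquotient scale Z U\<^esub> coset U x = coset U (- x)" if "x \<in> K" for x
    using that KZ subspace_neg[OF Z]
    by (intro minus_equality) (auto simp: add_coset[OF U])
  show ?thesis
  proof (rule submoduleI)
    show "\<zero>\<^bsub>subquotient scale Z U\<^esub> \<in> coset U ` K"
      using imageI[OF subspace_0[OF K], of "coset U"] by simp
  qed (use KZ in \<open>auto simp: inv add_coset[OF U] smult_coset[OF U] subspace_neg[OF K] subspace_add[OF K] subspace_scale[OF K]\<close>)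
qed

locale cochain_complex = vector_space scale
  for scale :: "'k::field \<Rightarrow> 'v::ab_group_add \<Rightarrow> 'v" +
  fixes C :: "int \<Rightarrow> 'v set" and d :: "'v \<Rightarrow> 'v"
  assumes subspace_C: "subspace (C n)"
    and d_C: "x \<in> C n \<Longrightarrow> d x \<in> C (n + 1)"
    and d_add: "x \<in> C n \<Longrightarrow> y \<in> C n \<Longrightarrow> d (x + y) = d x + d y"
    and d_scale: "x \<in> C n \<Longrightarrow> d (scale c x) = scale c (d x)"
    and d_d: "x \<in> C n \<Longrightarrow> d (d x) = 0"
begin

sublocale pair: vector_space_pair scale scale ..

definition cocycles :: "int \<Rightarrow> 'v set" where
  "cocycles n = {x \<in> C n. d x = 0}"

abbreviation coboundaries :: "int \<Rightarrow> 'v set" where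
  "coboundaries n \<equiv> d ` C (n - 1)"

lemma d_0 [simp]: "d 0 = 0"
  using d_add[of 0 0 0] subspace_0[OF subspace_C] by simp

lemma d_diff: "x \<in> C n \<Longrightarrow> y \<in> C n \<Longrightarrow> d (x - y) = d x - d y"
  using d_add[of "x - y" n y] subspace_diff[OF subspace_C] by (simp add: algebra_simps)

lemma d_neg: "x \<in> C n \<Longrightarrow> d (- x) = - d x"
  using d_diff[of 0 n x] subspace_0[OF subspace_C] by simp

lemma cohom_eq_subquotient:
  "cohom (\<lambda>n. vspace (C n) 0 (+) scale) (\<lambda>_. d) n = subquotient scale (cocycles n) (coboundaries n)"
  by (simp add: cohom_def cobound_def cocycles_def a_kernel_def')

lemma subspace_cocycles: "subspace (cocycles n)"
  using subspace_C[of n] by (auto simp: subspace_def cocycles_def d_add d_scale)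

lemma subspace_image: "subspace U \<Longrightarrow> U \<subseteq> C n \<Longrightarrow> subspace (d ` U)"
  using d_add[of _ n] d_scale[of _ n] by (intro pair.subspace_image_on) blast+

lemma subspace_coboundaries: "subspace (coboundaries n)"
  by (rule subspace_image[OF subspace_C order_refl])

lemma coboundaries_cocycles: "coboundaries n \<subseteq> cocycles n"
  using d_C[of _ "n - 1"] d_d by (auto simp: cocycles_def)

end

text \<open>
  \<open>F p\<close> contains everything for \<open>p \<le> 0\<close> and only 0 in degrees below \<open>p\<close>, so that only finitely many
  steps of the filtration matter in each degree.
\<close>

locale filtered_complex = cochain_complex scale C d
  for scale :: "'k::field \<Rightarrow> 'v::ab_group_add \<Rightarrow> 'v" and C d +
  fixes F :: "int \<Rightarrow> 'v set"
  assumes subspace_F: "subspace (F p)"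
    and F_antimono: "p \<le> p' \<Longrightarrow> F p' \<subseteq> F p"
    and d_F: "x \<in> C n \<Longrightarrow> x \<in> F p \<Longrightarrow> d x \<in> F p"
    and F_nonpos: "p \<le> 0 \<Longrightarrow> C n \<subseteq> F p"
    and F_large: "n < p \<Longrightarrow> C n \<inter> F p \<subseteq> {0}"
begin

text \<open>
  The page \<open>r\<close> at \<open>(p, q)\<close> is \<open>Z\<^sub>r\<^sup>p / (Z\<^sub>r\<^sub>-\<^sub>1\<^sup>p\<^sup>+\<^sup>1 + d Z\<^sub>r\<^sub>-\<^sub>1\<^sup>p\<^sup>-\<^sup>r\<^sup>+\<^sup>1)\<close>: cochains that are cocycles up to
  \<open>r\<close> filtration steps, modulo those that are deeper in the filtration and the coboundaries of
  cochains that start fewer than \<open>r\<close> steps earlier.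
\<close>

definition Zr :: "int \<Rightarrow> int \<Rightarrow> int \<Rightarrow> 'v set" where
  "Zr r p n = {x \<in> C n \<inter> F p. d x \<in> F (p + r)}"

definition Br :: "int \<Rightarrow> int \<Rightarrow> int \<Rightarrow> 'v set" where
  "Br r p n = {y + d z | y z. y \<in> Zr (r - 1) (p + 1) n \<and> z \<in> Zr (r - 1) (p - r + 1) (n - 1)}"

definition page :: "nat \<Rightarrow> int \<Rightarrow> int \<Rightarrow> ('k, 'v set) module" where
  "page r p q = subquotient scale (Zr (int r) p (p + q)) (Br (int r) p (p + q))"

definition page_diff :: "nat \<Rightarrow> int \<Rightarrow> int \<Rightarrow> 'v set \<Rightarrow> 'v set" where
  "page_diff r p q w = (\<Union>x\<in>w. coset (Br (int r) (p + int r) (p + q + 1)) (d x))"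

lemma F_C_nonpos: "x \<in> C n \<Longrightarrow> p \<le> 0 \<Longrightarrow> x \<in> F p"
  using F_nonpos by blast

lemma F_C_large: "x \<in> C n \<Longrightarrow> x \<in> F p \<Longrightarrow> n < p \<Longrightarrow> x = 0"
  using F_large by blast

lemma Zr_mono: "x \<in> Zr r' p' n \<Longrightarrow> p \<le> p' \<Longrightarrow> p + r \<le> p' + r' \<Longrightarrow> x \<in> Zr r p n"
  unfolding Zr_def using F_antimono[of p p'] F_antimono[of "p + r" "p' + r'"] by blast

lemma subspace_Zr: "subspace (Zr r p n)"
  using subspace_C[of n] subspace_F[of p] subspace_F[of "p + r"]
  by (auto simp: subspace_def Zr_def d_add d_scale)

lemma Zr_C: "x \<in> Zr r p n \<Longrightarrow> x \<in> C n"
  by (simp add: Zr_def)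

lemma subspace_Br: "subspace (Br r p n)"
proof -
  have "subspace {y + z | y z. y \<in> Zr (r - 1) (p + 1) n \<and> z \<in> d ` Zr (r - 1) (p - r + 1) (n - 1)}"
    by (rule subspace_sums[OF subspace_Zr subspace_image[OF subspace_Zr]]) (auto simp: Zr_def)
  moreover have "{y + z | y z. y \<in> Zr (r - 1) (p + 1) n \<and> z \<in> d ` Zr (r - 1) (p - r + 1) (n - 1)} = Br r p n"
    unfolding Br_def by blast
  ultimately show ?thesis by simp
qed

lemma BrI: "y \<in> Zr (r - 1) (p + 1) n \<Longrightarrow> z \<in> Zr (r - 1) (p - r + 1) (n - 1) \<Longrightarrow> y + d z \<in> Br r p n"
  unfolding Br_def by blast

lemma Zr_Br: "y \<in> Zr (r - 1) (p + 1) n \<Longrightarrow> y \<in> Br r p n"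
  using BrI[of y r p n 0] subspace_0[OF subspace_Zr] by simp

lemma d_Zr_Br: "z \<in> Zr (r - 1) (p - r + 1) (n - 1) \<Longrightarrow> d z \<in> Br r p n"
  using BrI[of 0 r p n z] subspace_0[OF subspace_Zr] by simp

lemma Br_Zr: "Br r p n \<subseteq> Zr r p n"
proof
  fix x assume "x \<in> Br r p n"
  then obtain y z where x: "x = y + d z" and y: "y \<in> Zr (r - 1) (p + 1) n"
    and z: "z \<in> Zr (r - 1) (p - r + 1) (n - 1)" by (auto simp: Br_def)
  have "y \<in> Zr r p n" using y by (rule Zr_mono) auto
  moreover have "d z \<in> Zr r p n"
    using z d_C[of z "n - 1"] subspace_0[OF subspace_F] by (auto simp: Zr_def d_d)
  ultimately show "x \<in> Zr r p n" unfolding x by (rule subspace_add[OF subspace_Zr])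
qed

lemma d_Zr: "x \<in> Zr r p n \<Longrightarrow> d x \<in> Zr r (p + r) (n + 1)"
  using d_C[of x n] subspace_0[OF subspace_F] by (auto simp: Zr_def d_d)

lemma d_Br:
  assumes "x \<in> Br r p n"
  shows "d x \<in> Br r (p + r) (n + 1)"
proof -
  obtain y z where x: "x = y + d z" and y: "y \<in> Zr (r - 1) (p + 1) n"
    and z: "z \<in> Zr (r - 1) (p - r + 1) (n - 1)" using assms by (auto simp: Br_def)
  have "d x = d y" using d_add[of y n "d z"] Zr_C[OF y] Zr_C[OF z] d_C[of z "n - 1"] by (simp add: x d_d)
  then show ?thesis using y d_Zr_Br[of y r "p + r" "n + 1"] by (simp add: add.commute)
qed

lemma page_diff_coset:
  assumes "x \<in> Zr (int r) p (p + q)"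
  shows "page_diff r p q (coset (Br (int r) p (p + q)) x) = coset (Br (int r) (p + int r) (p + q + 1)) (d x)"
  unfolding page_diff_def
  by (rule pair.coset_image[OF subspace_Zr subspace_Br subspace_Br Br_Zr _ d_Br assms])
     (auto intro: d_add Zr_C)

lemma is_vspace_page: "is_vspace (page r p q)"
  unfolding page_def by (rule is_vspace_subquotient[OF subspace_Zr subspace_Br])

lemma lin_page_diff: "lin (page r p q) (page r (p + int r) (q - int r + 1)) (page_diff r p q)"
proof -
  have eq: "p + int r + (q - int r + 1) = p + q + 1" by simp
  show ?thesis
    unfolding page_def page_diff_def[abs_def] eq
    by (rule pair.lin_subquotient[OF subspace_Zr subspace_Br subspace_Br Br_Zr d_Zr _ _ d_Br])
       (auto intro: d_add d_scale Zr_C)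
qed

lemma kernel_page_diff:
  "a_kernel (page r p q) (page r (p + int r) (q - int r + 1)) (page_diff r p q) =
     coset (Br (int r) p (p + q)) ` {x \<in> Zr (int r) p (p + q). d x \<in> Br (int r) (p + int r) (p + q + 1)}"
proof -
  have eq: "p + int r + (q - int r + 1) = p + q + 1" by simp
  have "page_diff r p q (coset (Br (int r) p (p + q)) x) = Br (int r) (p + int r) (p + q + 1) \<longleftrightarrow>
      d x \<in> Br (int r) (p + int r) (p + q + 1)" if "x \<in> Zr (int r) p (p + q)" for x
    by (simp add: page_diff_coset[OF that] coset_eq_zero[OF subspace_Br])
  then have "{w \<in> coset (Br (int r) p (p + q)) ` Zr (int r) p (p + q).
      page_diff r p q w = Br (int r) (p + int r) (p + q + 1)} =
    coset (Br (int r) p (p + q)) ` {x \<in> Zr (int r) p (p + q). d x \<in> Br (int r) (p + int r) (p + q + 1)}"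
    by blast
  then show ?thesis unfolding a_kernel_def' page_def eq by simp
qed

lemma image_page_diff:
  "page_diff r (p - int r) (q + int r - 1) ` carrier (page r (p - int r) (q + int r - 1)) =
     coset (Br (int r) p (p + q)) ` (\<lambda>(x, y). d x + y) ` (Zr (int r) (p - int r) (p + q - 1) \<times> Br (int r) p (p + q))"
proof -
  have eq: "p - int r + (q + int r - 1) = p + q - 1" by simp
  have "page_diff r (p - int r) (q + int r - 1) ` carrier (page r (p - int r) (q + int r - 1)) =
    (\<lambda>x. coset (Br (int r) p (p + q)) (d x)) ` Zr (int r) (p - int r) (p + q - 1)"
    using page_diff_coset[of _ r "p - int r" "q + int r - 1"]
    by (simp add: page_def eq image_image)
  moreover have "coset (Br (int r) p (p + q)) (d x + y) = coset (Br (int r) p (p + q)) (d x)"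
    if "y \<in> Br (int r) p (p + q)" for x y
    using that by (simp add: coset_eq_iff[OF subspace_Br])
  moreover have "0 \<in> Br (int r) p (p + q)" by (rule subspace_0[OF subspace_Br])
  ultimately show ?thesis by (force simp: image_iff)
qed

text \<open>
  Let the class of \<open>v\<close> be a cocycle on page \<open>r\<close>, so that \<open>d v = y + d z\<close> with \<open>y\<close> one step deeper
  than required and \<open>z\<close> divided out in the class of \<open>v\<close>.  Then \<open>v - z\<close> represents the same class and lies in \<open>Z\<^sub>r\<^sub>+\<^sub>1\<close>.
  So the inclusion of \<open>Z\<^sub>r\<^sub>+\<^sub>1\<close> into the representatives of cocycles is onto modulo coboundaries.
\<close>

lemma next_page:
  assumes r: "r \<ge> 1"
  shows "page (Suc r) p q \<simeq>\<^sub>k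
    quotient
      ((page r p q)\<lparr>carrier := a_kernel (page r p q) (page r (p + int r) (q - int r + 1)) (page_diff r p q)\<rparr>)
      (page_diff r (p - int r) (q + int r - 1) ` carrier (page r (p - int r) (q + int r - 1)))"
proof -
  define n where "n = p + q"
  \<comment> \<open>\<open>K\<close> and \<open>L\<close> consist of the representatives of cocycles and coboundaries of the page.\<close>
  define K where "K = {x \<in> Zr r p n. d x \<in> Br r (p + int r) (n + 1)}"
  define L where "L = (\<lambda>(x, y). d x + y) ` (Zr r (p - int r) (n - 1) \<times> Br r p n)"
  have L_eq: "L = {y + z | y z. y \<in> d ` Zr r (p - int r) (n - 1) \<and> z \<in> Br r p n}"
    unfolding L_def by (auto simp: image_def)
  have sL: "subspace L"
    unfolding L_eq
    by (rule subspace_sums[OF subspace_image[OF subspace_Zr] subspace_Br]) (rule subsetI, erule Zr_C)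
  have sK: "subspace K"
    unfolding K_def
    by (rule pair.subspace_preimage_on[OF subspace_Zr subspace_Br]) (auto intro: d_add d_scale Zr_C)
  have BL: "Br r p n \<subseteq> L"
  proof
    fix x assume "x \<in> Br r p n"
    then have "(\<lambda>(x, y). d x + y) (0, x) \<in> L"
      unfolding L_def using subspace_0[OF subspace_Zr] by (intro imageI) simp
    then show "x \<in> L" by simp
  qed
  have BK: "Br r p n \<subseteq> K"
    unfolding K_def using Br_Zr[of r p n] d_Br[of _ r p n] by blast
  have LK: "L \<subseteq> K"
  proof
    fix w assume "w \<in> L"
    then obtain x y where xy: "w = d x + y" "x \<in> Zr r (p - int r) (n - 1)" "y \<in> Br r p n"
      by (auto simp: L_def)
    have "d x \<in> K" using d_Zr[OF xy(2)] d_d[OF Zr_C[OF xy(2)]] subspace_0[OF subspace_Br] by (simp add: K_def)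
    moreover have "y \<in> K" using BK xy(3) by blast
    ultimately show "w \<in> K" unfolding xy(1) by (rule subspace_add[OF sK])
  qed
  have "subquotient scale (Zr (int r + 1) p n) (Br (int r + 1) p n) \<simeq>\<^sub>k subquotient scale K L"
  proof (rule pair.subquotient_iso[OF subspace_Zr subspace_Br sL Br_Zr])
    show "x \<in> K" if "x \<in> Zr (int r + 1) p n" for x
    proof -
      have "x \<in> Zr r p n" by (rule Zr_mono[OF that]) auto
      moreover have "d x \<in> F (p + int r + 1)" using that by (simp add: Zr_def add.assoc)
      moreover have "d x \<in> Zr (int r - 1) (p + int r + 1) (n + 1)"
        using calculation d_C[OF Zr_C[OF that]] d_d[OF Zr_C[OF that]] subspace_0[OF subspace_F]
        by (simp add: Zr_def)
      ultimately show ?thesis using Zr_Br by (simp add: K_def)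
    qed
    show "x \<in> L \<longleftrightarrow> x \<in> Br (int r + 1) p n" if x: "x \<in> Zr (int r + 1) p n" for x
    proof
      assume "x \<in> L"
      then obtain u y z where w: "x = d u + (y + d z)" "u \<in> Zr r (p - int r) (n - 1)"
        "y \<in> Zr (int r - 1) (p + 1) n" "z \<in> Zr (int r - 1) (p - int r + 1) (n - 1)"
        by (auto simp: L_def Br_def)
      have C: "u \<in> C (n - 1)" "z \<in> C (n - 1)" "y \<in> C n" using w Zr_C by auto
      have uz: "u + z \<in> Zr r (p - int r) (n - 1)"
        using w(4) by (intro subspace_add[OF subspace_Zr w(2)] Zr_mono[OF w(4)]) auto
      have xyz: "x = y + d (u + z)" using d_add[OF C(1,2)] by (simp add: w(1) add.left_commute)
      have "d x = d y"
        using d_add[of y n "d (u + z)"] C d_C[of "u + z" "n - 1"] d_d[of "u + z" "n - 1"]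
        by (simp add: xyz subspace_add[OF subspace_C])
      then have "y \<in> Zr r (p + 1) n" using x w(3) by (simp add: Zr_def add.assoc add.commute[of 1])
      then show "x \<in> Br (int r + 1) p n"
        unfolding xyz using uz by (intro BrI) auto
    next
      assume "x \<in> Br (int r + 1) p n"
      then obtain y z where w: "x = y + d z" "y \<in> Zr r (p + 1) n" "z \<in> Zr r (p - int r) (n - 1)"
        by (auto simp: Br_def)
      have "y \<in> Br r p n" by (intro Zr_Br Zr_mono[OF w(2)]) auto
      then have "(\<lambda>(x, y). d x + y) (z, y) \<in> L" unfolding L_def using w(3) by (intro imageI) simp
      then show "x \<in> L" by (simp add: w(1) add.commute)
    qed
    show "\<exists>x\<in>Zr (int r + 1) p n. v - x \<in> L" if "v \<in> K" for v
    proof -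
      from that obtain y z where w: "d v = y + d z" "y \<in> Zr (int r - 1) (p + int r + 1) (n + 1)"
         "z \<in> Zr (int r - 1) (p + 1) n" and v: "v \<in> Zr r p n"
        by (auto simp: K_def Br_def)
      have "d (v - z) = y" using w(1) d_diff[OF Zr_C[OF v] Zr_C[OF w(3)]] by simp
      moreover have "v - z \<in> Zr r p n"
        using v by (rule subspace_diff[OF subspace_Zr]) (rule Zr_mono[OF w(3)], auto)
      ultimately have "v - z \<in> Zr (int r + 1) p n"
        using w(2) by (simp add: Zr_def add.assoc)
      moreover have "v - (v - z) \<in> L" using Zr_Br[OF w(3)] BL by auto
      ultimately show ?thesis by blast
    qed
  qed (auto intro: d_add d_scale Zr_C)
  then have iso: "page (Suc r) p q \<simeq>\<^sub>k quotient (subquotient scale K (Br r p n)) (coset (Br r p n) ` L)"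
    using vspace_iso_trans[OF _ subquotient_subquotient(2)[OF subspace_Br sL sK BL LK]]
    by (simp add: page_def n_def add.commute)
  show ?thesis
    unfolding kernel_page_diff image_page_diff
    using iso by (simp add: page_def n_def K_def L_def quotient_update)
qed

lemma spectral_sequence_pages: "spectral_sequence page page_diff"
  unfolding spectral_sequence_def
proof (intro allI impI conjI ballI)
  fix r :: nat and p q :: int assume r: "2 \<le> r"
  show "is_vspace (page r p q)" by (rule is_vspace_page)
  show "lin (page r p q) (page r (p + int r) (q - int r + 1)) (page_diff r p q)" by (rule lin_page_diff)
  show "page (Suc r) p q \<simeq>\<^sub>k
    quotient
      ((page r p q)\<lparr>carrier := a_kernel (page r p q) (page r (p + int r) (q - int r + 1)) (page_diff r p q)\<rparr>)
      (page_diff r (p - int r) (q + int r - 1) ` carrier (page r (p - int r) (q + int r - 1)))"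
    using r by (intro next_page) simp
  fix w assume "w \<in> carrier (page r p q)"
  then obtain x where x: "x \<in> Zr r p (p + q)" "w = coset (Br r p (p + q)) x"
    by (auto simp: page_def)
  have eq: "p + int r + (q - int r + 1) = p + q + 1" "p + 2 * int r + (q - 2 * int r + 2) = p + q + 2"
    by simp_all
  have "page_diff r (p + int r) (q - int r + 1) (coset (Br r (p + int r) (p + q + 1)) (d x))
      = coset (Br r (p + int r + int r) (p + q + 1 + 1)) (d (d x))"
    using page_diff_coset[of "d x" r "p + int r" "q - int r + 1"] d_Zr[OF x(1)] unfolding eq by simp
  then show "page_diff r (p + int r) (q - int r + 1) (page_diff r p q w) =
    \<zero>\<^bsub>page r (p + 2 * int r) (q - 2 * int r + 2)\<^esub>"
    unfolding x(2) page_diff_coset[OF x(1)] page_def eq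
    by (simp add: d_d[OF Zr_C[OF x(1)]] add.assoc)
qed

text \<open>Here \<open>p + r\<close> exceeds the degree \<open>p + q + 1\<close> of \<open>d x\<close>, so that \<open>d x \<in> F (p + r)\<close> means
  \<open>d x = 0\<close>.\<close>

lemma Zr_large: "q + 1 < r \<Longrightarrow> Zr r p (p + q) = cocycles (p + q) \<inter> F p"
proof -
  assume r: "q + 1 < r"
  have "d x \<in> F (p + r) \<longleftrightarrow> d x = 0" if "x \<in> C (p + q)" for x
    using F_C_large[OF d_C[OF that], of "p + r"] subspace_0[OF subspace_F, of "p + r"] r by auto
  then show ?thesis by (auto simp: Zr_def cocycles_def)
qed

lemma page_diff_from_eq_0:
  assumes s: "q + 1 < int s" and w: "w \<in> carrier (page s p q)"
  shows "page_diff s p q w = \<zero>\<^bsub>page s (p + int s) (q - int s + 1)\<^esub>"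
proof -
  obtain x where x: "x \<in> Zr s p (p + q)" "w = coset (Br s p (p + q)) x"
    using w by (auto simp: page_def)
  have "d x = 0" using x(1) by (simp add: Zr_large[OF s] cocycles_def)
  then have "page_diff s p q w = Br s (p + int s) (p + q + 1)"
    using page_diff_coset[OF x(1)] by (simp add: x(2))
  moreover have "p + int s + (q - int s + 1) = p + q + 1" by simp
  ultimately show ?thesis unfolding page_def by (simp only: zero_quotient)
qed

text \<open>
  The source starts in a negative filtration index, where the filtration is constant; so its
  elements lie one step deeper as well, and their coboundaries are divided out in the target.
\<close>

lemma page_diff_to_eq_0:
  assumes s: "p < int s" and w: "w \<in> carrier (page s (p - int s) (q + int s - 1))"
  shows "page_diff s (p - int s) (q + int s - 1) w = \<zero>\<^bsub>page s p q\<^esub>"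
proof -
  have eq: "p - int s + (q + int s - 1) = p + q - 1" by simp
  obtain x where x: "x \<in> Zr s (p - int s) (p + q - 1)" "w = coset (Br s (p - int s) (p + q - 1)) x"
    using w unfolding page_def eq by auto
  have "x \<in> Zr (int s - 1) (p - int s + 1) (p + q - 1)"
    using x(1) F_C_nonpos[OF Zr_C[OF x(1)], of "p - int s + 1"] s by (simp add: Zr_def)
  then have "d x \<in> Br s p (p + q)" by (rule d_Zr_Br)
  then have "coset (Br s p (p + q)) (d x) = Br s p (p + q)" by (simp only: coset_eq_zero[OF subspace_Br])
  moreover have "page_diff s (p - int s) (q + int s - 1) w = coset (Br s p (p + q)) (d x)"
    using page_diff_coset[of x s "p - int s" "q + int s - 1"] x unfolding eq by simp
  ultimately show ?thesis unfolding page_def by (simp only: zero_quotient)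
qed

lemma stable_from_large:
  assumes r: "2 \<le> r" "q + 1 < int r" "p < int r"
  shows "stable_from page page_diff p q r"
  unfolding stable_from_def
proof (intro conjI allI impI)
  show "2 \<le> r" by (rule r(1))
  fix s :: nat assume s: "r \<le> s"
  have s': "q + 1 < int s" "p < int s" using r s by simp_all
  show "\<forall>w\<in>carrier (page s p q). page_diff s p q w = \<zero>\<^bsub>page s (p + int s) (q - int s + 1)\<^esub>"
    by (rule ballI) (rule page_diff_from_eq_0[OF s'(1)])
  show "\<forall>w\<in>carrier (page s (p - int s) (q + int s - 1)).
      page_diff s (p - int s) (q + int s - 1) w = \<zero>\<^bsub>page s p q\<^esub>"
    by (rule ballI) (rule page_diff_to_eq_0[OF s'(2)])
qed

text \<open>
  When all differentials at a position vanish, the next page is the page divided by zero.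
\<close>

lemma stable_pages_iso:
  assumes st: "stable_from page page_diff p q r" and s: "r \<le> s"
  shows "page s p q \<simeq>\<^sub>k page r p q"
  using s
proof (induction s rule: dec_induct)
  case base show ?case by (rule vspace_iso_refl)
next
  case (step s)
  let ?B = "Br s p (p + q)" and ?Z = "Zr s p (p + q)"
  have z: "page_diff s p q w = \<zero>\<^bsub>page s (p + int s) (q - int s + 1)\<^esub>" if "w \<in> carrier (page s p q)" for w
    using st step.hyps(1) that unfolding stable_from_def by blast
  have ker: "a_kernel (page s p q) (page s (p + int s) (q - int s + 1)) (page_diff s p q) = coset ?B ` ?Z"
    using z by (auto simp: a_kernel_def' page_def)
  have "page_diff s (p - int s) (q + int s - 1) w = ?B"
    if "w \<in> carrier (page s (p - int s) (q + int s - 1))" for w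
  proof -
    have "page_diff s (p - int s) (q + int s - 1) w = \<zero>\<^bsub>page s p q\<^esub>"
      using st step.hyps(1) that unfolding stable_from_def by blast
    then show ?thesis by (simp add: page_def)
  qed
  moreover have "carrier (page s (p - int s) (q + int s - 1)) \<noteq> {}"
    using subspace_0[OF subspace_Zr] by (auto simp: page_def)
  ultimately have "page_diff s (p - int s) (q + int s - 1) ` carrier (page s (p - int s) (q + int s - 1)) = {?B}"
    by auto
  also have "{?B} = coset ?B ` ?B" by (rule coset_image_self[OF subspace_Br, symmetric])
  finally have im: "page_diff s (p - int s) (q + int s - 1) ` carrier (page s (p - int s) (q + int s - 1)) = coset ?B ` ?B" .
  have "page (Suc s) p q \<simeq>\<^sub>k quotient ((page s p q)\<lparr>carrier := coset ?B ` ?Z\<rparr>) (coset ?B ` ?B)"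
    using next_page[of s p q] st step.hyps unfolding ker im by (simp add: stable_from_def)
  moreover have "(page s p q)\<lparr>carrier := coset ?B ` ?Z\<rparr> = subquotient scale ?Z ?B"
    unfolding page_def by (rule quotient_update)
  moreover have "quotient (subquotient scale ?Z ?B) (coset ?B ` ?B) \<simeq>\<^sub>k page s p q"
    unfolding page_def
    by (rule subquotient_subquotient(1)[OF subspace_Br subspace_Br subspace_Zr order_refl Br_Zr])
  ultimately have "page (Suc s) p q \<simeq>\<^sub>k page s p q"
    by (metis vspace_iso_trans)
  then show ?case using step.IH by (rule vspace_iso_trans)
qed

definition cohom_filtration :: "int \<Rightarrow> int \<Rightarrow> 'v set set" where
  "cohom_filtration n p = coset (coboundaries n) ` (cocycles n \<inter> F p)"

lemma subspace_cocycles_F: "subspace (cocycles n \<inter> F p)"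
  by (rule subspace_inter[OF subspace_cocycles subspace_F])

text \<open>
  On a late page \<open>Z\<^sub>r\<^sup>p\<close> consists of the cocycles in \<open>F p\<close>, and every coboundary in \<open>F p\<close> is divided
  out; so the page is the graded piece of the filtration that \<open>F\<close> induces on cohomology.
\<close>

lemma page_iso_graded:
  assumes r: "q + 2 < int r" "p < int r"
  shows "page r p q \<simeq>\<^sub>k quotient
    ((subquotient scale (cocycles (p + q)) (coboundaries (p + q)))\<lparr>carrier := cohom_filtration (p + q) p\<rparr>)
    (cohom_filtration (p + q) (p + 1))"
proof -
  define n where "n = p + q"
  define K where "K p = {y + z | y z. y \<in> cocycles n \<inter> F p \<and> z \<in> coboundaries n}" for p
  note B = subspace_coboundaries[of n]
  have sK: "subspace (K p)" for p
    unfolding K_def by (rule subspace_sums[OF subspace_cocycles_F B])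
  have KF: "y \<in> K p" if "y \<in> cocycles n \<inter> F p" for y p
    unfolding K_def using that subspace_0[OF B] by force
  have BK: "coboundaries n \<subseteq> K p" for p
    unfolding K_def using subspace_0[OF subspace_cocycles_F] by force
  have KK: "K (p + 1) \<subseteq> K p"
    unfolding K_def using F_antimono[of p "p + 1"] by auto
  have fil: "cohom_filtration n p = coset (coboundaries n) ` K p" for p
  proof -
    have "coset (coboundaries n) (y + z) = coset (coboundaries n) y" if "z \<in> coboundaries n" for y z
      using that by (simp add: coset_eq_iff[OF B])
    then have "coset (coboundaries n) ` K p \<subseteq> cohom_filtration n p"
      unfolding cohom_filtration_def K_def by blast
    moreover have "cohom_filtration n p \<subseteq> coset (coboundaries n) ` K p"
      unfolding cohom_filtration_def by (rule image_mono) (rule subsetI, rule KF)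
    ultimately show ?thesis by (rule antisym[rotated])
  qed
  have "subquotient scale (Zr r p n) (Br r p n) \<simeq>\<^sub>k subquotient scale (K p) (K (p + 1))"
  proof (rule pair.subquotient_iso[OF subspace_Zr subspace_Br sK Br_Zr])
    have Z: "Zr r p n = cocycles n \<inter> F p" using Zr_large[of q r p] r by (simp add: n_def)
    have Z1: "Zr (int r - 1) (p + 1) n = cocycles n \<inter> F (p + 1)"
      using Zr_large[of "q - 1" "int r - 1" "p + 1"] r by (simp add: n_def)
    show "x \<in> K p" if "x \<in> Zr r p n" for x using that KF Z by blast
    show "\<exists>x\<in>Zr r p n. v - x \<in> K (p + 1)" if v: "v \<in> K p" for v
    proof -
      obtain y z where yz: "v = y + z" "y \<in> cocycles n \<inter> F p" "z \<in> coboundaries n"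
        using v unfolding K_def by blast
      then have "v - y \<in> K (p + 1)" using BK by auto
      with yz Z show ?thesis by blast
    qed
    show "x \<in> K (p + 1) \<longleftrightarrow> x \<in> Br r p n" if x: "x \<in> Zr r p n" for x
    proof
      assume "x \<in> K (p + 1)"
      then obtain y z where yz: "x = y + d z" "y \<in> cocycles n \<inter> F (p + 1)" "z \<in> C (n - 1)"
        unfolding K_def by blast
      have "y \<in> F p" using F_antimono[of p "p + 1"] yz(2) by auto
      then have "x - y \<in> F p" using x by (intro subspace_diff[OF subspace_F]) (auto simp: Zr_def)
      then have "d z \<in> F p" by (simp add: yz(1))
      then have "z \<in> Zr (int r - 1) (p - int r + 1) (n - 1)"
        using yz(3) F_C_nonpos[OF yz(3), of "p - int r + 1"] r by (simp add: Zr_def)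
      then show "x \<in> Br r p n" using yz Z1 by (auto intro: BrI)
    next
      assume "x \<in> Br r p n"
      then obtain y z where yz: "x = y + d z" "y \<in> cocycles n \<inter> F (p + 1)" "z \<in> C (n - 1)"
        unfolding Br_def Z1 by (auto dest: Zr_C)
      then show "x \<in> K (p + 1)" unfolding K_def by blast
    qed
  qed (auto intro: d_add d_scale Zr_C)
  then show ?thesis
    using vspace_iso_trans[OF _ subquotient_subquotient(2)[OF B sK sK BK KK]]
    by (simp add: page_def fil quotient_update flip: n_def)
qed

theorem pages_converge:
  "converges_to page page_diff (cohom (\<lambda>n. vspace (C n) 0 (+) scale) (\<lambda>_. d))"
proof -
  let ?H = "cohom (\<lambda>n. vspace (C n) 0 (+) scale) (\<lambda>_. d)"
  have H: "?H n = subquotient scale (cocycles n) (coboundaries n)" for n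
    by (rule cohom_eq_subquotient)
  have ex: "\<exists>r. stable_from page page_diff p q r" for p q
    by (rule exI[of _ "nat (\<bar>p\<bar> + \<bar>q\<bar> + 3)"], rule stable_from_large) auto
  have sub: "is_subspace (cohom_filtration n p) (?H n)" for n p
    unfolding H cohom_filtration_def
    by (rule is_subspace_subquotient[OF subspace_cocycles subspace_coboundaries subspace_cocycles_F]) blast
  have anti: "cohom_filtration n (p + 1) \<subseteq> cohom_filtration n p" for n p
    unfolding cohom_filtration_def using F_antimono[of p "p + 1"] by auto
  have top: "cohom_filtration n 0 = carrier (?H n)" for n
    using F_nonpos[of 0 n] by (auto simp: H cohom_filtration_def cocycles_def)
  have bot: "cohom_filtration n (n + 1) = {\<zero>\<^bsub>?H n\<^esub>}" for n
  proof -
    have "cocycles n \<inter> F (n + 1) = {0}"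
      using F_large[of n "n + 1"] subspace_0[OF subspace_cocycles_F[of n "n + 1"]] by (auto simp: cocycles_def)
    then show ?thesis by (simp add: H cohom_filtration_def)
  qed
  have gr: "E_infinity page page_diff p q \<simeq>\<^sub>k
      quotient ((?H (p + q))\<lparr>carrier := cohom_filtration (p + q) p\<rparr>) (cohom_filtration (p + q) (p + 1))" for p q
  proof -
    define r where "r = (LEAST r. stable_from page page_diff p q r)"
    \<comment> \<open>a page late enough for \<open>page_iso_graded\<close>\<close>
    define s where "s = max r (nat (\<bar>p\<bar> + \<bar>q\<bar> + 3))"
    have "stable_from page page_diff p q r" unfolding r_def using ex by (rule LeastI_ex)
    then have "page s p q \<simeq>\<^sub>k page r p q" by (rule stable_pages_iso) (simp add: s_def)
    then have "page r p q \<simeq>\<^sub>k page s p q"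
      by (rule vspace_iso_sym[rotated 2])
         (auto simp: page_def add_coset[OF subspace_Br] smult_coset[OF subspace_Br] subspace_add[OF subspace_Zr] subspace_scale[OF subspace_Zr])
    moreover have "page s p q \<simeq>\<^sub>k
      quotient ((?H (p + q))\<lparr>carrier := cohom_filtration (p + q) p\<rparr>) (cohom_filtration (p + q) (p + 1))"
      unfolding H by (rule page_iso_graded) (auto simp: s_def)
    ultimately show ?thesis unfolding E_infinity_def r_def by (rule vspace_iso_trans)
  qed
  show ?thesis
    unfolding converges_to_def
  proof (intro conjI allI exI[of _ cohom_filtration])
    show "\<exists>p. cohom_filtration n p = carrier (?H n)" for n using top by (rule exI)
    show "\<exists>p. cohom_filtration n p = {\<zero>\<^bsub>?H n\<^esub>}" for n using bot by (rule exI)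
  qed (rule ex sub anti gr)+
qed

end

section \<open>Cyclic operators on functions of lists\<close>

text \<open>
  An \<open>n\<close>-cochain is evaluated on lists of length \<open>n + 1\<close>.  The operators on functions of lists read
  \<open>n\<close> off their argument, so that a family of cochains of different \<open>n\<close> is a single function.
\<close>

fun merge :: "nat \<Rightarrow> (nat \<times> 'a::times) list \<Rightarrow> (nat \<times> 'a) list" where
  "merge 0 (x # y # xs) = hmult x y # xs"
| "merge 0 [x] = [x]"
| "merge (Suc i) (x # xs) = x # merge i xs"
| "merge i [] = []"

text \<open>
  \<open>rot\<close> is the rotation \<open>t\<close> with its Koszul sign only, \<open>cyc\<close> is \<open>\<tau>\<close>, and \<open>face i\<close> is \<open>d\<^sub>i\<close>, the last
  face being \<open>t d\<^sub>0\<close>.  Further \<open>hoch\<close>, \<open>bar\<close>, \<open>cnorm\<close>, \<open>unit_ins\<close> and \<open>connes\<close> are \<open>b\<close>, \<open>b'\<close>, \<open>N\<close>, \<open>s\<close>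
  and \<open>B\<close>.  On lists of length 1, \<open>hoch\<close> vanishes because no \<open>b\<close> leads to 0-cochains; the sum would
  consist of the junk term \<open>t d\<^sub>0\<close>.
\<close>

definition rot :: "((nat \<times> 'a) list \<Rightarrow> 'k::comm_ring_1) \<Rightarrow> (nat \<times> 'a) list \<Rightarrow> 'k" where
  "rot g xs = (- 1) ^ koszul xs * g (last xs # butlast xs)"

definition face :: "nat \<Rightarrow> ((nat \<times> 'a::times) list \<Rightarrow> 'k::comm_ring_1) \<Rightarrow> (nat \<times> 'a) list \<Rightarrow> 'k" where
  "face i g xs = (if Suc i < length xs then g (merge i xs) else rot (\<lambda>ys. g (merge 0 ys)) xs)"

definition cyc :: "((nat \<times> 'a) list \<Rightarrow> 'k::comm_ring_1) \<Rightarrow> (nat \<times> 'a) list \<Rightarrow> 'k" where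
  "cyc g xs = (- 1) ^ (length xs - 1) * rot g xs"

definition hoch :: "((nat \<times> 'a::times) list \<Rightarrow> 'k::comm_ring_1) \<Rightarrow> (nat \<times> 'a) list \<Rightarrow> 'k" where
  "hoch g xs = (if length xs < 2 then 0 else \<Sum>i<length xs. (- 1) ^ i * face i g xs)"

definition bar :: "((nat \<times> 'a::times) list \<Rightarrow> 'k::comm_ring_1) \<Rightarrow> (nat \<times> 'a) list \<Rightarrow> 'k" where
  "bar g xs = (\<Sum>i<length xs - 1. (- 1) ^ i * face i g xs)"

definition cnorm :: "((nat \<times> 'a) list \<Rightarrow> 'k::comm_ring_1) \<Rightarrow> (nat \<times> 'a) list \<Rightarrow> 'k" where
  "cnorm g xs = (\<Sum>i<length xs. (cyc ^^ i) g xs)"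

definition unit_ins :: "((nat \<times> 'a::one) list \<Rightarrow> 'k::comm_ring_1) \<Rightarrow> (nat \<times> 'a) list \<Rightarrow> 'k" where
  "unit_ins g xs = (- 1) ^ (length xs - 1) * g (xs @ [(0, 1)])"

definition connes :: "((nat \<times> 'a::one) list \<Rightarrow> 'k::comm_ring_1) \<Rightarrow> (nat \<times> 'a) list \<Rightarrow> 'k" where
  "connes g = cnorm (unit_ins (\<lambda>xs. g xs - cyc g xs))"

lemma deg_simps [simp]:
  "deg [] = 0" "deg (x # xs) = fst x + deg xs" "deg (xs @ ys) = deg xs + deg ys"
  by (simp_all add: deg_def)

lemma deg_mset: "mset xs = mset ys \<Longrightarrow> deg xs = deg ys"
  unfolding deg_def by (metis mset_map sum_mset_sum_list)

lemma fst_hmult [simp]: "fst (hmult x y) = fst x + fst y"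
  by (simp add: hmult_def)

lemma hmult_assoc: "hmult (hmult x y) z = hmult x (hmult y (z :: nat \<times> 'a::semigroup_mult))"
  by (simp add: hmult_def mult.assoc)

lemma length_merge: "Suc i < length xs \<Longrightarrow> Suc (length (merge i xs)) = length xs"
  by (induction i xs rule: merge.induct) auto

lemma deg_merge [simp]: "deg (merge i xs) = deg xs"
  by (induction i xs rule: merge.induct) auto

lemma merge_append1: "Suc i < length xs \<Longrightarrow> merge i (xs @ ys) = merge i xs @ ys"
  by (induction i xs rule: merge.induct) auto

lemma merge_append2: "merge (length xs) (xs @ y # z # ys) = xs @ hmult y z # ys"
  by (induction xs) auto

lemma merge_eq:
  "Suc i < length xs \<Longrightarrow> merge i xs = take i xs @ [hmult (xs ! i) (xs ! Suc i)] @ drop (i + 2) xs"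
  by (induction i xs rule: merge.induct) auto

lemma merge_merge:
  fixes xs :: "(nat \<times> 'a::semigroup_mult) list"
  shows "i \<le> j \<Longrightarrow> Suc (Suc j) < length xs \<Longrightarrow> merge i (merge (Suc j) xs) = merge j (merge i xs)"
proof (induction i arbitrary: j xs)
  case 0
  then obtain x y z zs where xs: "xs = x # y # z # zs"
    by (cases xs; cases "tl xs"; cases "tl (tl xs)") auto
  show ?case
  proof (cases j)
    case 0 then show ?thesis by (simp add: xs hmult_assoc)
  next
    case (Suc k) then show ?thesis by (simp add: xs)
  qed
next
  case (Suc i)
  then obtain k where k: "j = Suc k" "i \<le> k" by (cases j) auto
  from Suc.prems obtain x zs where "xs = x # zs" by (cases xs) auto
  with Suc.prems Suc.IH[of k zs] k show ?case by simp
qed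

subsection \<open>Rotations\<close>

lemma rot_snoc: "rot g (ys @ [a]) = (- 1) ^ (fst a * deg ys) * g (a # ys)"
  by (simp add: rot_def koszul_def)

text \<open>
  Rotations see only rearrangements of the argument.  The multiset of entries is the invariant used
  throughout, as it determines length, degree and homogeneity.
\<close>

lemma rot_cong:
  assumes "xs \<noteq> []" and "\<And>ys. mset ys = mset xs \<Longrightarrow> g ys = h ys"
  shows "rot g xs = rot h xs"
proof -
  have "mset (last xs # butlast xs) = mset (butlast xs @ [last xs])" by simp
  also have "butlast xs @ [last xs] = xs" using assms(1) by simp
  finally show ?thesis unfolding rot_def using assms(2) by metis
qed

lemma cyc_cong:
  assumes "xs \<noteq> []" and "\<And>ys. mset ys = mset xs \<Longrightarrow> g ys = h ys"
  shows "cyc g xs = cyc h xs"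
  unfolding cyc_def using rot_cong[OF assms] by simp

lemma cyc_pow_cong:
  assumes "xs \<noteq> []" and "\<And>ys. mset ys = mset xs \<Longrightarrow> g ys = h ys"
  shows "(cyc ^^ i) g xs = (cyc ^^ i) h xs"
  using assms
proof (induction i arbitrary: xs)
  case (Suc i)
  have "cyc ((cyc ^^ i) g) xs = cyc ((cyc ^^ i) h) xs"
  proof (rule cyc_cong[OF Suc.prems(1)])
    fix ys assume ys: "mset ys = mset xs"
    show "(cyc ^^ i) g ys = (cyc ^^ i) h ys"
      using Suc.prems ys by (intro Suc.IH) (auto dest: sym)
  qed
  then show ?case by simp
qed simp

lemma cnorm_cong:
  assumes "\<And>ys. mset ys = mset xs \<Longrightarrow> g ys = h ys"
  shows "cnorm g xs = cnorm h xs"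
  unfolding cnorm_def using cyc_pow_cong[of xs g h] assms by (cases "xs = []") (auto intro!: sum.cong)

lemma cyc_diff: "cyc (\<lambda>ys. g ys - h ys) = (\<lambda>xs. cyc g xs - cyc h xs)"
  by (auto simp: cyc_def rot_def algebra_simps)

lemma cyc_sum: "cyc (\<lambda>ys. \<Sum>i\<in>I. c i * g i ys) = (\<lambda>xs. \<Sum>i\<in>I. c i * cyc (g i) xs)"
  by (rule ext) (simp add: cyc_def rot_def sum_distrib_left mult_ac)

lemma cyc_pow_diff: "(cyc ^^ i) (\<lambda>ys. g ys - h ys) = (\<lambda>xs. (cyc ^^ i) g xs - (cyc ^^ i) h xs)"
  by (induction i) (auto simp: cyc_diff)

lemma cyc_pow_sum: "(cyc ^^ i) (\<lambda>ys. \<Sum>i\<in>I. c i * g i ys) = (\<lambda>xs. \<Sum>j\<in>I. c j * (cyc ^^ i) (g j) xs)"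
  by (induction i) (auto simp: cyc_sum)

lemma cyc_scale: "cyc (\<lambda>ys. c * g ys) = (\<lambda>xs. c * cyc g xs)"
  by (rule ext) (simp add: cyc_def rot_def mult_ac)

lemma cyc_pow_scale: "(cyc ^^ i) (\<lambda>ys. c * g ys) = (\<lambda>xs. c * (cyc ^^ i) g xs)"
  by (induction i) (auto simp: cyc_scale)

lemma cnorm_diff: "cnorm (\<lambda>ys. g ys - h ys) xs = cnorm g xs - cnorm h xs"
  by (simp add: cnorm_def cyc_pow_diff sum_subtractf)

lemma cnorm_sum: "cnorm (\<lambda>ys. \<Sum>i\<in>I. c i * g i ys) xs = (\<Sum>j\<in>I. c j * cnorm (g j) xs)"
  unfolding cnorm_def cyc_pow_sum by (subst sum.swap) (simp add: sum_distrib_left)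

lemma cnorm_scale: "cnorm (\<lambda>ys. c * g ys) xs = c * cnorm g xs"
  unfolding cnorm_def cyc_pow_scale by (simp add: sum_distrib_left)

text \<open>
  The sign is that of moving the block \<open>vs\<close> past \<open>us\<close>: two entries of \<open>vs\<close> are exchanged twice.
\<close>

lemma rot_pow:
  fixes g :: "(nat \<times> 'a) list \<Rightarrow> 'k::comm_ring_1"
  shows "(rot ^^ length vs) g (us @ vs) = (- 1) ^ (deg us * deg vs) * g (vs @ us)"
proof (induction vs arbitrary: us rule: rev_induct)
  case (snoc a vs)
  have "(rot ^^ length (vs @ [a])) g (us @ vs @ [a]) = rot ((rot ^^ length vs) g) ((us @ vs) @ [a])"
    by simp
  also have "\<dots> = (- 1) ^ (fst a * deg (us @ vs)) * (rot ^^ length vs) g ((a # us) @ vs)"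
    by (simp only: rot_snoc append_Cons)
  also have "\<dots> = (- 1) ^ (fst a * deg (us @ vs)) * ((- 1) ^ (deg (a # us) * deg vs) * g (vs @ a # us))"
    by (simp only: snoc.IH)
  also have "\<dots> = (- 1) ^ (fst a * deg (us @ vs) + deg (a # us) * deg vs) * g ((vs @ [a]) @ us)"
    by (simp add: power_add mult.assoc)
  also have "fst a * deg (us @ vs) + deg (a # us) * deg vs = deg us * deg (vs @ [a]) + 2 * (fst a * deg vs)"
    by (simp add: algebra_simps)
  also have "(- 1 :: 'k) ^ (deg us * deg (vs @ [a]) + 2 * (fst a * deg vs)) = (- 1) ^ (deg us * deg (vs @ [a]))"
    by (simp add: power_add)
  finally show ?case by simp
qed simp

lemma cyc_pow_eq_rot_pow:
  "xs \<noteq> [] \<Longrightarrow> (cyc ^^ i) g xs = (- 1) ^ ((length xs - 1) * i) * (rot ^^ i) g xs"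
proof (induction i arbitrary: xs)
  case (Suc i)
  have "cyc ((cyc ^^ i) g) xs = cyc (\<lambda>ys. (- 1) ^ ((length xs - 1) * i) * (rot ^^ i) g ys) xs"
  proof (rule cyc_cong[OF Suc.prems])
    fix ys assume "mset ys = mset xs"
    then have "length ys = length xs" "ys \<noteq> []" using Suc.prems by (auto dest: mset_eq_length)
    then show "(cyc ^^ i) g ys = (- 1) ^ ((length xs - 1) * i) * (rot ^^ i) g ys"
      using Suc.IH[of ys] by simp
  qed
  then show ?case by (simp add: cyc_scale) (simp add: cyc_def power_add mult_ac)
qed simp

lemma cyc_pow_length: "(cyc ^^ length xs) g xs = g xs"
proof (cases "xs = []")
  case False
  have "even ((length xs - 1) * length xs)" using False by (cases xs) auto
  moreover have "(rot ^^ length xs) g xs = g xs" using rot_pow[of xs g "[]"] by simp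
  ultimately show ?thesis by (simp add: cyc_pow_eq_rot_pow False)
qed simp

lemma cnorm_shift: "cnorm g xs = (\<Sum>i<length xs. (cyc ^^ Suc i) g xs)"
proof -
  have "(\<Sum>i<length xs. (cyc ^^ Suc i) g xs - (cyc ^^ i) g xs) = (cyc ^^ length xs) g xs - (cyc ^^ 0) g xs"
    by (rule sum_lessThan_telescope)
  then show ?thesis unfolding cnorm_def sum_subtractf by (simp add: cyc_pow_length)
qed

lemma cnorm_cyc: "cnorm (cyc g) xs = cnorm g xs"
  unfolding cnorm_shift[of g] by (simp add: cnorm_def funpow_swap1)

lemma cnorm_cyc_pow: "cnorm ((cyc ^^ i) g) xs = cnorm g xs"
  by (induction i) (auto simp: cnorm_cyc)

lemma cyc_cnorm:
  assumes "xs \<noteq> []"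
  shows "cyc (cnorm g) xs = cnorm g xs"
proof -
  have "cyc (cnorm g) xs = cyc (\<lambda>ys. \<Sum>i<length xs. 1 * (cyc ^^ i) g ys) xs"
    by (rule cyc_cong[OF assms], drule mset_eq_length) (simp add: cnorm_def)
  then show ?thesis unfolding cyc_sum cnorm_shift by simp
qed

lemma cyc_pow_cnorm: "xs \<noteq> [] \<Longrightarrow> (cyc ^^ i) (cnorm g) xs = cnorm g xs"
proof (induction i arbitrary: xs)
  case (Suc i)
  have "cyc ((cyc ^^ i) (cnorm g)) xs = cyc (cnorm g) xs"
  proof (rule cyc_cong[OF Suc.prems])
    fix ys assume "mset ys = mset xs"
    then have "ys \<noteq> []" using Suc.prems by auto
    then show "(cyc ^^ i) (cnorm g) ys = cnorm g ys" by (rule Suc.IH)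
  qed
  then show ?case by (simp add: cyc_cnorm Suc.prems)
qed simp

subsection \<open>Faces\<close>

lemma face_cong:
  assumes "2 \<le> length xs" and "\<And>ys. Suc (length ys) = length xs \<Longrightarrow> g ys = h ys"
  shows "face i g xs = face i h xs"
proof (cases "Suc i < length xs")
  case True
  then show ?thesis using assms(2)[OF length_merge[OF True]] by (simp add: face_def)
next
  case False
  have "rot (\<lambda>ys. g (merge 0 ys)) xs = rot (\<lambda>ys. h (merge 0 ys)) xs"
  proof (rule rot_cong)
    fix ys assume "mset ys = mset xs"
    then have "length ys = length xs" by (rule mset_eq_length)
    then show "g (merge 0 ys) = h (merge 0 ys)" using assms length_merge[of 0 ys] by simp
  qed (use assms in auto)
  with False show ?thesis by (simp add: face_def)
qed

lemma face_sum: "face i (\<lambda>ys. \<Sum>j\<in>I. c j * g j ys) xs = (\<Sum>j\<in>I. c j * face i (g j) xs)"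
  by (simp add: face_def rot_def sum_distrib_left mult_ac)

lemma face_scale: "face i (\<lambda>ys. c * g ys) xs = c * face i g xs"
  by (simp add: face_def rot_def mult_ac)

lemma face_diff: "face i (\<lambda>ys. g ys - h ys) xs = face i g xs - face i h xs"
  by (simp add: face_def rot_def algebra_simps)

lemma face_last: "2 \<le> length xs \<Longrightarrow> face (length xs - 1) g xs = rot (face 0 g) xs"
  by (cases xs rule: rev_cases) (auto simp: face_def rot_snoc)

text \<open>
  For the last face, with \<open>b\<close> and \<open>a\<close> the last two entries, the exponents of the Koszul signs
  of two single rotations and of one rotation of the product \<open>b a\<close> differ by \<open>2 |a| |b|\<close>.
\<close>

lemma rot_face:
  assumes i: "Suc i < length xs"
  shows "rot (face (Suc i) g) xs = face i (rot g) xs"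
proof (cases "Suc (Suc i) < length xs")
  case True
  obtain ys a where xs: "xs = ys @ [a]" using i by (cases xs rule: rev_cases) auto
  have "merge i xs = merge i ys @ [a]" using True by (simp add: xs merge_append1)
  then show ?thesis using True by (simp add: xs rot_snoc face_def)
next
  case False
  then have len: "length xs = Suc (Suc i)" using i by simp
  obtain ys' a where xs': "xs = ys' @ [a]" using i by (cases xs rule: rev_cases) auto
  obtain ys b where ys: "ys' = ys @ [b]" using len xs' by (cases ys' rule: rev_cases) auto
  have xs: "xs = (ys @ [b]) @ [a]" by (simp add: xs' ys)
  have i: "i = length ys" using len by (simp add: xs)
  have "merge i xs = ys @ [hmult b a]" using merge_append2[of ys b a "[]"] by (simp add: xs i)
  then have "face i (rot g) xs = (- 1) ^ ((fst b + fst a) * deg ys) * g (hmult b a # ys)"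
    using len by (simp add: face_def rot_snoc)
  moreover have "rot (face (Suc i) g) xs = (- 1) ^ ((fst b + fst a) * deg ys) * g (hmult b a # ys)"
  proof -
    have "rot (face (Suc i) g) xs =
       (- 1) ^ (fst a * deg (ys @ [b])) * rot (\<lambda>ys. g (merge 0 ys)) ((a # ys) @ [b])"
      unfolding xs rot_snoc[of _ "ys @ [b]"] by (simp add: face_def i)
    also have "\<dots> = (- 1) ^ (fst a * deg (ys @ [b]) + fst b * deg (a # ys)) * g (hmult b a # ys)"
      unfolding rot_snoc power_add by (simp add: mult.assoc)
    also have "fst a * deg (ys @ [b]) + fst b * deg (a # ys) = (fst b + fst a) * deg ys + 2 * (fst a * fst b)"
      by (simp add: algebra_simps)
    finally show ?thesis by (simp add: power_add)
  qed
  ultimately show ?thesis by simp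
qed

lemma face_face_interior:
  fixes g :: "(nat \<times> 'a::semigroup_mult) list \<Rightarrow> 'k::comm_ring_1"
  assumes ij: "i \<le> j" and j: "Suc (Suc j) < length xs"
  shows "face (Suc j) (face i g) xs = face i (face j g) xs"
proof -
  have "Suc (length (merge (Suc j) xs)) = length xs" "Suc (length (merge i xs)) = length xs"
    using ij j by (simp_all add: length_merge)
  then show ?thesis using ij j by (simp add: face_def merge_merge)
qed

text \<open>
  The simplicial identities.  For interior faces they are associativity; those with a last face
  follow by expressing it as \<open>t d\<^sub>0\<close> and moving \<open>t\<close> outwards with \<open>rot_face\<close>.
\<close>

lemma face_face:
  fixes g :: "(nat \<times> 'a::semigroup_mult) list \<Rightarrow> 'k::comm_ring_1"
  assumes ij: "i \<le> j" and j: "Suc j < length xs" and l: "3 \<le> length xs"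
  shows "face (Suc j) (face i g) xs = face i (face j g) xs"
proof (cases "Suc (Suc j) < length xs")
  case True then show ?thesis using face_face_interior[OF ij] by blast
next
  case False
  then have L: "length xs = Suc (Suc j)" using j by simp
  have ne: "xs \<noteq> []" using l by auto
  have last: "face j h ys = rot (face 0 h) ys" if "Suc (length ys) = length xs" for h :: "(nat \<times> 'a) list \<Rightarrow> 'k" and ys
    using face_last[of ys h] that l by (simp add: L)
  have int: "face (Suc k) (face 0 g) ys = face 0 (face k g) ys" if "Suc (Suc k) < length xs" "mset ys = mset xs" for k ys
    using that by (intro face_face_interior) (auto dest: mset_eq_length)
  have "face (Suc j) (face i g) xs = rot (face 0 (face i g)) xs"
    using face_last[of xs "face i g"] l by (simp add: L)
  also have "\<dots> = rot (face (Suc i) (face 0 g)) xs"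
  proof (cases "i = j")
    case False
    with ij L show ?thesis by (intro rot_cong[OF ne] int[symmetric]) auto
  next
    case True
    have "rot (face 0 (face i g)) xs = rot (rot (face 0 (face 0 g))) xs"
    proof (rule rot_cong[OF ne])
      fix ys assume ys: "mset ys = mset xs"
      then have len: "length ys = length xs" by (rule mset_eq_length)
      have "face 0 (face i g) ys = face 0 (rot (face 0 g)) ys"
        using l len last by (intro face_cong) (auto simp: True)
      also have "\<dots> = rot (face (Suc 0) (face 0 g)) ys" using l len by (simp add: rot_face)
      also have "\<dots> = rot (face 0 (face 0 g)) ys"
        using l len ne ys by (intro rot_cong int) auto
      finally show "face 0 (face i g) ys = rot (face 0 (face 0 g)) ys" .
    qed
    also have "\<dots> = rot (face (Suc i) (face 0 g)) xs"
    proof (rule rot_cong[OF ne])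
      fix ys assume ys: "mset ys = mset xs"
      then have len: "length ys = Suc (Suc i)" using L True by (metis mset_eq_length)
      show "rot (face 0 (face 0 g)) ys = face (Suc i) (face 0 g) ys"
        using face_last[of ys "face 0 g"] len by simp
    qed
    finally show ?thesis .
  qed
  also have "\<dots> = face i (rot (face 0 g)) xs" using ij L by (intro rot_face) simp
  also have "\<dots> = face i (face j g) xs" using l last by (intro face_cong) auto
  finally show ?thesis .
qed

subsection \<open>The mixed complex identities\<close>

text \<open>
  The summands cancel in pairs \<open>(j + 1, i)\<close> and \<open>(i, j)\<close> with \<open>i \<le> j\<close>.
\<close>

lemma alternating_sum_eq_0:
  fixes Y :: "nat \<Rightarrow> nat \<Rightarrow> 'k::comm_ring_1"
  assumes Y: "\<And>i j. i \<le> j \<Longrightarrow> j < m \<Longrightarrow> Y (Suc j) i = Y i j"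
  shows "(\<Sum>j<Suc m. \<Sum>i<m. (- 1) ^ j * ((- 1) ^ i * Y j i)) = 0"
proof -
  let ?f = "\<lambda>(j, i). (- 1) ^ j * ((- 1) ^ i * Y j i)"
  let ?S = "{..<Suc m} \<times> {..<m}"
  let ?A = "{p \<in> ?S. snd p < fst p}" and ?B = "{p \<in> ?S. \<not> snd p < fst p}"
  have "sum ?f ?A = (\<Sum>p\<in>?B. - ?f p)"
    by (rule sum.reindex_bij_witness[of _ "\<lambda>(j, i). (Suc i, j)" "\<lambda>(j, i). (i, j - 1)"])
       (auto simp: Y mult_ac, rename_tac j i, case_tac j, auto simp: Y mult_ac)
  moreover have "sum ?f ?S = sum ?f ?A + sum ?f ?B"
    by (subst sum.union_disjoint[symmetric]) (auto intro!: sum.cong)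
  ultimately have "sum ?f ?S = 0" by (simp add: sum_negf)
  then show ?thesis by (simp add: sum.cartesian_product)
qed

theorem hoch_hoch:
  fixes g :: "(nat \<times> 'a::semigroup_mult) list \<Rightarrow> 'k::comm_ring_1"
  shows "hoch (hoch g) xs = 0"
proof -
  consider "length xs < 2" | "length xs = 2" | "3 \<le> length xs" by linarith
  then show ?thesis
  proof cases
    case 1 then show ?thesis by (simp add: hoch_def)
  next
    case 2
    have "face i (hoch g) xs = face i (\<lambda>ys. 0) xs" for i
      by (rule face_cong) (auto simp: 2 hoch_def)
    moreover have "face i (\<lambda>ys. 0) xs = (0 :: 'k)" for i by (simp add: face_def rot_def)
    ultimately have "face i (hoch g) xs = 0" for i by simp
    then show ?thesis by (simp add: hoch_def[of "hoch g"])
  next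
    case 3
    define m where "m = length xs - 1"
    have m: "length xs = Suc m" using 3 by (simp add: m_def)
    have "face j (hoch g) xs = face j (\<lambda>ys. \<Sum>i<m. (- 1) ^ i * face i g ys) xs" for j
      by (rule face_cong) (use 3 m in \<open>auto simp: hoch_def\<close>)
    then have "hoch (hoch g) xs = (\<Sum>j<Suc m. \<Sum>i<m. (- 1) ^ j * ((- 1) ^ i * face j (face i g) xs))"
      using 3 by (simp add: hoch_def[of "hoch g"] face_sum m sum_distrib_left del: sum.lessThan_Suc)
    also have "\<dots> = 0"
      by (rule alternating_sum_eq_0, rule face_face) (use 3 m in auto)
    finally show ?thesis .
  qed
qed

lemma cyc_face:
  assumes i: "Suc i < length xs"
  shows "cyc (face (Suc i) g) xs = - face i (cyc g) xs"
proof -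
  obtain k where k: "length xs = Suc (Suc k)" using i by (metis Suc_less_eq2 less_natE)
  have "face i (cyc g) xs = face i (\<lambda>ys. (- 1) ^ k * rot g ys) xs"
    by (rule face_cong) (auto simp: cyc_def k)
  then show ?thesis by (simp add: cyc_def[of "face (Suc i) g"] rot_face[OF i] face_scale k)
qed

lemma cyc_face_0: "2 \<le> length xs \<Longrightarrow> cyc (face 0 g) xs = (- 1) ^ (length xs - 1) * face (length xs - 1) g xs"
  using face_last[of xs g] by (simp add: cyc_def)

lemma bar_diff: "bar (\<lambda>ys. g ys - h ys) xs = bar g xs - bar h xs"
  by (simp add: bar_def face_diff right_diff_distrib sum_subtractf)

text \<open>
  This is \<open>(1 - \<tau>) b = b' (1 - \<tau>)\<close>: \<open>\<tau>\<close> turns the first face into the last, with its sign in \<open>b\<close>, and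
  anticommutes with the others up to the shift \<open>\<tau> d\<^sub>i\<^sub>+\<^sub>1 = - d\<^sub>i \<tau>\<close>.
\<close>

lemma hoch_diff_cyc_hoch:
  assumes l: "2 \<le> length xs"
  shows "hoch g xs - cyc (hoch g) xs = bar (\<lambda>ys. g ys - cyc g ys) xs"
proof -
  define n where "n = length xs - 1"
  have n: "length xs = Suc n" using l by (simp add: n_def)
  have ne: "xs \<noteq> []" using l by auto
  have "cyc (hoch g) xs = cyc (\<lambda>ys. \<Sum>i<Suc n. (- 1) ^ i * face i g ys) xs"
  proof (rule cyc_cong[OF ne])
    fix ys assume "mset ys = mset xs"
    then have "length ys = Suc n" using n by (metis mset_eq_length)
    then show "hoch g ys = (\<Sum>i<Suc n. (- 1) ^ i * face i g ys)" using l n by (simp add: hoch_def)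
  qed
  also have "\<dots> = cyc (face 0 g) xs + (\<Sum>i<n. (- 1) ^ Suc i * cyc (face (Suc i) g) xs)"
    unfolding cyc_sum by (subst sum.lessThan_Suc_shift) simp
  also have "\<dots> = (- 1) ^ n * face n g xs + (\<Sum>i<n. (- 1) ^ i * face i (cyc g) xs)"
    using l n by (simp add: cyc_face_0 cyc_face)
  finally show ?thesis using l n unfolding bar_diff by (simp add: bar_def hoch_def)
qed

text \<open>
  This lemma and the next one are the two ways of rotating a face into or out of the first position;
  they evaluate \<open>N b'\<close> and \<open>b N\<close>.
\<close>

lemma cyc_pow_face:
  assumes "i < length xs - 1"
  shows "(cyc ^^ i) (face i g) xs = (- 1) ^ i * face 0 ((cyc ^^ i) g) xs"
  using assms
proof (induction i arbitrary: g)
  case (Suc i)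
  have ne: "xs \<noteq> []" using Suc.prems by auto
  have "(cyc ^^ Suc i) (face (Suc i) g) xs = (cyc ^^ i) (cyc (face (Suc i) g)) xs"
    by (simp add: funpow_swap1)
  also have "\<dots> = (cyc ^^ i) (\<lambda>ys. (- 1) * face i (cyc g) ys) xs"
  proof (rule cyc_pow_cong[OF ne])
    fix ys assume "mset ys = mset xs"
    then have "length ys = length xs" by (rule mset_eq_length)
    then show "cyc (face (Suc i) g) ys = (- 1) * face i (cyc g) ys"
      using cyc_face[of i ys g] Suc.prems by simp
  qed
  also have "\<dots> = - (cyc ^^ i) (face i (cyc g)) xs"
    by (simp only: cyc_pow_scale) simp
  also have "\<dots> = - ((- 1) ^ i * face 0 ((cyc ^^ i) (cyc g)) xs)" using Suc by simp
  finally show ?case by (simp add: funpow_swap1)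
qed simp

lemma cyc_pow_face_0:
  assumes "2 \<le> length xs" "j \<le> length xs - 1"
  shows "(cyc ^^ Suc j) (face 0 g) xs = (- 1) ^ (length xs - 1 - j) * face (length xs - 1 - j) ((cyc ^^ j) g) xs"
  using assms
proof (induction j arbitrary: xs)
  case 0 then show ?case by (simp add: cyc_face_0)
next
  case (Suc j)
  have ne: "xs \<noteq> []" using Suc.prems by auto
  define k where "k = length xs - 1 - Suc j"
  have k: "length xs - 1 - j = Suc k" "Suc k < length xs" using Suc.prems by (auto simp: k_def)
  have "cyc ((cyc ^^ Suc j) (face 0 g)) xs = cyc (\<lambda>ys. (- 1) ^ Suc k * face (Suc k) ((cyc ^^ j) g) ys) xs"
  proof (rule cyc_cong[OF ne])
    fix ys assume "mset ys = mset xs"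
    then have "length ys = length xs" by (rule mset_eq_length)
    then show "(cyc ^^ Suc j) (face 0 g) ys = (- 1) ^ Suc k * face (Suc k) ((cyc ^^ j) g) ys"
      using Suc.IH[of ys] Suc.prems k by simp
  qed
  also have "\<dots> = (- 1) ^ Suc k * cyc (face (Suc k) ((cyc ^^ j) g)) xs" unfolding cyc_scale ..
  also have "\<dots> = (- 1) ^ k * face k (cyc ((cyc ^^ j) g)) xs" using k by (simp add: cyc_face)
  finally show ?case by (simp add: k_def)
qed

lemma cnorm_face_0_cnorm:
  assumes l: "2 \<le> length xs"
  shows "cnorm (face 0 (cnorm g)) xs = hoch (cnorm g) xs"
proof -
  define n where "n = length xs - 1"
  have n: "length xs = Suc n" using l by (simp add: n_def)
  have *: "face i ((cyc ^^ j) (cnorm g)) xs = face i (cnorm g) xs" for i j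
    using l by (intro face_cong cyc_pow_cnorm) auto
  have "cnorm (face 0 (cnorm g)) xs = (\<Sum>j<Suc n. (- 1) ^ (n - j) * face (n - j) (cnorm g) xs)"
    unfolding cnorm_shift[of "face 0 (cnorm g)"] n
    by (rule sum.cong) (use l n in \<open>auto simp: cyc_pow_face_0 * simp del: funpow.simps\<close>)
  also have "\<dots> = (\<Sum>j<Suc n. (- 1) ^ j * face j (cnorm g) xs)"
    using sum.nat_diff_reindex[of "\<lambda>j. (- 1) ^ j * face j (cnorm g) xs" "Suc n"] by simp
  finally show ?thesis using l n by (simp add: hoch_def)
qed

text \<open>
  Both sides of \<open>N b' = b N\<close> equal \<open>N d\<^sub>0 N\<close>: as \<open>N \<tau>\<^sup>i = N\<close>, each \<open>N d\<^sub>i\<close> is \<open>(-1)\<^sup>i N d\<^sub>0 \<tau>\<^sup>i\<close>.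
\<close>

lemma cnorm_bar: "cnorm (bar g) xs = hoch (cnorm g) xs"
proof (cases "2 \<le> length xs")
  case l: True
  define n where "n = length xs - 1"
  have n: "length xs = Suc n" using l by (simp add: n_def)
  have "cnorm (bar g) xs = cnorm (\<lambda>ys. \<Sum>i<n. (- 1) ^ i * face i g ys) xs"
    by (rule cnorm_cong, drule mset_eq_length) (simp add: bar_def n_def)
  also have "\<dots> = (\<Sum>i<n. (- 1) ^ i * cnorm (face i g) xs)" by (rule cnorm_sum)
  also have "\<dots> = (\<Sum>i<n. 1 * cnorm (face 0 ((cyc ^^ i) g)) xs)"
  proof (rule sum.cong[OF refl])
    fix i assume i: "i \<in> {..<n}"
    have "cnorm (face i g) xs = cnorm ((cyc ^^ i) (face i g)) xs" by (simp add: cnorm_cyc_pow)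
    also have "\<dots> = cnorm (\<lambda>ys. (- 1) ^ i * face 0 ((cyc ^^ i) g) ys) xs"
    proof (rule cnorm_cong)
      fix ys assume "mset ys = mset xs"
      then have "length ys = length xs" by (rule mset_eq_length)
      then show "(cyc ^^ i) (face i g) ys = (- 1) ^ i * face 0 ((cyc ^^ i) g) ys"
        using i by (intro cyc_pow_face) (simp add: n_def)
    qed
    finally show "(- 1) ^ i * cnorm (face i g) xs = 1 * cnorm (face 0 ((cyc ^^ i) g)) xs"
      by (simp add: cnorm_scale flip: mult.assoc power_add)
  qed
  also have "\<dots> = cnorm (\<lambda>ys. \<Sum>i<n. 1 * face 0 ((cyc ^^ i) g) ys) xs" by (rule cnorm_sum[symmetric])
  also have "\<dots> = cnorm (face 0 (cnorm g)) xs"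
  proof (rule cnorm_cong)
    fix ys assume "mset ys = mset xs"
    then have len: "length ys = Suc n" using n by (metis mset_eq_length)
    have "face 0 (cnorm g) ys = face 0 (\<lambda>zs. \<Sum>i<n. 1 * (cyc ^^ i) g zs) ys"
      using l n len by (intro face_cong) (auto simp: cnorm_def)
    then show "(\<Sum>i<n. 1 * face 0 ((cyc ^^ i) g) ys) = face 0 (cnorm g) ys" by (simp only: face_sum)
  qed
  also have "\<dots> = hoch (cnorm g) xs" by (rule cnorm_face_0_cnorm[OF l])
  finally show ?thesis .
next
  case False
  then consider "xs = []" | a where "xs = [a]" by (cases xs) (auto simp: Suc_le_eq)
  then show ?thesis by cases (simp_all add: cnorm_def bar_def hoch_def)
qed

text \<open>
  The new face of \<open>s\<close> after \<open>b'\<close> multiplies the last entry by 1; all others cancel, as \<open>s\<close> carries the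
  sign \<open>(-1)\<^sup>n\<close>.
\<close>

lemma unit_ins_bar:
  fixes g :: "(nat \<times> 'a::monoid_mult) list \<Rightarrow> 'k::comm_ring_1"
  assumes "xs \<noteq> []"
  shows "unit_ins (bar g) xs + bar (unit_ins g) xs = g xs"
proof -
  define n where "n = length xs - 1"
  have n: "length xs = Suc n" using assms by (simp add: n_def)
  obtain ys a where xs: "xs = ys @ [a]" using assms by (cases xs rule: rev_cases) auto
  have last: "face n g (xs @ [(0, 1)]) = g xs"
    using merge_append2[of ys a "(0, 1)" "[]"] n by (simp add: face_def xs hmult_def)
  have "unit_ins (bar g) xs = (- 1) ^ n * (\<Sum>i<Suc n. (- 1) ^ i * face i g (xs @ [(0, 1)]))"
    by (simp add: unit_ins_def bar_def n)
  also have "\<dots> = (- 1) ^ n * (\<Sum>i<n. (- 1) ^ i * face i g (xs @ [(0, 1)])) + g xs"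
    by (simp add: last distrib_left flip: mult.assoc power_add)
  finally have *: "unit_ins (bar g) xs = (- 1) ^ n * (\<Sum>i<n. (- 1) ^ i * face i g (xs @ [(0, 1)])) + g xs" .
  have "bar (unit_ins g) xs = (\<Sum>i<n. - ((- 1) ^ n * ((- 1) ^ i * face i g (xs @ [(0, 1)]))))"
    unfolding bar_def n_def[symmetric]
  proof (rule sum.cong[OF refl])
    fix i assume "i \<in> {..<n}"
    then have i: "Suc i < length xs" using n by simp
    obtain k where k: "n = Suc k" using i n by (cases n) auto
    show "(- 1) ^ i * face i (unit_ins g) xs = - ((- 1) ^ n * ((- 1) ^ i * face i g (xs @ [(0, 1)])))"
      using length_merge[OF i] i n k by (simp add: face_def unit_ins_def merge_append1 mult_ac)
  qed
  then show ?thesis unfolding * by (simp add: sum_negf sum_distrib_left)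
qed

lemma unit_ins_cong:
  assumes "g (xs @ [(0, 1)]) = h (xs @ [(0, 1)])"
  shows "unit_ins g xs = unit_ins h xs"
  using assms by (simp add: unit_ins_def)

text \<open>
  \<open>b B + B b = N (b' s + s b') (1 - \<tau>) = N (1 - \<tau>) = 0\<close>.
\<close>

theorem hoch_connes:
  fixes g :: "(nat \<times> 'a::monoid_mult) list \<Rightarrow> 'k::comm_ring_1"
  assumes ne: "xs \<noteq> []"
  shows "hoch (connes g) xs + connes (hoch g) xs = 0"
proof -
  define h where "h = (\<lambda>ys. g ys - cyc g ys)"
  have "connes (hoch g) xs = cnorm (\<lambda>ys. h ys - bar (unit_ins h) ys) xs"
    unfolding connes_def
  proof (rule cnorm_cong)
    fix ys assume "mset ys = mset xs"
    then have ys: "ys \<noteq> []" using ne by auto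
    have "unit_ins (\<lambda>ys. hoch g ys - cyc (hoch g) ys) ys = unit_ins (bar h) ys"
      unfolding h_def using ys by (intro unit_ins_cong hoch_diff_cyc_hoch) (cases ys, auto)
    then show "unit_ins (\<lambda>ys. hoch g ys - cyc (hoch g) ys) ys = h ys - bar (unit_ins h) ys"
      using unit_ins_bar[OF ys, of h] by (simp add: eq_diff_eq)
  qed
  also have "\<dots> = cnorm h xs - hoch (cnorm (unit_ins h)) xs"
    unfolding cnorm_diff cnorm_bar ..
  also have "cnorm h xs = 0" unfolding h_def cnorm_diff cnorm_cyc by simp
  finally show ?thesis unfolding connes_def h_def by simp
qed

text \<open>
  \<open>B B\<close> contains the factor \<open>(1 - \<tau>) N = 0\<close>.
\<close>

theorem connes_connes:
  fixes g :: "(nat \<times> 'a::one) list \<Rightarrow> 'k::comm_ring_1"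
  shows "connes (connes g) xs = 0"
proof -
  have "connes (connes g) xs = cnorm (\<lambda>ys. 0 * 0) xs"
    unfolding connes_def[of "connes g"]
    by (rule cnorm_cong) (simp add: unit_ins_def connes_def cyc_cnorm)
  then show ?thesis unfolding cnorm_scale by simp
qed

section \<open>The internal differential on functions of lists\<close>

context dga
begin

definition hom_list :: "(nat \<times> 'a) list \<Rightarrow> bool" where
  "hom_list xs \<longleftrightarrow> (\<forall>(e, x)\<in>set xs. x \<in> A e)"

lemma hom_list_simps [simp]:
  "hom_list []" "hom_list (a # xs) \<longleftrightarrow> snd a \<in> A (fst a) \<and> hom_list xs"
  "hom_list (xs @ ys) \<longleftrightarrow> hom_list xs \<and> hom_list ys"
  by (auto simp: hom_list_def)

lemma hlists_iff: "xs \<in> hlists n m \<longleftrightarrow> length xs = n \<and> deg xs = m \<and> hom_list xs"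
  by (simp add: hlists_def hom_list_def)

lemma hom_list_mset: "mset xs = mset ys \<Longrightarrow> hom_list xs \<Longrightarrow> hom_list ys"
  unfolding hom_list_def by (metis set_mset_mset)

lemma hom_list_merge: "hom_list xs \<Longrightarrow> hom_list (merge i xs)"
  by (induction i xs rule: merge.induct) (auto simp: hmult_def mult_A)

lemma A_add: "x \<in> A e \<Longrightarrow> y \<in> A e \<Longrightarrow> x + y \<in> A e"
  by (rule subspace_add[OF subspace_A])

lemma A_scale: "x \<in> A e \<Longrightarrow> c *s x \<in> A e"
  by (rule subspace_scale[OF subspace_A])

lemma \<phi>_add: "\<phi> (x + y) = \<phi> x + \<phi> y"
  using linear_\<phi> by (simp add: Vector_Spaces.linear_iff)

lemma \<phi>_scale: "\<phi> (c *s x) = c *s \<phi> x"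
  using linear_\<phi> by (simp add: Vector_Spaces.linear_iff)

lemma \<phi>_pred: "x \<in> A e \<Longrightarrow> 0 < e \<Longrightarrow> \<phi> x \<in> A (e - 1)"
  using \<phi>_A[of x "e - 1"] by simp

subsection \<open>Multilinear functions\<close>

definition mlin :: "((nat \<times> 'a) list \<Rightarrow> 'k) \<Rightarrow> bool" where
  "mlin g \<longleftrightarrow> (\<forall>us vs e x. hom_list us \<longrightarrow> hom_list vs \<longrightarrow> x \<in> A e \<longrightarrow>
     (\<forall>y\<in>A e. g (us @ (e, x + y) # vs) = g (us @ (e, x) # vs) + g (us @ (e, y) # vs)) \<and>
     (\<forall>c. g (us @ (e, c *s x) # vs) = c * g (us @ (e, x) # vs)))"

lemma mlinI:
  assumes "\<And>us vs e x y. hom_list us \<Longrightarrow> hom_list vs \<Longrightarrow> x \<in> A e \<Longrightarrow> y \<in> A e \<Longrightarrow>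
     g (us @ (e, x + y) # vs) = g (us @ (e, x) # vs) + g (us @ (e, y) # vs)"
    and "\<And>us vs e x c. hom_list us \<Longrightarrow> hom_list vs \<Longrightarrow> x \<in> A e \<Longrightarrow>
     g (us @ (e, c *s x) # vs) = c * g (us @ (e, x) # vs)"
  shows "mlin g"
  using assms unfolding mlin_def by blast

lemma mlin_add_arg:
  "mlin g \<Longrightarrow> hom_list us \<Longrightarrow> hom_list vs \<Longrightarrow> x \<in> A e \<Longrightarrow> y \<in> A e \<Longrightarrow>
     g (us @ (e, x + y) # vs) = g (us @ (e, x) # vs) + g (us @ (e, y) # vs)"
  unfolding mlin_def by blast

lemma mlin_scale_arg:
  "mlin g \<Longrightarrow> hom_list us \<Longrightarrow> hom_list vs \<Longrightarrow> x \<in> A e \<Longrightarrow>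
     g (us @ (e, c *s x) # vs) = c * g (us @ (e, x) # vs)"
  unfolding mlin_def by blast

lemma mlin_zero_arg:
  assumes "mlin g" "hom_list us" "hom_list vs"
  shows "g (us @ (e, 0) # vs) = 0"
  using mlin_scale_arg[OF assms subspace_0[OF subspace_A], where c = 0] by simp

lemma mlin_append: "mlin g \<Longrightarrow> hom_list us \<Longrightarrow> mlin (\<lambda>u. g (us @ u))"
proof (rule mlinI)
  fix us' vs :: "(nat \<times> 'a) list" and e x y c
  assume g: "mlin g" and h: "hom_list us" "hom_list us'" "hom_list vs" "x \<in> A e"
  show "g (us @ us' @ (e, c *s x) # vs) = c * g (us @ us' @ (e, x) # vs)"
    using mlin_scale_arg[OF g, of "us @ us'" vs x e c] h by simp
  show "g (us @ us' @ (e, x + y) # vs) = g (us @ us' @ (e, x) # vs) + g (us @ us' @ (e, y) # vs)" if "y \<in> A e"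
    using mlin_add_arg[OF g, of "us @ us'" vs x e y] h that by simp
qed

lemma mlin_Cons: "mlin g \<Longrightarrow> snd a \<in> A (fst a) \<Longrightarrow> mlin (\<lambda>u. g (a # u))"
  using mlin_append[of g "[a]"] by simp

text \<open>
  Signs and summation bounds of the operators depend on length and degree, which stay the same when
  an entry is varied within its degree.
\<close>

lemma mlin_index:
  assumes "\<And>n m. mlin (G n m)"
  shows "mlin (\<lambda>xs. G (length xs) (deg xs) xs)"
  by (rule mlinI) (simp_all add: mlin_add_arg[OF assms] mlin_scale_arg[OF assms] A_add A_scale)

lemma mlin_0: "mlin (\<lambda>_. 0)"
  by (rule mlinI) simp_all

lemma mlin_add: "mlin g \<Longrightarrow> mlin h \<Longrightarrow> mlin (\<lambda>xs. g xs + h xs)"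
  by (rule mlinI) (simp_all add: mlin_add_arg mlin_scale_arg algebra_simps)

lemma mlin_scale: "mlin g \<Longrightarrow> mlin (\<lambda>xs. c * g xs)"
  by (rule mlinI) (simp_all add: mlin_add_arg mlin_scale_arg algebra_simps)

lemma mlin_sum: "(\<And>i. i \<in> I \<Longrightarrow> mlin (g i)) \<Longrightarrow> mlin (\<lambda>xs. \<Sum>i\<in>I. g i xs)"
  by (induction I rule: infinite_finite_induct) (auto intro: mlin_0 mlin_add)

lemma merge_append3: "merge (length us + j) (us @ zs) = us @ merge j zs"
  by (induction us) auto

lemma mlin_merge:
  assumes g: "mlin g"
  shows "mlin (\<lambda>xs. g (merge i xs))"
proof -
  have *: "g (merge i (us @ (e, x + y) # vs)) = g (merge i (us @ (e, x) # vs)) + g (merge i (us @ (e, y) # vs)) \<and>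
      g (merge i (us @ (e, c *s x) # vs)) = c * g (merge i (us @ (e, x) # vs))"
    if h: "hom_list us" "hom_list vs" "x \<in> A e" "y \<in> A e" for us vs e x y c
  proof -
    consider "Suc i < length us" | us' u where "us = us' @ [u]" "i = length us'"
      | j where "i = length us + j"
    proof (cases "Suc i < length us")
      case False
      show thesis
      proof (cases "Suc i = length us")
        case True
        then show thesis using that(2) by (cases us rule: rev_cases) auto
      next
        case f: False
        then show thesis using that(3)[of "i - length us"] False by simp
      qed
    qed (rule that(1))
    then show ?thesis
    proof cases
      case 1
      then show ?thesis
        using h hom_list_merge[of us i] by (simp add: merge_append1 mlin_add_arg[OF g] mlin_scale_arg[OF g])
    next
      case 2
      then have "merge i (us @ w # vs) = us' @ hmult u w # vs" for w
        by (simp add: merge_append2)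
      then show ?thesis
        using h 2 by (simp add: hmult_def distrib_left scale_mult_right mult_A mlin_add_arg[OF g] mlin_scale_arg[OF g])
    next
      case 3
      show ?thesis
      proof (cases j)
        case (Suc k)
        then have "merge i (us @ w # vs) = us @ w # merge k vs" for w
          using merge_append3[of us j "w # vs"] 3 by simp
        then show ?thesis
          using h by (simp add: hom_list_merge mlin_add_arg[OF g] mlin_scale_arg[OF g])
      next
        case 0
        show ?thesis
        proof (cases vs)
          case Nil
          then have "merge i (us @ w # vs) = us @ [w]" for w
            using merge_append3[of us 0 "[w]"] 3 0 by simp
          then show ?thesis
            using h by (simp add: mlin_add_arg[OF g] mlin_scale_arg[OF g])
        next
          case (Cons v vs')
          then have "merge i (us @ w # vs) = us @ hmult w v # vs'" for w
            using merge_append3[of us 0 "w # v # vs'"] 3 0 by simp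
          then show ?thesis
            using h Cons by (simp add: hmult_def distrib_right scale_mult_left mult_A mlin_add_arg[OF g] mlin_scale_arg[OF g])
        qed
      qed
    qed
  qed
  show ?thesis
    by (rule mlinI) (use * in blast)+
qed

lemma mlin_rot:
  assumes g: "mlin g"
  shows "mlin (rot g)"
proof -
  have *: "rot g (us @ (e, x + y) # vs) = rot g (us @ (e, x) # vs) + rot g (us @ (e, y) # vs) \<and>
      rot g (us @ (e, c *s x) # vs) = c * rot g (us @ (e, x) # vs)"
    if h: "hom_list us" "hom_list vs" "x \<in> A e" "y \<in> A e" for us vs e x y c
  proof (cases vs rule: rev_cases)
    case Nil
    then show ?thesis
      using h mlin_add_arg[OF g, of "[]" us x e y] mlin_scale_arg[OF g, of "[]" us x e c]
      by (simp add: rot_snoc algebra_simps)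
  next
    case (snoc vs' l)
    have "rot g (us @ (e, z) # vs) = (- 1) ^ (fst l * (deg us + (e + deg vs'))) * g ((l # us) @ (e, z) # vs')" for z
      using rot_snoc[of g "us @ (e, z) # vs'" l] by (simp add: snoc)
    then show ?thesis
      using h snoc mlin_add_arg[OF g, of "l # us" vs' x e y] mlin_scale_arg[OF g, of "l # us" vs' x e c]
      by (simp add: algebra_simps)
  qed
  show ?thesis
    by (rule mlinI) (use * in blast)+
qed

lemma mlin_face: "mlin g \<Longrightarrow> mlin (face i g)"
proof -
  assume g: "mlin g"
  have "mlin (\<lambda>xs. if Suc i < n then g (merge i xs) else rot (\<lambda>ys. g (merge 0 ys)) xs)" for n
    using g by (cases "Suc i < n") (simp_all add: mlin_merge mlin_rot)
  then show ?thesis unfolding face_def[abs_def]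
    by (rule mlin_index[of "\<lambda>n m xs. if Suc i < n then g (merge i xs) else rot (\<lambda>ys. g (merge 0 ys)) xs"])
qed

lemma mlin_cyc: "mlin g \<Longrightarrow> mlin (cyc g)"
  unfolding cyc_def[abs_def]
  using mlin_index[of "\<lambda>n m xs. (- 1) ^ (n - 1) * rot g xs"] by (simp add: mlin_scale mlin_rot)

lemma mlin_hoch: "mlin g \<Longrightarrow> mlin (hoch g)"
proof -
  assume g: "mlin g"
  have "mlin (\<lambda>xs. if n < 2 then 0 else \<Sum>i<n. (- 1) ^ i * face i g xs)" for n :: nat
    using g by (cases "n < 2") (simp_all add: mlin_scale mlin_sum mlin_0 mlin_face)
  then show ?thesis unfolding hoch_def[abs_def]
    by (rule mlin_index[of "\<lambda>n m xs. if n < 2 then 0 else \<Sum>i<n. (- 1) ^ i * face i g xs"])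
qed

lemma mlin_unit_ins:
  assumes g: "mlin g"
  shows "mlin (unit_ins g)"
proof (rule mlinI)
  fix us vs :: "(nat \<times> 'a) list" and e x y c
  assume h: "hom_list us" "hom_list vs" "x \<in> A e"
  show "unit_ins g (us @ (e, c *s x) # vs) = c * unit_ins g (us @ (e, x) # vs)"
    using mlin_scale_arg[OF g, of us "vs @ [(0, 1)]" x e c] h by (simp add: unit_ins_def one_A)
  show "unit_ins g (us @ (e, x + y) # vs) = unit_ins g (us @ (e, x) # vs) + unit_ins g (us @ (e, y) # vs)"
    if "y \<in> A e"
    using mlin_add_arg[OF g, of us "vs @ [(0, 1)]" x e y] h that
    by (simp add: unit_ins_def one_A algebra_simps)
qed

subsection \<open>The differential\<close>

text \<open>
  \<open>Phi xs g\<close> is \<open>g\<close> applied to \<open>\<phi>\<^sup>\<otimes>\<^sup>n\<close> of the tensor \<open>xs\<close>.  The recursion over the list, rather than the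
  usual sum in \<open>Phi_eq_sum\<close>, keeps the signs \<open>(-1)\<^bsup>|a\<^sub>0| + \<dots>\<^esup>\<close> local: they arise one factor at a time.
\<close>

primrec Phi :: "(nat \<times> 'a) list \<Rightarrow> ((nat \<times> 'a) list \<Rightarrow> 'k) \<Rightarrow> 'k" where
  "Phi [] g = 0"
| "Phi (a # xs) g = (if 0 < fst a then g ((fst a - 1, \<phi> (snd a)) # xs) else 0) +
     (- 1) ^ fst a * Phi xs (\<lambda>ys. g (a # ys))"

lemma Phi_eq_sum:
  "Phi xs g = (\<Sum>i | i < length xs \<and> 0 < fst (xs ! i).
      (- 1) ^ deg (take i xs) * g (xs[i := (fst (xs ! i) - 1, \<phi> (snd (xs ! i)))]))"
proof -
  have "Phi xs g = (\<Sum>i<length xs. if 0 < fst (xs ! i) then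
      (- 1) ^ deg (take i xs) * g (xs[i := (fst (xs ! i) - 1, \<phi> (snd (xs ! i)))]) else 0)"
  proof (induction xs arbitrary: g)
    case (Cons a xs)
    show ?case
      by (simp add: Cons.IH sum.lessThan_Suc_shift sum_distrib_left power_add mult.assoc if_distrib cong: if_cong
           del: sum.lessThan_Suc)
  qed simp
  also have "\<dots> = (\<Sum>i\<in>{i \<in> {..<length xs}. 0 < fst (xs ! i)}.
      (- 1) ^ deg (take i xs) * g (xs[i := (fst (xs ! i) - 1, \<phi> (snd (xs ! i)))]))"
    by (rule sum.inter_filter[symmetric]) simp
  finally show ?thesis by (simp add: lessThan_def)
qed

lemma Phi_append:
  "Phi (xs @ ys) g = Phi xs (\<lambda>u. g (u @ ys)) + (- 1) ^ deg xs * Phi ys (\<lambda>v. g (xs @ v))"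
  by (induction xs arbitrary: g) (auto simp: power_add algebra_simps)

lemma Phi_cong:
  assumes "hom_list xs"
    and "\<And>ys. hom_list ys \<Longrightarrow> length ys = length xs \<Longrightarrow> Suc (deg ys) = deg xs \<Longrightarrow> g ys = h ys"
  shows "Phi xs g = Phi xs h"
  using assms
proof (induction xs arbitrary: g h)
  case (Cons a xs)
  have "Phi xs (\<lambda>ys. g (a # ys)) = Phi xs (\<lambda>ys. h (a # ys))"
    using Cons.prems by (intro Cons.IH) auto
  moreover have "g ((fst a - 1, \<phi> (snd a)) # xs) = h ((fst a - 1, \<phi> (snd a)) # xs)" if "0 < fst a"
    using Cons.prems(1) that by (intro Cons.prems(2)) (auto simp: \<phi>_pred[simplified])
  ultimately show ?case by simp
qed simp

lemma Phi_add: "Phi xs (\<lambda>ys. g ys + h ys) = Phi xs g + Phi xs h"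
  by (simp add: Phi_eq_sum sum.distrib distrib_left)

lemma Phi_scale: "Phi xs (\<lambda>ys. c * g ys) = c * Phi xs g"
  by (simp add: Phi_eq_sum sum_distrib_left mult_ac)

lemma Phi_0: "Phi xs (\<lambda>ys. 0) = 0"
  by (simp add: Phi_eq_sum)

lemma Phi_diff: "Phi xs (\<lambda>ys. g ys - h ys) = Phi xs g - Phi xs h"
  by (simp add: Phi_eq_sum sum_subtractf right_diff_distrib)

lemma Phi_sum: "Phi xs (\<lambda>ys. \<Sum>i\<in>I. c i * g i ys) = (\<Sum>i\<in>I. c i * Phi xs (g i))"
  unfolding Phi_eq_sum sum_distrib_left by (subst sum.swap) (simp add: mult_ac)

lemma Phi_Phi:
  assumes "mlin g" "hom_list xs"
  shows "Phi xs (\<lambda>ys. Phi ys g) = 0"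
  using assms
proof (induction xs arbitrary: g)
  case (Cons a xs)
  have a: "snd a \<in> A (fst a)" and xs: "hom_list xs" using Cons.prems by auto
  let ?a' = "(fst a - 1, \<phi> (snd a))" and ?s = "(- 1 :: 'k) ^ fst a"
  let ?P = "Phi xs (\<lambda>ys. g (?a' # ys))"
  have IH: "Phi xs (\<lambda>ys. Phi ys (\<lambda>zs. g (a # zs))) = 0"
    using Cons.IH[OF mlin_Cons[OF Cons.prems(1) a] xs] .
  have zero: "g ((e, \<phi> (\<phi> (snd a))) # xs) = 0" for e
    using mlin_zero_arg[OF Cons.prems(1), of "[]" xs e] xs by (simp add: \<phi>_\<phi>)
  have tail: "Phi xs (\<lambda>ys. Phi (a # ys) g) = (if 0 < fst a then ?P else 0)"
    by (simp add: Phi_add Phi_scale Phi_0 IH)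
  have head: "Phi (?a' # xs) g = (- 1) ^ (fst a - 1) * ?P"
    by (simp add: zero)
  show ?case
  proof (cases "0 < fst a")
    case True
    then have "?s = - ((- 1) ^ (fst a - 1))" by (cases "fst a") auto
    then show ?thesis using True unfolding Phi.simps(2)[of a xs "\<lambda>ys. Phi ys g"] tail head by simp
  next
    case False
    then show ?thesis unfolding Phi.simps(2)[of a xs "\<lambda>ys. Phi ys g"] tail by simp
  qed
qed simp

text \<open>
  Passing \<open>\<phi> a\<close> instead of \<open>a\<close> through the tensor \<open>ys\<close> changes the Koszul sign by \<open>(-1)\<close> to the degree
  of \<open>ys\<close>, which is the sign with which \<open>\<phi>\<close> reaches the last factor.
\<close>

lemma Phi_rot:
  assumes "xs \<noteq> []" "hom_list xs"
  shows "Phi xs (rot g) = rot (\<lambda>ys. Phi ys g) xs"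
proof -
  obtain ys a where xs: "xs = ys @ [a]" using assms by (cases xs rule: rev_cases) auto
  let ?s = "(- 1 :: 'k) ^ (fst a * deg ys)"
  have "Phi ys (\<lambda>u. rot g (u @ [a])) = Phi ys (\<lambda>u. (?s * (- 1) ^ fst a) * g (a # u))"
  proof (rule Phi_cong)
    fix u :: "(nat \<times> 'a) list" assume "Suc (deg u) = deg ys"
    then have d: "deg ys = Suc (deg u)" by simp
    show "rot g (u @ [a]) = (?s * (- 1) ^ fst a) * g (a # u)"
      unfolding rot_snoc d by (simp add: power_add mult_ac)
  qed (use assms xs in auto)
  then have "Phi ys (\<lambda>u. rot g (u @ [a])) = (?s * (- 1) ^ fst a) * Phi ys (\<lambda>u. g (a # u))"
    by (simp only: Phi_scale)
  moreover have "(- 1) ^ deg ys * Phi [a] (\<lambda>v. rot g (ys @ v)) =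
      (if 0 < fst a then ?s * g ((fst a - 1, \<phi> (snd a)) # ys) else 0)"
  proof (cases "fst a")
    case (Suc k)
    then show ?thesis by (simp add: rot_snoc power_add)
  qed simp
  ultimately show ?thesis
    unfolding xs rot_snoc Phi_append by (simp add: algebra_simps)
qed

text \<open>
  The derivation rule of \<open>\<phi>\<close> at the position of the product.
\<close>

lemma Phi_merge:
  assumes "mlin g" "hom_list xs" "Suc i < length xs"
  shows "Phi xs (\<lambda>ys. g (merge i ys)) = Phi (merge i xs) g"
  using assms
proof (induction i arbitrary: xs g)
  case (Suc i)
  then obtain a zs where xs: "xs = a # zs" by (cases xs) auto
  have "Phi zs (\<lambda>ys. g (a # merge i ys)) = Phi (merge i zs) (\<lambda>ys. g (a # ys))"
    using Suc.prems xs by (intro Suc.IH[of "\<lambda>ys. g (a # ys)"]) (auto intro: mlin_Cons)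
  then show ?case by (simp add: xs)
next
  case 0
  then obtain a b zs where xs: "xs = a # b # zs" by (cases xs; cases "tl xs") auto
  obtain d x e y where ab: "a = (d, x)" "b = (e, y)" by (cases a; cases b)
  have h: "x \<in> A d" "y \<in> A e" "hom_list zs" using 0 by (auto simp: xs ab)
  note g = \<open>mlin g\<close>
  have lb: "\<phi> (x * y) = \<phi> x * y + (- 1) ^ d *s (x * \<phi> y)" by (rule leibniz[OF h(1)])
  have key: "(if 0 < d then g ((d - 1 + e, \<phi> x * y) # zs) else 0) + (- 1) ^ d * (if 0 < e then g ((d + (e - 1), x * \<phi> y) # zs) else 0)
     = (if 0 < d + e then g ((d + e - 1, \<phi> (x * y)) # zs) else 0)"
  proof (cases d; cases e)
    fix d' e' assume "d = Suc d'" "e = Suc e'"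
    moreover have "\<phi> x * y \<in> A (d' + Suc e')" if "d = Suc d'" "e = Suc e'"
      using h that mult_A[OF \<phi>_A, of x d' y "Suc e'"] by simp
    moreover have "x * \<phi> y \<in> A (d' + Suc e')" if "d = Suc d'" "e = Suc e'"
      using h that mult_A[OF _ \<phi>_A, of x d y e'] by simp
    ultimately show ?thesis
      using h A_scale[of "x * \<phi> y" "d' + Suc e'" "(- 1) ^ d"] mlin_add_arg[OF g, of "[]" zs "\<phi> x * y" "d' + Suc e'" "(- 1) ^ d *s (x * \<phi> y)"]
        mlin_scale_arg[OF g, of "[]" zs "x * \<phi> y" "d' + Suc e'" "(- 1) ^ d"]
      by (simp add: lb A_scale)
  next
    fix d' assume "d = Suc d'" "e = 0"
    then show ?thesis using h by (simp add: lb \<phi>_A0)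
  next
    fix e' assume "d = 0" "e = Suc e'"
    then show ?thesis using h by (simp add: lb \<phi>_A0)
  qed simp
  show ?case
    by (cases d; cases e) (use key in \<open>simp_all add: xs ab hmult_def power_add algebra_simps\<close>)
qed

lemma face_cong_hom:
  assumes h: "hom_list xs" and l: "2 \<le> length xs"
    and eq: "\<And>ys. hom_list ys \<Longrightarrow> Suc (length ys) = length xs \<Longrightarrow> deg ys = deg xs \<Longrightarrow> g ys = h' ys"
  shows "face i g xs = face i h' xs"
proof (cases "Suc i < length xs")
  case True
  then show ?thesis using length_merge[OF True] hom_list_merge[OF h] by (simp add: face_def eq)
next
  case False
  have "rot (\<lambda>ys. g (merge 0 ys)) xs = rot (\<lambda>ys. h' (merge 0 ys)) xs"
  proof (rule rot_cong)
    fix ys assume ys: "mset ys = mset xs"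
    have "Suc (length (merge 0 ys)) = length xs"
      using length_merge[of 0 ys] l mset_eq_length[OF ys] by simp
    then show "g (merge 0 ys) = h' (merge 0 ys)"
      using hom_list_mset[OF sym[OF ys] h] deg_mset[OF ys] by (intro eq) (auto intro: hom_list_merge)
  qed (use l in auto)
  with False show ?thesis by (simp add: face_def)
qed

lemma hoch_cong_hom:
  assumes h: "hom_list xs"
    and eq: "\<And>ys. hom_list ys \<Longrightarrow> ys \<noteq> [] \<Longrightarrow> Suc (length ys) = length xs \<Longrightarrow> deg ys = deg xs \<Longrightarrow> g ys = h' ys"
  shows "hoch g xs = hoch h' xs"
proof (cases "2 \<le> length xs")
  case True
  then have "face i g xs = face i h' xs" for i by (intro face_cong_hom[OF h] eq) auto
  then show ?thesis by (simp add: hoch_def)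
qed (simp add: hoch_def)

lemma connes_cong_hom:
  assumes h: "hom_list xs"
    and eq: "\<And>ys. hom_list ys \<Longrightarrow> length ys = Suc (length xs) \<Longrightarrow> deg ys = deg xs \<Longrightarrow> g ys = h' ys"
  shows "connes g xs = connes h' xs"
  unfolding connes_def
proof (rule cnorm_cong)
  fix ys assume ys: "mset ys = mset xs"
  have y: "hom_list (ys @ [(0, 1)])" "length (ys @ [(0, 1)]) = Suc (length xs)" "deg (ys @ [(0, 1)]) = deg xs"
    using hom_list_mset[OF sym[OF ys] h] mset_eq_length[OF ys] deg_mset[OF ys] one_A by auto
  have "cyc g (ys @ [(0, 1)]) = cyc h' (ys @ [(0, 1)])"
  proof (rule cyc_cong)
    fix zs assume zs: "mset zs = mset (ys @ [(0, 1)])"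
    show "g zs = h' zs"
      using hom_list_mset[OF sym[OF zs] y(1)] mset_eq_length[OF zs] deg_mset[OF zs] y(2,3) by (intro eq) auto
  qed simp
  moreover have "g (ys @ [(0, 1)]) = h' (ys @ [(0, 1)])" by (rule eq[OF y])
  ultimately show "unit_ins (\<lambda>xs. g xs - cyc g xs) ys = unit_ins (\<lambda>xs. h' xs - cyc h' xs) ys"
    by (simp add: unit_ins_def)
qed

lemma hoch_scale: "hoch (\<lambda>ys. c * g ys) xs = c * hoch g xs"
  by (simp add: hoch_def face_scale sum_distrib_left mult_ac)

lemma hoch_add: "hoch (\<lambda>ys. g ys + h ys) xs = hoch g xs + hoch h xs"
proof -
  have "face i (\<lambda>ys. g ys + h ys) xs = face i g xs + face i h xs" for i
    by (simp add: face_def rot_def algebra_simps)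
  then show ?thesis by (simp add: hoch_def distrib_left sum.distrib)
qed

lemma connes_scale: "connes (\<lambda>ys. c * g ys) xs = c * connes g xs"
proof -
  have "unit_ins (\<lambda>xs. c * g xs - cyc (\<lambda>ys. c * g ys) xs) = (\<lambda>ys. c * unit_ins (\<lambda>xs. g xs - cyc g xs) ys)"
    by (rule ext) (simp add: unit_ins_def cyc_scale algebra_simps)
  then show ?thesis by (simp add: connes_def cnorm_scale)
qed

lemma connes_diff: "connes (\<lambda>ys. g ys - h ys) xs = connes g xs - connes h xs"
proof -
  have "unit_ins (\<lambda>xs. (g xs - h xs) - cyc (\<lambda>ys. g ys - h ys) xs) =
     (\<lambda>ys. unit_ins (\<lambda>xs. g xs - cyc g xs) ys - unit_ins (\<lambda>xs. h xs - cyc h xs) ys)"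
    by (rule ext) (simp add: unit_ins_def cyc_diff algebra_simps)
  then show ?thesis by (simp add: connes_def cnorm_diff)
qed

lemma connes_add: "connes (\<lambda>ys. g ys + h ys) xs = connes g xs + connes h xs"
  using connes_diff[of g "\<lambda>ys. (- 1) * h ys"] connes_scale[of "- 1" h] by simp

lemma Phi_face:
  assumes g: "mlin g" and h: "hom_list xs" and l: "2 \<le> length xs"
  shows "Phi xs (face i g) = face i (\<lambda>ys. Phi ys g) xs"
proof (cases "Suc i < length xs")
  case True
  have "Phi xs (face i g) = Phi xs (\<lambda>ys. g (merge i ys))"
    by (rule Phi_cong[OF h]) (use True in \<open>simp add: face_def\<close>)
  then show ?thesis using True by (simp add: Phi_merge[OF g h] face_def)
next
  case False
  have ne: "xs \<noteq> []" using l by auto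
  have "Phi xs (face i g) = Phi xs (rot (\<lambda>ys. g (merge 0 ys)))"
    by (rule Phi_cong[OF h]) (use False in \<open>simp add: face_def\<close>)
  also have "\<dots> = rot (\<lambda>ys. Phi ys (\<lambda>zs. g (merge 0 zs))) xs" by (rule Phi_rot[OF ne h])
  also have "\<dots> = rot (\<lambda>ys. Phi (merge 0 ys) g) xs"
  proof (rule rot_cong[OF ne])
    fix ys assume ys: "mset ys = mset xs"
    show "Phi ys (\<lambda>zs. g (merge 0 zs)) = Phi (merge 0 ys) g"
      using hom_list_mset[OF sym[OF ys] h] mset_eq_length[OF ys] l by (intro Phi_merge[OF g]) auto
  qed
  finally show ?thesis using False by (simp add: face_def)
qed

lemma Phi_hoch:
  assumes g: "mlin g" and h: "hom_list xs"
  shows "Phi xs (hoch g) = hoch (\<lambda>ys. Phi ys g) xs"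
proof (cases "2 \<le> length xs")
  case True
  have "Phi xs (hoch g) = Phi xs (\<lambda>ys. \<Sum>i<length xs. (- 1) ^ i * face i g ys)"
    by (rule Phi_cong[OF h]) (use True in \<open>simp add: hoch_def\<close>)
  also have "\<dots> = (\<Sum>i<length xs. (- 1) ^ i * face i (\<lambda>ys. Phi ys g) xs)"
    by (simp add: Phi_sum Phi_face[OF g h True])
  finally show ?thesis using True by (simp add: hoch_def)
next
  case False
  have "Phi xs (hoch g) = Phi xs (\<lambda>_. 0)"
    by (rule Phi_cong[OF h]) (use False in \<open>simp add: hoch_def\<close>)
  then show ?thesis using False by (simp add: hoch_def Phi_0)
qed

lemma Phi_cyc:
  assumes ne: "xs \<noteq> []" and h: "hom_list xs"
  shows "Phi xs (cyc g) = cyc (\<lambda>ys. Phi ys g) xs"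
proof -
  have "Phi xs (cyc g) = Phi xs (\<lambda>ys. (- 1) ^ (length xs - 1) * rot g ys)"
    by (rule Phi_cong[OF h]) (simp add: cyc_def)
  then show ?thesis by (simp add: Phi_scale Phi_rot[OF ne h] cyc_def)
qed

lemma Phi_cyc_pow:
  assumes "xs \<noteq> []" and "hom_list xs"
  shows "Phi xs ((cyc ^^ i) g) = (cyc ^^ i) (\<lambda>ys. Phi ys g) xs"
  using assms
proof (induction i arbitrary: xs)
  case (Suc i)
  have "Phi xs (cyc ((cyc ^^ i) g)) = cyc (\<lambda>ys. Phi ys ((cyc ^^ i) g)) xs"
    by (rule Phi_cyc[OF Suc.prems])
  also have "\<dots> = cyc ((cyc ^^ i) (\<lambda>ys. Phi ys g)) xs"
  proof (rule cyc_cong[OF Suc.prems(1)])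
    fix ys assume ys: "mset ys = mset xs"
    then have "ys \<noteq> []" using Suc.prems by auto
    then show "Phi ys ((cyc ^^ i) g) = (cyc ^^ i) (\<lambda>ys. Phi ys g) ys"
      by (rule Suc.IH) (rule hom_list_mset[OF sym[OF ys] Suc.prems(2)])
  qed
  finally show ?case by simp
qed simp

lemma Phi_cnorm:
  assumes ne: "xs \<noteq> []" and h: "hom_list xs"
  shows "Phi xs (cnorm g) = cnorm (\<lambda>ys. Phi ys g) xs"
proof -
  have "Phi xs (cnorm g) = Phi xs (\<lambda>ys. \<Sum>i<length xs. 1 * (cyc ^^ i) g ys)"
    by (rule Phi_cong[OF h]) (simp add: cnorm_def)
  then show ?thesis unfolding Phi_sum by (simp add: Phi_cyc_pow[OF ne h] cnorm_def)
qed

lemma Phi_unit_ins: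
  assumes h: "hom_list xs"
  shows "Phi xs (unit_ins g) = unit_ins (\<lambda>ys. Phi ys g) xs"
proof -
  have "Phi xs (unit_ins g) = Phi xs (\<lambda>ys. (- 1) ^ (length xs - 1) * g (ys @ [(0, 1)]))"
    by (rule Phi_cong[OF h]) (simp add: unit_ins_def)
  then show ?thesis by (simp add: Phi_scale Phi_append unit_ins_def)
qed

lemma Phi_connes:
  assumes ne: "xs \<noteq> []" and h: "hom_list xs"
  shows "Phi xs (connes g) = connes (\<lambda>ys. Phi ys g) xs"
  unfolding connes_def Phi_cnorm[OF ne h]
proof (rule cnorm_cong)
  fix ys assume ys: "mset ys = mset xs"
  have y: "hom_list ys" "hom_list (ys @ [(0, 1)])" using hom_list_mset[OF sym[OF ys] h] one_A by auto
  show "Phi ys (unit_ins (\<lambda>xs. g xs - cyc g xs)) = unit_ins (\<lambda>xs. Phi xs g - cyc (\<lambda>ys. Phi ys g) xs) ys"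
    unfolding Phi_unit_ins[OF y(1)] Phi_diff
    by (rule unit_ins_cong) (simp add: Phi_cyc[OF _ y(2)])
qed

text \<open>
  On an argument of length \<open>n + 1\<close> and degree \<open>m + 1\<close> the sign is \<open>(-1)\<^sup>n (-1)\<^sup>m\<close>, so that \<open>Psi\<close> is the
  summand \<open>(-1)\<^sup>n \<delta>\<close> of the total differential.  With this sign it anticommutes with \<open>b\<close> and \<open>B\<close>,
  which change the length by one.
\<close>

definition Psi :: "((nat \<times> 'a) list \<Rightarrow> 'k) \<Rightarrow> (nat \<times> 'a) list \<Rightarrow> 'k" where
  "Psi g xs = (- 1) ^ (length xs + deg xs) * Phi xs g"

lemma Psi_cong_hom:
  assumes "hom_list xs"
    and "\<And>ys. hom_list ys \<Longrightarrow> length ys = length xs \<Longrightarrow> Suc (deg ys) = deg xs \<Longrightarrow> g ys = h ys"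
  shows "Psi g xs = Psi h xs"
  unfolding Psi_def using Phi_cong[OF assms] by simp

lemma Psi_add: "Psi (\<lambda>ys. g ys + h ys) xs = Psi g xs + Psi h xs"
  by (simp add: Psi_def Phi_add distrib_left)

lemma Psi_scale: "Psi (\<lambda>ys. c * g ys) xs = c * Psi g xs"
  by (simp add: Psi_def Phi_scale)

theorem Psi_Psi:
  assumes "mlin g" "hom_list xs"
  shows "Psi (Psi g) xs = 0"
proof -
  have "Phi xs (Psi g) = Phi xs (\<lambda>ys. (- 1) ^ Suc (length xs + deg xs) * Phi ys g)"
  proof (rule Phi_cong[OF assms(2)])
    fix ys :: "(nat \<times> 'a) list" assume "length ys = length xs" "Suc (deg ys) = deg xs"
    then have e: "length xs + deg xs = Suc (length ys + deg ys)" by simp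
    show "Psi g ys = (- 1) ^ Suc (length xs + deg xs) * Phi ys g" unfolding Psi_def e by simp
  qed
  then show ?thesis by (simp only: Psi_def Phi_scale Phi_Phi[OF assms]) simp
qed

theorem hoch_Psi:
  assumes g: "mlin g" and h: "hom_list xs"
  shows "hoch (Psi g) xs + Psi (hoch g) xs = 0"
proof -
  have "hoch (Psi g) xs = hoch (\<lambda>ys. (- 1) ^ Suc (length xs + deg xs) * Phi ys g) xs"
  proof (rule hoch_cong_hom[OF h])
    fix ys :: "(nat \<times> 'a) list" assume "Suc (length ys) = length xs" "deg ys = deg xs"
    then have e: "length xs + deg xs = Suc (length ys + deg ys)" by simp
    show "Psi g ys = (- 1) ^ Suc (length xs + deg xs) * Phi ys g" unfolding Psi_def e by simp
  qed
  then show ?thesis by (simp only: hoch_scale) (simp add: Psi_def Phi_hoch[OF g h])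
qed

theorem connes_Psi:
  assumes ne: "xs \<noteq> []" and h: "hom_list xs"
  shows "connes (Psi g) xs + Psi (connes g) xs = 0"
proof -
  have "connes (Psi g) xs = connes (\<lambda>ys. (- 1) ^ Suc (length xs + deg xs) * Phi ys g) xs"
    by (rule connes_cong_hom[OF h]) (simp add: Psi_def)
  then show ?thesis by (simp only: connes_scale) (simp add: Psi_def Phi_connes[OF ne h])
qed

end

section \<open>Cochains as multilinear functions\<close>

abbreviation pscale :: "'k::field \<Rightarrow> ('b \<Rightarrow>\<^sub>0 'k) \<Rightarrow> ('b \<Rightarrow>\<^sub>0 'k)" where
  "pscale c \<equiv> Poly_Mapping.map ((*) c)"

lemma lookup_pscale [simp]: "Poly_Mapping.lookup (pscale c u) x = c * Poly_Mapping.lookup u x"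
  by (simp add: Poly_Mapping.map.rep_eq when_def)

lemma vector_space_poly_mapping: "vector_space (pscale :: 'k::field \<Rightarrow> ('b \<Rightarrow>\<^sub>0 'k) \<Rightarrow> _)"
  by unfold_locales (auto intro!: poly_mapping_eqI simp: lookup_add algebra_simps)

lemma vector_space_pointwise: "vector_space (\<lambda>(c::'k::field) f w. c * f w)"
  by unfold_locales (auto simp: fun_eq_iff algebra_simps)

lemma poly_mapping_sum_singles:
  "u = (\<Sum>x\<in>Poly_Mapping.keys u. Poly_Mapping.single x (Poly_Mapping.lookup u x))"
  by (rule poly_mapping_eqI) (simp add: lookup_sum lookup_single when_def in_keys_iff)

lemma single_eq_pscale: "Poly_Mapping.single x c = pscale c (Poly_Mapping.single x 1)"
  by (rule poly_mapping_eqI) (simp add: lookup_single when_def)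

lemma sum_fun_apply: "(\<Sum>i\<in>I. f i) w = (\<Sum>i\<in>I. f i w)"
  by (induction I rule: infinite_finite_induct) simp_all

definition lin_comb :: "('k::field \<Rightarrow> 'w \<Rightarrow> 'w) \<Rightarrow> ('b \<Rightarrow> 'w) \<Rightarrow> ('b \<Rightarrow>\<^sub>0 'k) \<Rightarrow> 'w::ab_group_add" where
  "lin_comb s g u = (\<Sum>x\<in>Poly_Mapping.keys u. s (Poly_Mapping.lookup u x) (g x))"

context vector_space
begin

lemma lin_comb_superset:
  assumes "finite S" "Poly_Mapping.keys u \<subseteq> S"
  shows "lin_comb scale g u = (\<Sum>x\<in>S. Poly_Mapping.lookup u x *s g x)"
  unfolding lin_comb_def using assms by (intro sum.mono_neutral_left) (auto simp: in_keys_iff)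

lemma lin_comb_add: "lin_comb scale g (u + v) = lin_comb scale g u + lin_comb scale g v"
proof -
  let ?S = "Poly_Mapping.keys u \<union> Poly_Mapping.keys v"
  have "Poly_Mapping.keys (u + v) \<subseteq> ?S" by (rule Poly_Mapping.keys_add)
  then show ?thesis
    by (simp add: lin_comb_superset[of ?S] lookup_add scale_left_distrib sum.distrib)
qed

lemma lin_comb_pscale: "lin_comb scale g (pscale c u) = c *s lin_comb scale g u"
proof -
  have "Poly_Mapping.keys (pscale c u) \<subseteq> Poly_Mapping.keys u" by (auto simp: in_keys_iff)
  then show ?thesis
    by (simp add: lin_comb_superset[of "Poly_Mapping.keys u"] scale_sum_right)
qed

lemma lin_comb_diff: "lin_comb scale g (u - v) = lin_comb scale g u - lin_comb scale g v"
  using lin_comb_add[of g "u - v" v] by (simp add: algebra_simps)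

lemma lin_comb_single: "lin_comb scale g (Poly_Mapping.single x c) = c *s g x"
  by (cases "c = 0") (simp_all add: lin_comb_def)

end

lemma lin_combineD:
  assumes "lin M N h" "x \<in> carrier M" "y \<in> carrier M"
  shows "h (x \<oplus>\<^bsub>M\<^esub> y) = h x \<oplus>\<^bsub>N\<^esub> h y" "h (c \<odot>\<^bsub>M\<^esub> x) = c \<odot>\<^bsub>N\<^esub> h x" "h x \<in> carrier N"
  using assms by (auto simp: lin_def)

lemma scalars_sel [simp]:
  "carrier scalars = UNIV" "zero scalars = 0" "add scalars = (+)" "module.smult scalars = (*)"
  by (simp_all add: scalars_def)

context dga
begin

interpretation free: vector_space "pscale :: 'k \<Rightarrow> ((nat \<times> 'a) list \<Rightarrow>\<^sub>0 'k) \<Rightarrow> _"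
  by (rule vector_space_poly_mapping)

interpretation self: vector_space "(*) :: 'k \<Rightarrow> 'k \<Rightarrow> 'k"
  by unfold_locales (simp_all add: algebra_simps)

interpretation free_pair: vector_space_pair "pscale :: 'k \<Rightarrow> ((nat \<times> 'a) list \<Rightarrow>\<^sub>0 'k) \<Rightarrow> _"
  "pscale :: 'k \<Rightarrow> ((nat \<times> 'a) list \<Rightarrow>\<^sub>0 'k) \<Rightarrow> _" ..

definition Free :: "nat \<Rightarrow> nat \<Rightarrow> ((nat \<times> 'a) list \<Rightarrow>\<^sub>0 'k) set" where
  "Free n m = {u. Poly_Mapping.keys u \<subseteq> hlists n m}"

abbreviation sgl :: "(nat \<times> 'a) list \<Rightarrow> (nat \<times> 'a) list \<Rightarrow>\<^sub>0 'k" where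
  "sgl xs \<equiv> Poly_Mapping.single xs 1"

lemma Free_iff: "u \<in> Free n m \<longleftrightarrow> (\<forall>x. x \<notin> hlists n m \<longrightarrow> Poly_Mapping.lookup u x = 0)"
  by (auto simp: Free_def in_keys_iff)

lemma free_space_eq: "free_space n m = vspace (Free n m) 0 (+) pscale"
  by (simp add: free_space_def Free_def)

lemma subspace_Free: "free.subspace (Free n m)"
  by (rule free.subspaceI) (auto simp: Free_iff lookup_add)

lemma single_Free: "xs \<in> hlists n m \<Longrightarrow> Poly_Mapping.single xs c \<in> Free n m"
  unfolding Free_iff by (auto simp: lookup_single when_def)

lemma hlists_update:
  assumes "xs \<in> hlists n m" "i < n" "x \<in> A (fst (xs ! i))"
  shows "xs[i := (fst (xs ! i), x)] \<in> hlists n m"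
proof -
  have "i < length xs" using assms by (simp add: hlists_iff)
  then have xs: "xs = take i xs @ xs ! i # drop (Suc i) xs" "length (take i xs) = i"
    by (simp_all add: id_take_nth_drop)
  then obtain us w vs where "xs = us @ w # vs" "i = length us" by metis
  then show ?thesis using assms by (simp add: hlists_iff)
qed

lemma multilinearityE:
  assumes "u \<in> multilinearity n m"
  obtains us e x y vs where "us @ (e, x) # vs \<in> hlists n m" "x \<in> A e" "y \<in> A e"
      "u = sgl (us @ (e, x + y) # vs) - sgl (us @ (e, x) # vs) - sgl (us @ (e, y) # vs)"
    | us e c x vs where "us @ (e, x) # vs \<in> hlists n m" "x \<in> A e"
      "u = sgl (us @ (e, c *s x) # vs) - Poly_Mapping.single (us @ (e, x) # vs) c"
proof -
  have upd: "xs[i := (fst (xs ! i), z)] = take i xs @ (fst (xs ! i), z) # drop (Suc i) xs"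
    if "xs \<in> hlists n m" "i < n" for xs i z
    using that by (simp add: hlists_iff upd_conv_take_nth_drop)
  from assms consider xs i x y where "xs \<in> hlists n m" "i < n" "x \<in> A (fst (xs ! i))" "y \<in> A (fst (xs ! i))"
      "u = sgl (xs[i := (fst (xs ! i), x + y)]) - sgl (xs[i := (fst (xs ! i), x)]) - sgl (xs[i := (fst (xs ! i), y)])"
    | xs i c x where "xs \<in> hlists n m" "i < n" "x \<in> A (fst (xs ! i))"
      "u = sgl (xs[i := (fst (xs ! i), c *s x)]) - Poly_Mapping.single (xs[i := (fst (xs ! i), x)]) c"
    unfolding multilinearity_def by blast
  then show thesis
  proof cases
    case 1
    show thesis
      by (rule that(1)[of "take i xs" "fst (xs ! i)" x "drop (Suc i) xs" y])
         (use 1 hlists_update[OF 1(1,2,3)] upd[OF 1(1,2)] in simp_all)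
  next
    case 2
    show thesis
      by (rule that(2)[of "take i xs" "fst (xs ! i)" x "drop (Suc i) xs" c])
         (use 2 hlists_update[OF 2(1,2,3)] upd[OF 2(1,2)] in simp_all)
  qed
qed

lemma multilinearity_Free: "multilinearity n m \<subseteq> Free n m"
proof
  fix u assume "u \<in> multilinearity n m"
  then show "u \<in> Free n m"
  proof (cases rule: multilinearityE)
    case (1 us e x y vs)
    then have "us @ (e, z) # vs \<in> hlists n m" if "z \<in> A e" for z using that by (simp add: hlists_iff)
    then show ?thesis using 1
      by (auto intro!: free.subspace_diff[OF subspace_Free] single_Free A_add)
  next
    case (2 us e c x vs)
    then have "us @ (e, z) # vs \<in> hlists n m" if "z \<in> A e" for z using that by (simp add: hlists_iff)
    then show ?thesis using 2
      by (auto intro!: free.subspace_diff[OF subspace_Free] single_Free A_scale)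
  qed
qed

lemma tensor_rels_subspace: "free.subspace (tensor_rels n m)"
  and tensor_rels_Free: "tensor_rels n m \<subseteq> Free n m"
  and multilinearity_rels: "multilinearity n m \<subseteq> tensor_rels n m"
  and tensor_rels_minimal:
    "free.subspace U \<Longrightarrow> U \<subseteq> Free n m \<Longrightarrow> multilinearity n m \<subseteq> U \<Longrightarrow> tensor_rels n m \<subseteq> U"
proof -
  have sub: "is_subspace U (free_space n m) \<longleftrightarrow> free.subspace U \<and> U \<subseteq> Free n m" for U
    unfolding free_space_eq by (rule free.is_subspace_iff[OF subspace_Free])
  have eq: "tensor_rels n m = \<Inter>{U. (free.subspace U \<and> U \<subseteq> Free n m) \<and> multilinearity n m \<subseteq> U}"
    unfolding tensor_rels_def hull_def sub ..
  show "free.subspace (tensor_rels n m)" unfolding eq by (rule free.subspace_Inter) auto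
  show "tensor_rels n m \<subseteq> Free n m" unfolding eq using subspace_Free multilinearity_Free by blast
  show "multilinearity n m \<subseteq> tensor_rels n m" unfolding eq by blast
  show "free.subspace U \<Longrightarrow> U \<subseteq> Free n m \<Longrightarrow> multilinearity n m \<subseteq> U \<Longrightarrow> tensor_rels n m \<subseteq> U"
    unfolding eq by blast
qed

lemma add_rel:
  assumes "us @ (e, x) # vs \<in> hlists n m" "x \<in> A e" "y \<in> A e"
  shows "sgl (us @ (e, x + y) # vs) - sgl (us @ (e, x) # vs) - sgl (us @ (e, y) # vs) \<in> tensor_rels n m"
proof (rule subsetD[OF multilinearity_rels], unfold multilinearity_def, intro UnI1 CollectI exI conjI)
  let ?xs = "us @ (e, x) # vs" and ?i = "length us"
  show "sgl (us @ (e, x + y) # vs) - sgl (us @ (e, x) # vs) - sgl (us @ (e, y) # vs) =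
    sgl (?xs[?i := (e, x + y)]) - sgl (?xs[?i := (e, x)]) - sgl (?xs[?i := (e, y)])" by simp
qed (use assms in \<open>auto simp: hlists_iff\<close>)

lemma scale_rel:
  assumes "us @ (e, x) # vs \<in> hlists n m" "x \<in> A e"
  shows "sgl (us @ (e, c *s x) # vs) - Poly_Mapping.single (us @ (e, x) # vs) c \<in> tensor_rels n m"
proof (rule subsetD[OF multilinearity_rels], unfold multilinearity_def, intro UnI2 CollectI exI conjI)
  let ?xs = "us @ (e, x) # vs" and ?i = "length us"
  show "sgl (us @ (e, c *s x) # vs) - Poly_Mapping.single (us @ (e, x) # vs) c =
    sgl (?xs[?i := (e, c *s x)]) - Poly_Mapping.single (?xs[?i := (e, x)]) c" by simp
qed (use assms in \<open>auto simp: hlists_iff\<close>)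

lemma tensor_power_eq: "tensor_power n m = subquotient pscale (Free n m) (tensor_rels n m)"
  by (simp add: tensor_power_def free_space_eq)

lemma tensor_class_eq: "tensor_class n m u = coset (tensor_rels n m) u"
  by (simp add: tensor_class_def free_space_eq)

lemma pure_eq: "xs \<in> hlists n m \<Longrightarrow> pure xs = coset (tensor_rels n m) (sgl xs)"
  by (simp add: pure_def tensor_class_eq hlists_iff)

lemma carrier_tensor_power: "carrier (tensor_power n m) = coset (tensor_rels n m) ` Free n m"
  by (simp add: tensor_power_eq)

lemma pure_carrier: "xs \<in> hlists n m \<Longrightarrow> pure xs \<in> carrier (tensor_power n m)"
  by (simp add: pure_eq carrier_tensor_power single_Free)

lemma add_tensor: "coset (tensor_rels n m) u \<oplus>\<^bsub>tensor_power n m\<^esub> coset (tensor_rels n m) v = coset (tensor_rels n m) (u + v)"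
  unfolding tensor_power_eq by (rule free.add_coset[OF tensor_rels_subspace])

lemma smult_tensor: "c \<odot>\<^bsub>tensor_power n m\<^esub> coset (tensor_rels n m) u = coset (tensor_rels n m) (pscale c u)"
  unfolding tensor_power_eq by (rule free.smult_coset[OF tensor_rels_subspace])

text \<open>Pure tensors span.\<close>

lemma Free_induct:
  assumes U: "free.subspace U" and s: "\<And>xs. xs \<in> hlists n m \<Longrightarrow> sgl xs \<in> U" and u: "u \<in> Free n m"
  shows "u \<in> U"
proof -
  have "Poly_Mapping.single x (Poly_Mapping.lookup u x) \<in> U" if "x \<in> Poly_Mapping.keys u" for x
    by (subst single_eq_pscale, rule free.subspace_scale[OF U s]) (use that u in \<open>auto simp: Free_def\<close>)
  then have "(\<Sum>x\<in>Poly_Mapping.keys u. Poly_Mapping.single x (Poly_Mapping.lookup u x)) \<in> U"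
    by (rule free.subspace_sum[OF U])
  then show ?thesis by (subst poly_mapping_sum_singles)
qed

text \<open>
  Linear maps on a tensor power are determined by their values on pure tensors.  The hypothesis on
  scalar multiples by 0 holds in every vector space; it says that both maps agree at 0.
\<close>

lemma Hom_set_eqI:
  assumes W: "\<And>w w'. w \<in> carrier W \<Longrightarrow> w' \<in> carrier W \<Longrightarrow> (0::'k) \<odot>\<^bsub>W\<^esub> w = 0 \<odot>\<^bsub>W\<^esub> w'"
    and h: "h \<in> Hom_set (tensor_power n m) W" "h' \<in> Hom_set (tensor_power n m) W"
    and eq: "\<And>xs. xs \<in> hlists n m \<Longrightarrow> h (pure xs) = h' (pure xs)"
  shows "h = h'"
proof
  fix w
  let ?c = "coset (tensor_rels n m)"
  let ?U = "{u \<in> Free n m. h (?c u) = h' (?c u)}"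
  have l: "lin (tensor_power n m) W h" "lin (tensor_power n m) W h'" using h by (auto simp: Hom_set_def)
  have c: "?c u \<in> carrier (tensor_power n m)" if "u \<in> Free n m" for u
    using that by (auto simp: carrier_tensor_power)
  note add = lin_combineD(1)[OF l(1) c c, unfolded add_tensor] lin_combineD(1)[OF l(2) c c, unfolded add_tensor]
  note sm = lin_combineD(2)[OF l(1) c c, unfolded smult_tensor] lin_combineD(2)[OF l(2) c c, unfolded smult_tensor]
  have U: "free.subspace ?U"
  proof (rule free.subspaceI)
    have z: "0 \<in> Free n m" by (rule free.subspace_0[OF subspace_Free])
    have h0: "h (?c 0) = 0 \<odot>\<^bsub>W\<^esub> h (?c 0)" "h' (?c 0) = 0 \<odot>\<^bsub>W\<^esub> h' (?c 0)"
      using sm(1)[OF z z, of 0] sm(2)[OF z z, of 0] by simp_all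
    have "h (?c 0) \<in> carrier W" "h' (?c 0) \<in> carrier W"
      using lin_combineD(3)[OF l(1) c[OF z] c[OF z]] lin_combineD(3)[OF l(2) c[OF z] c[OF z]] by blast+
    then have "0 \<odot>\<^bsub>W\<^esub> h (?c 0) = 0 \<odot>\<^bsub>W\<^esub> h' (?c 0)" by (rule W)
    then have "h (?c 0) = h' (?c 0)" using h0 by simp
    then show "0 \<in> ?U" using z by simp
    show "x + y \<in> ?U" if "x \<in> ?U" "y \<in> ?U" for x y
      using that add[of x y] free.subspace_add[OF subspace_Free, of x n m y] by simp
    show "pscale k x \<in> ?U" if "x \<in> ?U" for k x
      using that sm[of x x k] free.subspace_scale[OF subspace_Free, of x n m k] by simp
  qed
  have "h (?c u) = h' (?c u)" if u: "u \<in> Free n m" for u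
  proof -
    have "u \<in> ?U"
      by (rule Free_induct[OF U _ u]) (use eq in \<open>simp add: pure_eq single_Free\<close>)
    then show ?thesis by simp
  qed
  then show "h w = h' w"
    using h by (cases "w \<in> carrier (tensor_power n m)") (auto simp: Hom_set_def carrier_tensor_power)
qed

lemma lin_ext_eq:
  assumes W: "\<And>w w'. w \<in> carrier W \<Longrightarrow> w' \<in> carrier W \<Longrightarrow> (0::'k) \<odot>\<^bsub>W\<^esub> w = 0 \<odot>\<^bsub>W\<^esub> w'"
    and h: "h \<in> Hom_set (tensor_power n m) W" "\<And>xs. xs \<in> hlists n m \<Longrightarrow> h (pure xs) = g xs"
  shows "lin_ext n m W g = h"
  unfolding lin_ext_def
proof (rule the_equality)
  show "h \<in> Hom_set (tensor_power n m) W \<and> (\<forall>xs\<in>hlists n m. h (pure xs) = g xs)" using h by blast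
  fix h' assume h': "h' \<in> Hom_set (tensor_power n m) W \<and> (\<forall>xs\<in>hlists n m. h' (pure xs) = g xs)"
  show "h' = h" by (rule Hom_set_eqI[OF W]) (use h h' in auto)
qed

subsection \<open>Functionals\<close>

abbreviation ext :: "((nat \<times> 'a) list \<Rightarrow> 'k) \<Rightarrow> ((nat \<times> 'a) list \<Rightarrow>\<^sub>0 'k) \<Rightarrow> 'k" where
  "ext \<equiv> lin_comb (*)"

lemma ext_rels:
  assumes g: "mlin g" and u: "u \<in> tensor_rels n m"
  shows "ext g u = 0"
proof -
  have "tensor_rels n m \<subseteq> {u \<in> Free n m. ext g u = 0}"
  proof (rule tensor_rels_minimal)
    show "free.subspace {u \<in> Free n m. ext g u = 0}"
      using free.subspace_0[OF subspace_Free, of n m] free.subspace_add[OF subspace_Free, of _ n m]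
        free.subspace_scale[OF subspace_Free, of _ n m]
      by (intro free.subspaceI) (auto simp: self.lin_comb_add self.lin_comb_pscale lin_comb_def[of _ _ 0])
    show "multilinearity n m \<subseteq> {u \<in> Free n m. ext g u = 0}"
    proof
      fix u assume u: "u \<in> multilinearity n m"
      then have "ext g u = 0"
      proof (cases rule: multilinearityE)
        case (1 us e x y vs)
        then show ?thesis using mlin_add_arg[OF g, of us vs x e y]
          by (simp add: self.lin_comb_diff self.lin_comb_single hlists_iff)
      next
        case (2 us e c x vs)
        then show ?thesis using mlin_scale_arg[OF g, of us vs x e c]
          by (simp add: self.lin_comb_diff self.lin_comb_single hlists_iff)
      qed
      then show "u \<in> {u \<in> Free n m. ext g u = 0}" using u multilinearity_Free by blast
    qed
  qed blast
  then show ?thesis using u by blast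
qed

text \<open>
  The universal property: a multilinear function extends to the free space, and its extension
  vanishes on the relations.
\<close>

lemma functional_exists:
  assumes g: "mlin g"
  shows "\<exists>h\<in>Hom_set (tensor_power n m) scalars. \<forall>u\<in>Free n m. h (coset (tensor_rels n m) u) = ext g u"
proof -
  let ?c = "coset (tensor_rels n m)"
  define h where "h w = (if w \<in> carrier (tensor_power n m) then the_elem (ext g ` w) else 0)" for w
  have h: "h (?c u) = ext g u" if "u \<in> Free n m" for u
  proof -
    have "ext g ` ?c u = {ext g u}"
    proof (intro equalityI subsetI)
      fix z assume "z \<in> ext g ` ?c u"
      then show "z \<in> {ext g u}" by (auto simp: coset_def self.lin_comb_add ext_rels[OF g])
    qed (use free.coset_self[OF tensor_rels_subspace] in auto)
    then show ?thesis using that by (auto simp: h_def carrier_tensor_power)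
  qed
  have "lin (tensor_power n m) scalars h"
    unfolding lin_def
    using free.subspace_add[OF subspace_Free] free.subspace_scale[OF subspace_Free]
    by (auto simp: carrier_tensor_power add_tensor smult_tensor h self.lin_comb_add self.lin_comb_pscale)
  then have "h \<in> Hom_set (tensor_power n m) scalars" by (auto simp: Hom_set_def h_def)
  then show ?thesis using h by blast
qed

lemma carrier_cochains: "carrier (cochains n m) = Hom_set (tensor_power (Suc n) m) scalars"
  by (simp add: cochains_def dual_def)

lemma cochain_ext:
  "f \<in> carrier (cochains n m) \<Longrightarrow> f' \<in> carrier (cochains n m) \<Longrightarrow>
    (\<And>xs. xs \<in> hlists (Suc n) m \<Longrightarrow> f (pure xs) = f' (pure xs)) \<Longrightarrow> f = f'"
  unfolding carrier_cochains by (rule Hom_set_eqI[of scalars]) auto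

lemma cochain_of:
  assumes g: "mlin g" and eq: "\<And>xs. xs \<in> hlists (Suc n) m \<Longrightarrow> g' xs = g xs"
  shows "cochain_of n m g' \<in> carrier (cochains n m)"
    and "xs \<in> hlists (Suc n) m \<Longrightarrow> cochain_of n m g' (pure xs) = g xs"
proof -
  obtain h where h: "h \<in> Hom_set (tensor_power (Suc n) m) scalars"
    "\<forall>u\<in>Free (Suc n) m. h (coset (tensor_rels (Suc n) m) u) = ext g u"
    using functional_exists[OF g] by blast
  have hp: "h (pure xs) = g xs" if "xs \<in> hlists (Suc n) m" for xs
    using h(2) single_Free[OF that, of 1] that by (simp add: pure_eq self.lin_comb_single)
  have "cochain_of n m g' = h"
    by (rule lin_ext_eq) (use h hp eq in auto)
  then show "cochain_of n m g' \<in> carrier (cochains n m)"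
    and "xs \<in> hlists (Suc n) m \<Longrightarrow> cochain_of n m g' (pure xs) = g xs"
    using h hp by (simp_all add: carrier_cochains)
qed

text \<open>
  The value 0 on lists of another length or degree makes this function multilinear without
  restriction, since varying an entry linearly stays inside or outside of \<^const>\<open>hlists\<close>.
\<close>

definition cochain_eval :: "nat \<Rightarrow> nat \<Rightarrow> ('k, 'a) cochain \<Rightarrow> (nat \<times> 'a) list \<Rightarrow> 'k" where
  "cochain_eval n m f xs = (if xs \<in> hlists (Suc n) m then f (pure xs) else 0)"

lemma mlin_cochain_eval:
  assumes f: "f \<in> carrier (cochains n m)"
  shows "mlin (cochain_eval n m f)"
proof (rule mlinI)
  let ?R = "tensor_rels (Suc n) m" and ?M = "tensor_power (Suc n) m"
  have l: "lin ?M scalars f" using f by (simp add: carrier_cochains Hom_set_def)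
  fix us vs :: "(nat \<times> 'a) list" and e x y c
  assume h: "hom_list us" "hom_list vs" "x \<in> A e"
  define H where "H \<longleftrightarrow> us @ (e, x) # vs \<in> hlists (Suc n) m"
  have H: "us @ (e, z) # vs \<in> hlists (Suc n) m \<longleftrightarrow> H" if "z \<in> A e" for z
    using that h by (simp add: H_def hlists_iff)
  show "cochain_eval n m f (us @ (e, c *s x) # vs) = c * cochain_eval n m f (us @ (e, x) # vs)"
  proof (cases H)
    case True
    have m: "us @ (e, x) # vs \<in> hlists (Suc n) m" "us @ (e, c *s x) # vs \<in> hlists (Suc n) m"
      using True H[OF h(3)] H[OF A_scale[OF h(3)]] by simp_all
    have "coset ?R (sgl (us @ (e, c *s x) # vs)) = coset ?R (pscale c (sgl (us @ (e, x) # vs)))"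
      unfolding single_eq_pscale[symmetric] free.coset_eq_iff[OF tensor_rels_subspace]
      by (rule scale_rel[OF m(1) h(3)])
    then have "pure (us @ (e, c *s x) # vs) = c \<odot>\<^bsub>?M\<^esub> pure (us @ (e, x) # vs)"
      unfolding pure_eq[OF m(1)] pure_eq[OF m(2)] smult_tensor .
    then show ?thesis
      using m lin_combineD(2)[OF l pure_carrier[OF m(1)] pure_carrier[OF m(1)], of c]
      by (simp add: cochain_eval_def)
  qed (use H[OF h(3)] H[OF A_scale[OF h(3)]] in \<open>simp add: cochain_eval_def\<close>)
  show "cochain_eval n m f (us @ (e, x + y) # vs) = cochain_eval n m f (us @ (e, x) # vs) + cochain_eval n m f (us @ (e, y) # vs)"
    if y: "y \<in> A e"
  proof (cases H)
    case True
    have m: "us @ (e, x) # vs \<in> hlists (Suc n) m" "us @ (e, y) # vs \<in> hlists (Suc n) m"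
        "us @ (e, x + y) # vs \<in> hlists (Suc n) m"
      using True H[OF h(3)] H[OF y] H[OF A_add[OF h(3) y]] by simp_all
    have "coset ?R (sgl (us @ (e, x + y) # vs)) = coset ?R (sgl (us @ (e, x) # vs) + sgl (us @ (e, y) # vs))"
      unfolding free.coset_eq_iff[OF tensor_rels_subspace] diff_diff_eq[symmetric]
      by (rule add_rel[OF m(1) h(3) y])
    then have "pure (us @ (e, x + y) # vs) = pure (us @ (e, x) # vs) \<oplus>\<^bsub>?M\<^esub> pure (us @ (e, y) # vs)"
      unfolding pure_eq[OF m(1)] pure_eq[OF m(2)] pure_eq[OF m(3)] add_tensor .
    then show ?thesis
      using m lin_combineD(1)[OF l pure_carrier[OF m(1)] pure_carrier[OF m(2)]]
      by (simp add: cochain_eval_def)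
  qed (use H[OF h(3)] H[OF y] H[OF A_add[OF h(3) y]] in \<open>simp add: cochain_eval_def\<close>)
qed

lemma cochain_eq_ext:
  assumes f: "f \<in> carrier (cochains n m)" and u: "u \<in> Free (Suc n) m"
  shows "f (coset (tensor_rels (Suc n) m) u) = ext (cochain_eval n m f) u"
proof -
  obtain h where h: "h \<in> Hom_set (tensor_power (Suc n) m) scalars"
    "\<forall>u\<in>Free (Suc n) m. h (coset (tensor_rels (Suc n) m) u) = ext (cochain_eval n m f) u"
    using functional_exists[OF mlin_cochain_eval[OF f]] by blast
  have "h (pure xs) = f (pure xs)" if "xs \<in> hlists (Suc n) m" for xs
    using h(2) single_Free[OF that, of 1] that by (simp add: pure_eq self.lin_comb_single cochain_eval_def)
  then have "h = f" using f h(1) by (intro cochain_ext[of h n m f]) (auto simp: carrier_cochains)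
  then show ?thesis using h u by blast
qed

lemma subspace_cochains: "module.subspace (\<lambda>c f w. c * f w) (carrier (cochains n m))"
proof -
  interpret fs: vector_space "\<lambda>(c::'k) (f::('k,'a) tensor \<Rightarrow> 'k) w. c * f w" by (rule vector_space_pointwise)
  show ?thesis
  proof (rule fs.subspaceI)
    show "0 \<in> carrier (cochains n m)"
      by (simp add: carrier_cochains Hom_set_def lin_def)
    fix f :: "('k, 'a) cochain" and g c
    assume f: "f \<in> carrier (cochains n m)"
    then show "(\<lambda>w. c * f w) \<in> carrier (cochains n m)"
      by (simp add: carrier_cochains Hom_set_def lin_def distrib_left mult.left_commute)
    assume "g \<in> carrier (cochains n m)"
    with f show "f + g \<in> carrier (cochains n m)"
      by (simp add: carrier_cochains Hom_set_def lin_def distrib_left)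
  qed
qed

subsection \<open>The operators on pure tensors\<close>

lemma hlists_mset: "mset ys = mset xs \<Longrightarrow> xs \<in> hlists n m \<Longrightarrow> ys \<in> hlists n m"
  using hom_list_mset[of xs ys] deg_mset[of ys xs] mset_eq_length[of ys xs] by (simp add: hlists_iff)

lemma op_tau:
  assumes f: "f \<in> carrier (cochains n m)"
  shows "op_tau n m f \<in> carrier (cochains n m)"
    and "xs \<in> hlists (Suc n) m \<Longrightarrow> op_tau n m f (pure xs) = cyc (cochain_eval n m f) xs"
proof -
  have eq: "(- 1) ^ (n + koszul xs) * f (pure (last xs # butlast xs)) = cyc (cochain_eval n m f) xs"
    if xs: "xs \<in> hlists (Suc n) m" for xs
  proof -
    obtain ys a where ya: "xs = ys @ [a]" using xs by (cases xs rule: rev_cases) (auto simp: hlists_iff)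
    have mem: "last xs # butlast xs \<in> hlists (Suc n) m" by (rule hlists_mset[OF _ xs]) (simp add: ya)
    have len: "length xs - 1 = n" using xs by (simp add: hlists_iff)
    show ?thesis by (simp only: cyc_def rot_def cochain_eval_def mem if_True len power_add mult.assoc)
  qed
  show "op_tau n m f \<in> carrier (cochains n m)"
    unfolding op_tau_def by (rule cochain_of(1)[OF mlin_cyc[OF mlin_cochain_eval[OF f]] eq])
  show "op_tau n m f (pure xs) = cyc (cochain_eval n m f) xs" if "xs \<in> hlists (Suc n) m"
    unfolding op_tau_def by (rule cochain_of(2)[OF mlin_cyc[OF mlin_cochain_eval[OF f]] eq that])
qed

lemma op_tau_pow:
  assumes f: "f \<in> carrier (cochains n m)"
  shows "(op_tau n m ^^ i) f \<in> carrier (cochains n m)"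
    and "xs \<in> hlists (Suc n) m \<Longrightarrow> (op_tau n m ^^ i) f (pure xs) = (cyc ^^ i) (cochain_eval n m f) xs"
proof (induction i arbitrary: xs)
  case 0
  { case 1 then show ?case using f by simp }
  { case 2 then show ?case by (simp add: cochain_eval_def) }
next
  case (Suc i)
  { case 1 then show ?case using op_tau(1)[OF Suc.IH(1)] by simp }
  { case 2
    have ne: "xs \<noteq> []" using 2 by (auto simp: hlists_iff)
    have "(op_tau n m ^^ Suc i) f (pure xs) = cyc (cochain_eval n m ((op_tau n m ^^ i) f)) xs"
      using op_tau(2)[OF Suc.IH(1) 2] by simp
    also have "\<dots> = cyc ((cyc ^^ i) (cochain_eval n m f)) xs"
    proof (rule cyc_cong[OF ne])
      fix ys assume "mset ys = mset xs"
      then have "ys \<in> hlists (Suc n) m" by (rule hlists_mset) (rule 2)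
      then show "cochain_eval n m ((op_tau n m ^^ i) f) ys = (cyc ^^ i) (cochain_eval n m f) ys"
        using Suc.IH(2)[of ys] by (simp add: cochain_eval_def[of n m "(op_tau n m ^^ i) f"])
    qed
    finally show ?case by simp }
qed

lemma op_N:
  assumes f: "f \<in> carrier (cochains n m)"
  shows "op_N n m f \<in> carrier (cochains n m)"
    and "xs \<in> hlists (Suc n) m \<Longrightarrow> op_N n m f (pure xs) = cnorm (cochain_eval n m f) xs"
proof -
  interpret fs: vector_space "\<lambda>(c::'k) (f::('k,'a) tensor \<Rightarrow> 'k) w. c * f w" by (rule vector_space_pointwise)
  have "op_N n m f = (\<Sum>i = 0..n. (op_tau n m ^^ i) f)"
    unfolding op_N_def by (simp add: fun_eq_iff sum_fun_apply)
  then show "op_N n m f \<in> carrier (cochains n m)"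
    by (simp only:) (rule fs.subspace_sum[OF subspace_cochains op_tau_pow(1)[OF f]])
  show "op_N n m f (pure xs) = cnorm (cochain_eval n m f) xs" if "xs \<in> hlists (Suc n) m"
    using that by (simp add: op_N_def cnorm_def op_tau_pow(2)[OF f that] hlists_iff atLeast0AtMost lessThan_Suc_atMost)
qed

lemma op_s:
  assumes f: "f \<in> carrier (cochains (Suc n) m)"
  shows "op_s n m f \<in> carrier (cochains n m)"
    and "xs \<in> hlists (Suc n) m \<Longrightarrow> op_s n m f (pure xs) = unit_ins (cochain_eval (Suc n) m f) xs"
proof -
  have eq: "(- 1) ^ n * f (pure (xs @ [(0, 1)])) = unit_ins (cochain_eval (Suc n) m f) xs"
    if xs: "xs \<in> hlists (Suc n) m" for xs
    using xs one_A by (simp add: unit_ins_def cochain_eval_def hlists_iff)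
  show "op_s n m f \<in> carrier (cochains n m)"
    unfolding op_s_def by (rule cochain_of(1)[OF mlin_unit_ins[OF mlin_cochain_eval[OF f]] eq])
  show "op_s n m f (pure xs) = unit_ins (cochain_eval (Suc n) m f) xs" if "xs \<in> hlists (Suc n) m"
    unfolding op_s_def by (rule cochain_of(2)[OF mlin_unit_ins[OF mlin_cochain_eval[OF f]] eq that])
qed

lemma op_B:
  assumes f: "f \<in> carrier (cochains (Suc n) m)"
  shows "op_B n m f \<in> carrier (cochains n m)"
    and "xs \<in> hlists (Suc n) m \<Longrightarrow> op_B n m f (pure xs) = connes (cochain_eval (Suc n) m f) xs"
proof -
  interpret fs: vector_space "\<lambda>(c::'k) (f::('k,'a) tensor \<Rightarrow> 'k) w. c * f w" by (rule vector_space_pointwise)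
  let ?g = "\<lambda>w. f w - op_tau (Suc n) m f w"
  have "?g = f - op_tau (Suc n) m f" by (simp add: fun_eq_iff)
  then have g: "?g \<in> carrier (cochains (Suc n) m)"
    using fs.subspace_diff[OF subspace_cochains f op_tau(1)[OF f]] by simp
  show "op_B n m f \<in> carrier (cochains n m)"
    unfolding op_B_def by (rule op_N(1)[OF op_s(1)[OF g]])
  show "op_B n m f (pure xs) = connes (cochain_eval (Suc n) m f) xs" if xs: "xs \<in> hlists (Suc n) m"
    unfolding op_B_def op_N(2)[OF op_s(1)[OF g] xs] connes_def
  proof (rule cnorm_cong)
    fix ys assume "mset ys = mset xs"
    then have ys: "ys \<in> hlists (Suc n) m" by (rule hlists_mset) (rule xs)
    then have y1: "ys @ [(0, 1)] \<in> hlists (Suc (Suc n)) m" using one_A by (simp add: hlists_iff)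
    have "cochain_eval n m (op_s n m ?g) ys = unit_ins (cochain_eval (Suc n) m ?g) ys"
      using ys op_s(2)[OF g ys] by (simp add: cochain_eval_def)
    also have "\<dots> = unit_ins (\<lambda>xs. cochain_eval (Suc n) m f xs - cyc (cochain_eval (Suc n) m f) xs) ys"
      by (rule unit_ins_cong) (use op_tau(2)[OF f y1] y1 in \<open>simp add: cochain_eval_def\<close>)
    finally show "cochain_eval n m (op_s n m ?g) ys = unit_ins (\<lambda>xs. cochain_eval (Suc n) m f xs - cyc (cochain_eval (Suc n) m f) xs) ys" .
  qed
qed

lemma op_b:
  assumes f: "f \<in> carrier (cochains n m)"
  shows "op_b n m f \<in> carrier (cochains (Suc n) m)"
    and "xs \<in> hlists (Suc (Suc n)) m \<Longrightarrow> op_b n m f (pure xs) = hoch (cochain_eval n m f) xs"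
proof -
  have eq: "(\<Sum>i = 0..n. (- 1) ^ i * f (pure (take i xs @ [hmult (xs ! i) (xs ! Suc i)] @ drop (i + 2) xs)))
          + (- 1) ^ (Suc n + koszul xs) * f (pure (hmult (last xs) (hd xs) # butlast (tl xs))) = hoch (cochain_eval n m f) xs"
    if xs: "xs \<in> hlists (Suc (Suc n)) m" for xs
  proof -
    have len: "length xs = Suc (Suc n)" using xs by (simp add: hlists_iff)
    have mem: "merge i ys \<in> hlists (Suc n) m" if "i \<le> n" "mset ys = mset xs" for i ys
      using hlists_mset[OF that(2) xs] length_merge[of i ys] that by (auto simp: hlists_iff hom_list_merge)
    have int: "face i (cochain_eval n m f) xs = f (pure (take i xs @ [hmult (xs ! i) (xs ! Suc i)] @ drop (i + 2) xs))"
      if "i \<le> n" for i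
      using mem[OF that refl] that len by (simp add: face_def cochain_eval_def merge_eq)
    obtain a b zs where ab: "xs = b # zs @ [a]"
    proof -
      obtain b ys where "xs = b # ys" using len by (cases xs) auto
      moreover obtain zs a where "ys = zs @ [a]" using len calculation by (cases ys rule: rev_cases) auto
      ultimately show thesis using that by simp
    qed
    have "merge 0 (last xs # butlast xs) = hmult (last xs) (hd xs) # butlast (tl xs)"
      by (simp add: ab)
    moreover have "merge 0 (last xs # butlast xs) \<in> hlists (Suc n) m"
      by (rule mem) (simp_all add: ab)
    ultimately have last: "face (Suc n) (cochain_eval n m f) xs =
        (- 1) ^ koszul xs * f (pure (hmult (last xs) (hd xs) # butlast (tl xs)))"
      using len by (simp add: face_def rot_def cochain_eval_def)
    have "hoch (cochain_eval n m f) xs = (\<Sum>i<Suc n. (- 1) ^ i * face i (cochain_eval n m f) xs) + (- 1) ^ Suc n * face (Suc n) (cochain_eval n m f) xs"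
      by (simp only: hoch_def len sum.lessThan_Suc) simp
    moreover have "(\<Sum>i<Suc n. (- 1) ^ i * face i (cochain_eval n m f) xs) =
        (\<Sum>i = 0..n. (- 1) ^ i * f (pure (take i xs @ [hmult (xs ! i) (xs ! Suc i)] @ drop (i + 2) xs)))"
      by (rule sum.cong) (auto simp: int simp del: append.simps)
    ultimately show ?thesis by (simp only: last power_add mult.assoc)
  qed
  show "op_b n m f \<in> carrier (cochains (Suc n) m)"
    unfolding op_b_def by (rule cochain_of(1)[OF mlin_hoch[OF mlin_cochain_eval[OF f]] eq])
  show "op_b n m f (pure xs) = hoch (cochain_eval n m f) xs" if "xs \<in> hlists (Suc (Suc n)) m"
    unfolding op_b_def by (rule cochain_of(2)[OF mlin_hoch[OF mlin_cochain_eval[OF f]] eq that])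
qed

subsection \<open>The differential of a tensor power\<close>

abbreviation dec :: "nat \<times> 'a \<Rightarrow> nat \<times> 'a" where
  "dec w \<equiv> (fst w - 1, \<phi> (snd w))"

definition diff_term :: "nat \<Rightarrow> (nat \<times> 'a) list \<Rightarrow> (nat \<times> 'a) list \<Rightarrow>\<^sub>0 'k" where
  "diff_term i xs = (if 0 < fst (xs ! i) then Poly_Mapping.single (xs[i := dec (xs ! i)]) ((- 1) ^ deg (take i xs)) else 0)"

definition list_diff :: "nat \<Rightarrow> (nat \<times> 'a) list \<Rightarrow> (nat \<times> 'a) list \<Rightarrow>\<^sub>0 'k" where
  "list_diff n xs = (\<Sum>i<n. diff_term i xs)"

lemma diff_term_append:
  "diff_term (length us) (us @ w # vs) =
     (if 0 < fst w then Poly_Mapping.single (us @ dec w # vs) ((- 1) ^ deg us) else 0)"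
  by (simp add: diff_term_def)

lemma dec_hlists: "us @ w # vs \<in> hlists n (Suc m) \<Longrightarrow> 0 < fst w \<Longrightarrow> us @ dec w # vs \<in> hlists n m"
  by (cases w; cases "fst w") (auto simp: hlists_iff \<phi>_A)

lemma list_splitE:
  assumes "i < length xs"
  obtains us w vs where "xs = us @ w # vs" "i = length us"
  using id_take_nth_drop[OF assms] assms by (metis length_take min.absorb4)

lemma diff_term_Free:
  assumes "xs \<in> hlists n (Suc m)" "i < n"
  shows "diff_term i xs \<in> Free n m"
proof -
  have "i < length xs" using assms by (simp add: hlists_iff)
  then obtain us w vs where "xs = us @ w # vs" "i = length us" by (rule list_splitE)
  then show ?thesis
    using dec_hlists[of us w vs n m] assms free.subspace_0[OF subspace_Free]
    by (simp add: diff_term_append single_Free)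
qed

lemma list_diff_Free: "xs \<in> hlists n (Suc m) \<Longrightarrow> list_diff n xs \<in> Free n m"
  unfolding list_diff_def by (intro free.subspace_sum[OF subspace_Free] diff_term_Free) auto

lemma add_rel_scaled:
  assumes "us @ (e, x) # vs \<in> hlists n m" "x \<in> A e" "y \<in> A e"
  shows "Poly_Mapping.single (us @ (e, x + y) # vs) k - Poly_Mapping.single (us @ (e, x) # vs) k
      - Poly_Mapping.single (us @ (e, y) # vs) k \<in> tensor_rels n m"
proof -
  have "Poly_Mapping.single (us @ (e, x + y) # vs) k - Poly_Mapping.single (us @ (e, x) # vs) k
      - Poly_Mapping.single (us @ (e, y) # vs) k =
    pscale k (sgl (us @ (e, x + y) # vs) - sgl (us @ (e, x) # vs) - sgl (us @ (e, y) # vs))"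
    by (rule poly_mapping_eqI) (simp add: lookup_minus lookup_single when_def)
  then show ?thesis
    using free.subspace_scale[OF tensor_rels_subspace add_rel[OF assms]] by simp
qed

lemma scale_rel_scaled:
  assumes "us @ (e, x) # vs \<in> hlists n m" "x \<in> A e"
  shows "Poly_Mapping.single (us @ (e, c *s x) # vs) k - pscale c (Poly_Mapping.single (us @ (e, x) # vs) k)
      \<in> tensor_rels n m"
proof -
  have "Poly_Mapping.single (us @ (e, c *s x) # vs) k - pscale c (Poly_Mapping.single (us @ (e, x) # vs) k) =
    pscale k (sgl (us @ (e, c *s x) # vs) - Poly_Mapping.single (us @ (e, x) # vs) c)"
    by (rule poly_mapping_eqI) (auto simp: lookup_minus lookup_single when_def algebra_simps)
  then show ?thesis
    using free.subspace_scale[OF tensor_rels_subspace scale_rel[OF assms]] by simp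
qed

text \<open>
  Each summand of the tensor differential maps a multilinearity relation in one entry to a multiple
  of such a relation, be the entry left of, at, or right of the position of \<open>\<phi>\<close>.
\<close>

lemma diff_term_rel:
  assumes h: "us @ (e, x) # vs \<in> hlists n (Suc m)" "x \<in> A e" "y \<in> A e" and i: "i < n"
  shows "diff_term i (us @ (e, x + y) # vs) - diff_term i (us @ (e, x) # vs) - diff_term i (us @ (e, y) # vs)
      \<in> tensor_rels n m" (is ?add)
    and "diff_term i (us @ (e, c *s x) # vs) - pscale c (diff_term i (us @ (e, x) # vs)) \<in> tensor_rels n m" (is ?sc)
proof -
  have len: "length (us @ (e, x) # vs) = n" using h by (simp add: hlists_iff)
  note zero = free.subspace_0[OF tensor_rels_subspace[of n m]]
  have ps0: "pscale c 0 = (0 :: (nat \<times> 'a) list \<Rightarrow>\<^sub>0 'k)" for c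
    by (rule poly_mapping_eqI) simp
  consider "i < length us" | "i = length us" | j where "i = Suc (length us + j)" "j < length vs"
    using i len less_imp_Suc_add[of "length us" i] by (auto simp: not_less_iff_gr_or_eq) (metis add_less_cancel_left linorder_neqE_nat)
  then have "?add \<and> ?sc"
  proof cases
    case 1
    then obtain a w b where us: "us = a @ w # b" "i = length a" by (rule list_splitE)
    have t: "diff_term i (us @ (e, z) # vs) =
       (if 0 < fst w then Poly_Mapping.single ((a @ dec w # b) @ (e, z) # vs) ((- 1) ^ deg a) else 0)" for z
      using diff_term_append[of a w "b @ (e, z) # vs"] by (simp add: us)
    have mem: "(a @ dec w # b) @ (e, x) # vs \<in> hlists n m" if "0 < fst w"
      using dec_hlists[of a w "b @ (e, x) # vs" n m] h(1) that by (simp add: us)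
    show ?thesis
    proof (cases "0 < fst w")
      case True
      show ?thesis unfolding t
        using add_rel_scaled[OF mem[OF True] h(2,3)] scale_rel_scaled[OF mem[OF True] h(2)]
        by (simp only: True if_True simp_thms)
    qed (simp add: t zero ps0)
  next
    case 2
    have t: "diff_term i (us @ (e, z) # vs) =
       (if 0 < e then Poly_Mapping.single (us @ (e - 1, \<phi> z) # vs) ((- 1) ^ deg us) else 0)" for z
      using diff_term_append[of us "(e, z)" vs] by (simp add: 2)
    have mem: "us @ (e - 1, \<phi> x) # vs \<in> hlists n m" if "0 < e"
      using dec_hlists[OF h(1)] that by simp
    show ?thesis
    proof (cases "0 < e")
      case True
      show ?thesis unfolding t \<phi>_add \<phi>_scale
        using add_rel_scaled[OF mem[OF True] \<phi>_pred[OF h(2) True] \<phi>_pred[OF h(3) True]]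
          scale_rel_scaled[OF mem[OF True] \<phi>_pred[OF h(2) True]]
        by (simp only: True if_True simp_thms)
    next
      case False
      show ?thesis unfolding t by (simp add: False zero ps0)
    qed
  next
    case 3
    then obtain a w b where vs: "vs = a @ w # b" "j = length a" using list_splitE by metis
    have t: "diff_term i (us @ (e, z) # vs) =
       (if 0 < fst w then Poly_Mapping.single (us @ (e, z) # a @ dec w # b) ((- 1) ^ (deg us + (e + deg a))) else 0)" for z
      using diff_term_append[of "us @ (e, z) # a" w b] 3 by (simp add: vs)
    have mem: "us @ (e, x) # a @ dec w # b \<in> hlists n m" if "0 < fst w"
      using dec_hlists[of "us @ (e, x) # a" w b n m] h(1) that by (simp add: vs)
    show ?thesis
    proof (cases "0 < fst w")
      case True
      show ?thesis unfolding t
        using add_rel_scaled[OF mem[OF True] h(2,3)] scale_rel_scaled[OF mem[OF True] h(2)]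
        by (simp only: True if_True simp_thms)
    qed (simp add: t zero ps0)
  qed
  then show ?add ?sc by blast+
qed

abbreviation free_diff :: "nat \<Rightarrow> ((nat \<times> 'a) list \<Rightarrow>\<^sub>0 'k) \<Rightarrow> ((nat \<times> 'a) list \<Rightarrow>\<^sub>0 'k)" where
  "free_diff n \<equiv> lin_comb pscale (list_diff n)"

lemma free_diff_Free: "u \<in> Free n (Suc m) \<Longrightarrow> free_diff n u \<in> Free n m"
  unfolding lin_comb_def
  by (rule free.subspace_sum[OF subspace_Free], rule free.subspace_scale[OF subspace_Free], rule list_diff_Free)
     (auto simp: Free_def)

lemma free_diff_rels: "u \<in> tensor_rels n (Suc m) \<Longrightarrow> free_diff n u \<in> tensor_rels n m"
proof -
  let ?U = "{u \<in> Free n (Suc m). free_diff n u \<in> tensor_rels n m}"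
  have "tensor_rels n (Suc m) \<subseteq> ?U"
  proof (rule tensor_rels_minimal)
    show "free.subspace ?U"
      by (rule free_pair.subspace_preimage_on[OF subspace_Free tensor_rels_subspace])
         (rule free.lin_comb_add free.lin_comb_pscale)+
    show "multilinearity n (Suc m) \<subseteq> ?U"
    proof
      fix u assume u: "u \<in> multilinearity n (Suc m)"
      then have "free_diff n u \<in> tensor_rels n m"
      proof (cases rule: multilinearityE)
        case (1 us e x y vs)
        have "free_diff n u = (\<Sum>i<n. diff_term i (us @ (e, x + y) # vs) - diff_term i (us @ (e, x) # vs) - diff_term i (us @ (e, y) # vs))"
          unfolding 1(4) free.lin_comb_diff free.lin_comb_single free.scale_one list_diff_def
          by (simp add: sum_subtractf)
        then show ?thesis
          by (simp only:) (rule free.subspace_sum[OF tensor_rels_subspace], rule diff_term_rel(1)[OF 1(1,2,3)], simp)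
      next
        case (2 us e c x vs)
        have "free_diff n u = (\<Sum>i<n. diff_term i (us @ (e, c *s x) # vs) - pscale c (diff_term i (us @ (e, x) # vs)))"
          unfolding 2(3) free.lin_comb_diff free.lin_comb_single free.scale_one list_diff_def
          by (simp add: sum_subtractf free.scale_sum_right)
        then show ?thesis
          by (simp only:) (rule free.subspace_sum[OF tensor_rels_subspace], rule diff_term_rel(2)[OF 2(1,2,2)], simp)
      qed
      then show "u \<in> ?U" using u multilinearity_Free by blast
    qed
  qed blast
  then show "u \<in> tensor_rels n (Suc m) \<Longrightarrow> free_diff n u \<in> tensor_rels n m" by blast
qed

lemma zero_tensor_power: "\<zero>\<^bsub>tensor_power n m\<^esub> = tensor_rels n m"
  by (simp add: tensor_power_eq)

text \<open>
  The differential of the tensor power is induced by a map of free spaces that preserves the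
  relations.
\<close>

lemma tensor_diff:
  "tensor_diff n m \<in> Hom_set (tensor_power n (Suc m)) (tensor_power n m)"
  "u \<in> Free n (Suc m) \<Longrightarrow>
     tensor_diff n m (coset (tensor_rels n (Suc m)) u) = coset (tensor_rels n m) (free_diff n u)"
proof -
  define h where "h w = (if w \<in> carrier (tensor_power n (Suc m)) then \<Union>u\<in>w. coset (tensor_rels n m) (free_diff n u)
      else \<zero>\<^bsub>tensor_power n m\<^esub>)" for w
  have hc: "h (coset (tensor_rels n (Suc m)) u) = coset (tensor_rels n m) (free_diff n u)"
    if u: "u \<in> Free n (Suc m)" for u
  proof -
    have "(\<Union>v\<in>coset (tensor_rels n (Suc m)) u. coset (tensor_rels n m) (free_diff n v)) = coset (tensor_rels n m) (free_diff n u)"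
      by (rule free_pair.coset_image[OF subspace_Free tensor_rels_subspace tensor_rels_subspace tensor_rels_Free _ free_diff_rels u])
         (rule free.lin_comb_add)
    then show ?thesis using u by (simp add: h_def carrier_tensor_power del: UN_simps)
  qed
  have "lin (tensor_power n (Suc m)) (tensor_power n m) h"
    unfolding lin_def
    using free.subspace_add[OF subspace_Free, of _ n "Suc m"] free.subspace_scale[OF subspace_Free, of _ n "Suc m"]
    by (auto simp: carrier_tensor_power add_tensor smult_tensor hc free.lin_comb_add free.lin_comb_pscale
       intro!: imageI free_diff_Free)
  then have h: "h \<in> Hom_set (tensor_power n (Suc m)) (tensor_power n m)"
    by (auto simp: Hom_set_def h_def)
  have "tensor_diff n m = h"
    unfolding tensor_diff_def
  proof (rule lin_ext_eq[OF _ h])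
    fix w w' assume "w \<in> carrier (tensor_power n m)" "w' \<in> carrier (tensor_power n m)"
    moreover have "pscale 0 u = 0" for u :: "(nat \<times> 'a) list \<Rightarrow>\<^sub>0 'k" by (rule poly_mapping_eqI) simp
    ultimately show "(0::'k) \<odot>\<^bsub>tensor_power n m\<^esub> w = 0 \<odot>\<^bsub>tensor_power n m\<^esub> w'"
      by (auto simp: carrier_tensor_power smult_tensor)
  next
    fix xs assume xs: "xs \<in> hlists n (Suc m)"
    have "(\<Sum>i | i < n \<and> 0 < fst (xs ! i).
           Poly_Mapping.single (xs[i := (fst (xs ! i) - 1, \<phi> (snd (xs ! i)))]) ((- 1) ^ deg (take i xs)))
        = (\<Sum>i\<in>{i \<in> {..<n}. 0 < fst (xs ! i)}. Poly_Mapping.single (xs[i := dec (xs ! i)]) ((- 1) ^ deg (take i xs)))"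
      by (rule sum.cong) auto
    also have "\<dots> = list_diff n xs"
      unfolding list_diff_def diff_term_def by (rule sum.inter_filter) simp
    finally have eq: "(\<Sum>i | i < n \<and> 0 < fst (xs ! i).
           Poly_Mapping.single (xs[i := (fst (xs ! i) - 1, \<phi> (snd (xs ! i)))]) ((- 1) ^ deg (take i xs))) = list_diff n xs" .
    show "h (pure xs) = tensor_class n m (\<Sum>i | i < n \<and> 0 < fst (xs ! i).
           Poly_Mapping.single (xs[i := (fst (xs ! i) - 1, \<phi> (snd (xs ! i)))]) ((- 1) ^ deg (take i xs)))"
      unfolding eq tensor_class_eq pure_eq[OF xs] hc[OF single_Free[OF xs]] free.lin_comb_single free.scale_one ..
  qed
  then show "tensor_diff n m \<in> Hom_set (tensor_power n (Suc m)) (tensor_power n m)"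
    and "u \<in> Free n (Suc m) \<Longrightarrow>
     tensor_diff n m (coset (tensor_rels n (Suc m)) u) = coset (tensor_rels n m) (free_diff n u)"
    using h hc by simp_all
qed

lemma ext_sum: "ext g (\<Sum>i\<in>I. u i) = (\<Sum>i\<in>I. ext g (u i))"
  by (induction I rule: infinite_finite_induct) (simp_all add: self.lin_comb_add lin_comb_def[of _ _ 0])

lemma ext_list_diff:
  assumes "length xs = n"
  shows "ext g (list_diff n xs) = Phi xs g"
proof -
  have "ext g (list_diff n xs) = (\<Sum>i<n. if 0 < fst (xs ! i) then (- 1) ^ deg (take i xs) * g (xs[i := dec (xs ! i)]) else 0)"
    unfolding list_diff_def ext_sum diff_term_def
    by (rule sum.cong) (auto simp: self.lin_comb_single lin_comb_def[of _ _ 0])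
  also have "\<dots> = (\<Sum>i\<in>{i \<in> {..<n}. 0 < fst (xs ! i)}. (- 1) ^ deg (take i xs) * g (xs[i := dec (xs ! i)]))"
    by (rule sum.inter_filter[symmetric]) simp
  also have "\<dots> = Phi xs g"
    unfolding Phi_eq_sum by (rule sum.cong) (auto simp: assms)
  finally show ?thesis .
qed

lemma op_delta:
  assumes f: "f \<in> carrier (cochains n m)"
  shows "op_delta n m f \<in> carrier (cochains n (Suc m))"
    and "xs \<in> hlists (Suc n) (Suc m) \<Longrightarrow> op_delta n m f (pure xs) = (- 1) ^ m * Phi xs (cochain_eval n m f)"
proof -
  let ?N = "Suc n"
  have D: "lin (tensor_power ?N (Suc m)) (tensor_power ?N m) (tensor_diff ?N m)"
    and D0: "\<And>w. w \<notin> carrier (tensor_power ?N (Suc m)) \<Longrightarrow> tensor_diff ?N m w = tensor_rels ?N m"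
    using tensor_diff(1)[of ?N m] by (auto simp: Hom_set_def zero_tensor_power)
  have l: "lin (tensor_power ?N m) scalars f" using f by (simp add: carrier_cochains Hom_set_def)
  have f0: "f (tensor_rels ?N m) = 0"
    using cochain_eq_ext[OF f free.subspace_0[OF subspace_Free]] by (simp add: lin_comb_def)
  have "lin (tensor_power ?N (Suc m)) scalars (op_delta n m f)"
    using D l unfolding lin_def op_delta_def by (simp add: Pi_iff distrib_left mult.left_commute)
  then show "op_delta n m f \<in> carrier (cochains n (Suc m))"
    by (simp add: carrier_cochains Hom_set_def op_delta_def D0 f0)
  show "op_delta n m f (pure xs) = (- 1) ^ m * Phi xs (cochain_eval n m f)" if xs: "xs \<in> hlists (Suc n) (Suc m)"
  proof -
    have "tensor_diff ?N m (pure xs) = coset (tensor_rels ?N m) (list_diff ?N xs)"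
      unfolding pure_eq[OF xs] tensor_diff(2)[OF single_Free[OF xs]] free.lin_comb_single free.scale_one ..
    then show ?thesis
      using xs by (simp add: op_delta_def cochain_eq_ext[OF f list_diff_Free[OF xs]] ext_list_diff hlists_iff)
  qed
qed

end

section \<open>Hochschild and cyclic cochains\<close>

abbreviation fscale :: "'k::field \<Rightarrow> ('i \<Rightarrow> 'w \<Rightarrow> 'k) \<Rightarrow> 'i \<Rightarrow> 'w \<Rightarrow> 'k" where
  "fscale c \<equiv> \<lambda>x i w. c * x i w"

lemma vector_space_fscale: "vector_space fscale"
  by unfold_locales (auto simp: fun_eq_iff algebra_simps)

context dga
begin

subsection \<open>The Hochschild complex\<close>

definition cochain_family :: "(nat \<times> nat \<Rightarrow> ('k, 'a) cochain) \<Rightarrow> bool" where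
  "cochain_family y \<longleftrightarrow> (\<forall>p q. y (p, q) \<in> carrier (cochains p q))"

lemma familyD: "cochain_family y \<Longrightarrow> y (p, q) \<in> carrier (cochains p q)"
  by (simp add: cochain_family_def)

text \<open>
  The bidegree \<open>(p, q)\<close> of the component that applies to a list can be read off its length and
  degree; so a Hochschild cochain is a single function of lists.
\<close>

definition family_eval :: "(nat \<times> nat \<Rightarrow> ('k, 'a) cochain) \<Rightarrow> (nat \<times> 'a) list \<Rightarrow> 'k" where
  "family_eval y xs = (if xs \<noteq> [] \<and> hom_list xs then y (length xs - 1, deg xs) (pure xs) else 0)"

lemma family_eval_eq_cochain_eval: "hom_list xs \<Longrightarrow> length xs = Suc p \<Longrightarrow> deg xs = q \<Longrightarrow> family_eval y xs = cochain_eval p q (y (p, q)) xs"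
  by (auto simp: family_eval_def cochain_eval_def hlists_iff)

lemma family_eval_add: "family_eval (y + y') = (\<lambda>xs. family_eval y xs + family_eval y' xs)"
  by (rule ext) (simp add: family_eval_def)

lemma family_eval_scale: "family_eval (fscale c y) = (\<lambda>xs. c * family_eval y xs)"
  by (rule ext) (simp add: family_eval_def)

lemma family_eval_0: "family_eval 0 = (\<lambda>xs. 0)"
  by (rule ext) (simp add: family_eval_def)

lemma cochains_0: "0 \<in> carrier (cochains p q)"
  and cochains_add: "f \<in> carrier (cochains p q) \<Longrightarrow> g \<in> carrier (cochains p q) \<Longrightarrow> f + g \<in> carrier (cochains p q)"
  and cochains_scale: "f \<in> carrier (cochains p q) \<Longrightarrow> (\<lambda>w. c * f w) \<in> carrier (cochains p q)"
proof -
  interpret fs: vector_space "\<lambda>(c::'k) (f::('k,'a) tensor \<Rightarrow> 'k) w. c * f w" by (rule vector_space_pointwise)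
  show "0 \<in> carrier (cochains p q)" by (rule fs.subspace_0[OF subspace_cochains])
  show "f \<in> carrier (cochains p q) \<Longrightarrow> g \<in> carrier (cochains p q) \<Longrightarrow> f + g \<in> carrier (cochains p q)"
    by (rule fs.subspace_add[OF subspace_cochains])
  show "f \<in> carrier (cochains p q) \<Longrightarrow> (\<lambda>w. c * f w) \<in> carrier (cochains p q)"
    by (rule fs.subspace_scale[OF subspace_cochains])
qed

lemma family_add: "cochain_family y \<Longrightarrow> cochain_family y' \<Longrightarrow> cochain_family (y + y')"
  by (simp add: cochain_family_def cochains_add)

lemma family_scale: "cochain_family y \<Longrightarrow> cochain_family (fscale c y)"
  by (simp add: cochain_family_def cochains_scale)

lemma family_0: "cochain_family 0"
  by (simp add: cochain_family_def cochains_0)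

lemma family_eqI:
  assumes y: "cochain_family y" and y': "cochain_family y'"
    and eq: "\<And>xs. xs \<noteq> [] \<Longrightarrow> hom_list xs \<Longrightarrow> family_eval y xs = family_eval y' xs"
  shows "y = y'"
proof
  fix i :: "nat \<times> nat"
  obtain p q where i: "i = (p, q)" by (cases i)
  have "y (p, q) = y' (p, q)"
  proof (rule cochain_ext[of _ p q])
    fix xs assume xs: "xs \<in> hlists (Suc p) q"
    then have "xs \<noteq> []" by (auto simp: hlists_iff)
    then show "y (p, q) (pure xs) = y' (p, q) (pure xs)"
      using eq[of xs] xs by (simp add: hlists_iff family_eval_def)
  qed (rule familyD[OF y], rule familyD[OF y'])
  then show "y i = y' i" by (simp add: i)
qed

lemma mlin_family_eval:
  assumes y: "cochain_family y"
  shows "mlin (family_eval y)"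
proof (rule mlinI)
  fix us vs :: "(nat \<times> 'a) list" and e x z c
  assume h: "hom_list us" "hom_list vs" "x \<in> A e"
  let ?p = "length us + length vs" and ?q = "deg us + (e + deg vs)"
  have G: "family_eval y (us @ (e, t) # vs) = cochain_eval ?p ?q (y (?p, ?q)) (us @ (e, t) # vs)" if "t \<in> A e" for t
    using h that by (intro family_eval_eq_cochain_eval) auto
  have m: "mlin (cochain_eval ?p ?q (y (?p, ?q)))" by (rule mlin_cochain_eval[OF familyD[OF y]])
  show "family_eval y (us @ (e, c *s x) # vs) = c * family_eval y (us @ (e, x) # vs)"
    unfolding G[OF h(3)] G[OF A_scale[OF h(3)]] by (rule mlin_scale_arg[OF m h])
  show "family_eval y (us @ (e, x + z) # vs) = family_eval y (us @ (e, x) # vs) + family_eval y (us @ (e, z) # vs)" if z: "z \<in> A e"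
    unfolding G[OF h(3)] G[OF z] G[OF A_add[OF h(3) z]] by (rule mlin_add_arg[OF m h z])
qed

lemma hoch_0: "hoch (\<lambda>_. 0) xs = 0" and connes_0: "connes (\<lambda>_. 0) xs = 0" and Psi_0: "Psi (\<lambda>_. 0) xs = 0"
  using hoch_scale[of 0 "\<lambda>_. 0"] connes_scale[of 0 "\<lambda>_. 0"] Psi_scale[of 0 "\<lambda>_. 0"] by simp_all

lemma family_diff:
  assumes y: "cochain_family y"
  shows "cochain_family (EH_diff y)"
  unfolding cochain_family_def
proof (intro allI)
  fix p q
  have "EH_diff y (p, q) = (if 0 < p then op_b (p - 1) q (y (p - 1, q)) else 0) +
      (if 0 < q then (\<lambda>w. (- 1) ^ p * op_delta p (q - 1) (y (p, q - 1)) w) else 0)"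
    by (auto simp: EH_diff_def fun_eq_iff)
  moreover have "op_b (p - 1) q (y (p - 1, q)) \<in> carrier (cochains p q)" if "0 < p"
    using op_b(1)[of "y (p - 1, q)" "p - 1" q] familyD[OF y] that by simp
  moreover have "op_delta p (q - 1) (y (p, q - 1)) \<in> carrier (cochains p q)" if "0 < q"
    using op_delta(1)[of "y (p, q - 1)" p "q - 1"] familyD[OF y] that by simp
  ultimately show "EH_diff y (p, q) \<in> carrier (cochains p q)"
    by (simp add: cochains_add cochains_0 cochains_scale del: plus_fun_apply)
qed

lemma family_eval_diff:
  assumes y: "cochain_family y" and ne: "xs \<noteq> []" and h: "hom_list xs"
  shows "family_eval (EH_diff y) xs = hoch (family_eval y) xs + Psi (family_eval y) xs"
proof -
  obtain p where p: "length xs = Suc p" using ne by (cases xs) auto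
  define q where "q = deg xs"
  have xs: "xs \<in> hlists (Suc p) q" using h p by (simp add: hlists_iff q_def)
  have "(if 0 < p then op_b (p - 1) q (y (p - 1, q)) (pure xs) else 0) = hoch (family_eval y) xs"
  proof (cases p)
    case 0 then show ?thesis using p by (simp add: hoch_def)
  next
    case (Suc p')
    have "op_b p' q (y (p', q)) (pure xs) = hoch (cochain_eval p' q (y (p', q))) xs"
      by (rule op_b(2)[OF familyD[OF y]]) (use xs Suc in simp)
    also have "\<dots> = hoch (family_eval y) xs"
      by (rule hoch_cong_hom[OF h], rule family_eval_eq_cochain_eval[symmetric]) (use p Suc in \<open>auto simp: q_def\<close>)
    finally show ?thesis using Suc by simp
  qed
  moreover have "(if 0 < q then (- 1) ^ p * op_delta p (q - 1) (y (p, q - 1)) (pure xs) else 0) = Psi (family_eval y) xs"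
  proof (cases q)
    case 0
    have "Psi (family_eval y) xs = Psi (\<lambda>_. 0) xs" by (rule Psi_cong_hom[OF h]) (use 0 q_def in simp)
    then show ?thesis using 0 by (simp add: Psi_0)
  next
    case (Suc q')
    have "op_delta p q' (y (p, q')) (pure xs) = (- 1) ^ q' * Phi xs (cochain_eval p q' (y (p, q')))"
      by (rule op_delta(2)[OF familyD[OF y]]) (use xs Suc in simp)
    also have "Phi xs (cochain_eval p q' (y (p, q'))) = Phi xs (family_eval y)"
      by (rule Phi_cong[OF h], rule family_eval_eq_cochain_eval[symmetric]) (use p Suc in \<open>auto simp: q_def\<close>)
    finally show ?thesis using Suc p by (simp add: Psi_def power_add flip: q_def)
  qed
  ultimately have "EH_diff y (p, q) (pure xs) = hoch (family_eval y) xs + Psi (family_eval y) xs" by (simp add: EH_diff_def)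
  moreover have "family_eval (EH_diff y) xs = EH_diff y (p, q) (pure xs)" using ne h p by (simp add: family_eval_def q_def)
  ultimately show ?thesis by simp
qed

lemma family_B: "cochain_family y \<Longrightarrow> cochain_family (EH_B y)"
  by (simp add: cochain_family_def EH_B_def op_B(1))

lemma family_eval_B:
  assumes y: "cochain_family y" and ne: "xs \<noteq> []" and h: "hom_list xs"
  shows "family_eval (EH_B y) xs = connes (family_eval y) xs"
proof -
  obtain p where p: "length xs = Suc p" using ne by (cases xs) auto
  define q where "q = deg xs"
  have xs: "xs \<in> hlists (Suc p) q" using h p by (simp add: hlists_iff q_def)
  have "op_B p q (y (Suc p, q)) (pure xs) = connes (cochain_eval (Suc p) q (y (Suc p, q))) xs"
    by (rule op_B(2)[OF familyD[OF y] xs])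
  also have "\<dots> = connes (family_eval y) xs"
    by (rule connes_cong_hom[OF h], rule family_eval_eq_cochain_eval[symmetric]) (use p in \<open>auto simp: q_def\<close>)
  finally have "EH_B y (p, q) (pure xs) = connes (family_eval y) xs" by (simp add: EH_B_def)
  moreover have "family_eval (EH_B y) xs = EH_B y (p, q) (pure xs)" using ne h p by (simp add: family_eval_def q_def)
  ultimately show ?thesis by simp
qed

lemma EH_diff_add: "cochain_family y \<Longrightarrow> cochain_family y' \<Longrightarrow> EH_diff (y + y') = EH_diff y + EH_diff y'"
  by (rule family_eqI[OF family_diff[OF family_add] family_add[OF family_diff family_diff]])
     (simp_all add: family_eval_diff family_add family_eval_add hoch_add Psi_add)

lemma EH_diff_scale: "cochain_family y \<Longrightarrow> EH_diff (fscale c y) = fscale c (EH_diff y)"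
  by (rule family_eqI[OF family_diff[OF family_scale] family_scale[OF family_diff]])
     (simp_all add: family_eval_diff family_scale family_eval_scale hoch_scale Psi_scale distrib_left)

lemma EH_B_add: "cochain_family y \<Longrightarrow> cochain_family y' \<Longrightarrow> EH_B (y + y') = EH_B y + EH_B y'"
  by (rule family_eqI[OF family_B[OF family_add] family_add[OF family_B family_B]])
     (simp_all add: family_eval_B family_add family_eval_add connes_add)

lemma EH_B_scale: "cochain_family y \<Longrightarrow> EH_B (fscale c y) = fscale c (EH_B y)"
  by (rule family_eqI[OF family_B[OF family_scale] family_scale[OF family_B]])
     (simp_all add: family_eval_B family_scale family_eval_scale connes_scale)

lemma EH_diff_diff:
  assumes y: "cochain_family y"
  shows "EH_diff (EH_diff y) = 0"
proof (rule family_eqI[OF family_diff[OF family_diff[OF y]] family_0])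
  fix xs :: "(nat \<times> 'a) list" assume xs: "xs \<noteq> []" "hom_list xs"
  let ?D = "\<lambda>ys. hoch (family_eval y) ys + Psi (family_eval y) ys"
  have "hoch (family_eval (EH_diff y)) xs = hoch ?D xs"
    by (rule hoch_cong_hom[OF xs(2)]) (rule family_eval_diff[OF y])
  moreover have "Psi (family_eval (EH_diff y)) xs = Psi ?D xs"
    by (rule Psi_cong_hom[OF xs(2)]) (rule family_eval_diff[OF y], use xs(1) in auto)
  ultimately show "family_eval (EH_diff (EH_diff y)) xs = family_eval 0 xs"
    using hoch_Psi[OF mlin_family_eval[OF y] xs(2)] Psi_Psi[OF mlin_family_eval[OF y] xs(2)]
    by (simp add: family_eval_diff[OF family_diff[OF y] xs] hoch_add Psi_add hoch_hoch family_eval_0)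
qed

lemma EH_B_B:
  assumes y: "cochain_family y"
  shows "EH_B (EH_B y) = 0"
proof (rule family_eqI[OF family_B[OF family_B[OF y]] family_0])
  fix xs :: "(nat \<times> 'a) list" assume xs: "xs \<noteq> []" "hom_list xs"
  have "connes (family_eval (EH_B y)) xs = connes (connes (family_eval y)) xs"
    by (rule connes_cong_hom[OF xs(2)]) (rule family_eval_B[OF y], auto)
  then show "family_eval (EH_B (EH_B y)) xs = family_eval 0 xs"
    by (simp add: family_eval_B[OF family_B[OF y] xs] connes_connes family_eval_0)
qed

lemma EH_diff_B:
  assumes y: "cochain_family y"
  shows "EH_diff (EH_B y) + EH_B (EH_diff y) = 0"
proof (rule family_eqI[OF family_add[OF family_diff[OF family_B[OF y]] family_B[OF family_diff[OF y]]] family_0])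
  fix xs :: "(nat \<times> 'a) list" assume xs: "xs \<noteq> []" "hom_list xs"
  have "hoch (family_eval (EH_B y)) xs = hoch (connes (family_eval y)) xs"
    by (rule hoch_cong_hom[OF xs(2)]) (rule family_eval_B[OF y])
  moreover have "Psi (family_eval (EH_B y)) xs = Psi (connes (family_eval y)) xs"
    by (rule Psi_cong_hom[OF xs(2)]) (rule family_eval_B[OF y], use xs(1) in auto)
  moreover have "connes (family_eval (EH_diff y)) xs = connes (\<lambda>ys. hoch (family_eval y) ys + Psi (family_eval y) ys) xs"
    by (rule connes_cong_hom[OF xs(2)]) (rule family_eval_diff[OF y], auto)
  ultimately have "family_eval (EH_diff (EH_B y) + EH_B (EH_diff y)) xs =
      (hoch (connes (family_eval y)) xs + connes (hoch (family_eval y)) xs) + (connes (Psi (family_eval y)) xs + Psi (connes (family_eval y)) xs)"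
    by (simp add: family_eval_add family_eval_diff[OF family_B[OF y] xs] family_eval_B[OF family_diff[OF y] xs] connes_add)
  then show "family_eval (EH_diff (EH_B y) + EH_B (EH_diff y)) xs = family_eval 0 xs"
    by (simp only: hoch_connes[OF xs(1)] connes_Psi[OF xs] family_eval_0 add_0)
qed

definition EH_set :: "int \<Rightarrow> (nat \<times> nat \<Rightarrow> ('k, 'a) cochain) set" where
  "EH_set n = {y. cochain_family y \<and> (\<forall>p q. int p + int q \<noteq> n \<longrightarrow> y (p, q) = 0)}"

lemma EH_set_family: "y \<in> EH_set n \<Longrightarrow> cochain_family y"
  by (simp add: EH_set_def)

lemma cochains_sel [simp]:
  "zero (cochains p q) = 0" "add (cochains p q) = (+)" "module.smult (cochains p q) = (\<lambda>c f w. c * f w)"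
  by (auto simp: cochains_def dual_def fun_eq_iff)

lemma EH_eq: "EH n = vspace (EH_set n) 0 (+) fscale"
proof -
  let ?I = "{(p, q). int p + int q = n}" and ?M = "\<lambda>(p, q). cochains p q"
  have fin: "finite ?I"
    by (rule finite_subset[of _ "{..nat n} \<times> {..nat n}"]) auto
  have sel: "\<zero>\<^bsub>?M i\<^esub> = 0" "add (?M i) = (+)" "module.smult (?M i) = (\<lambda>c f w. c * f w)" for i
    by (cases i; simp)+
  have "{x. (\<forall>i\<in>?I. x i \<in> carrier (?M i)) \<and> (\<forall>i. i \<notin> ?I \<longrightarrow> x i = \<zero>\<^bsub>?M i\<^esub>) \<and> finite {i. x i \<noteq> \<zero>\<^bsub>?M i\<^esub>}} = EH_set n" (is "?S = _")
  proof (intro equalityI subsetI)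
    fix x assume x: "x \<in> ?S"
    have "x (p, q) \<in> carrier (cochains p q)" for p q
      using x cochains_0 by (cases "(p, q) \<in> ?I") (auto simp: sel)
    then show "x \<in> EH_set n" using x by (auto simp: EH_set_def cochain_family_def sel)
  next
    fix x assume x: "x \<in> EH_set n"
    have "{i. x i \<noteq> 0} \<subseteq> ?I" using x by (auto simp: EH_set_def)
    then have "finite {i. x i \<noteq> 0}" using fin by (rule finite_subset)
    then show "x \<in> ?S"
      using x by (auto simp: EH_set_def cochain_family_def sel)
  qed
  then show ?thesis
    unfolding EH_def dsum_def by (simp add: sel vspace_def fun_eq_iff zero_fun_def)
qed

text \<open>
  The degree of a Hochschild cochain in terms of its values: a list of length \<open>p + 1\<close> and degree \<open>q\<close>
  has total degree \<open>p + q\<close>.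
\<close>

lemma EH_set_iff:
  "y \<in> EH_set n \<longleftrightarrow> cochain_family y \<and>
     (\<forall>xs. xs \<noteq> [] \<longrightarrow> hom_list xs \<longrightarrow> int (length xs) + int (deg xs) \<noteq> n + 1 \<longrightarrow> family_eval y xs = 0)"
proof
  assume "y \<in> EH_set n"
  then show "cochain_family y \<and>
     (\<forall>xs. xs \<noteq> [] \<longrightarrow> hom_list xs \<longrightarrow> int (length xs) + int (deg xs) \<noteq> n + 1 \<longrightarrow> family_eval y xs = 0)"
    by (auto simp: EH_set_def family_eval_def neq_Nil_conv)
next
  assume y: "cochain_family y \<and>
     (\<forall>xs. xs \<noteq> [] \<longrightarrow> hom_list xs \<longrightarrow> int (length xs) + int (deg xs) \<noteq> n + 1 \<longrightarrow> family_eval y xs = 0)"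
  have "y (p, q) = 0" if pq: "int p + int q \<noteq> n" for p q
  proof (rule cochain_ext[of _ p q, OF _ cochains_0])
    fix xs assume xs: "xs \<in> hlists (Suc p) q"
    then have "xs \<noteq> []" "hom_list xs" "length xs = Suc p" "deg xs = q" by (auto simp: hlists_iff)
    then show "y (p, q) (pure xs) = 0 (pure xs)" using y pq by (auto simp: family_eval_def)
  qed (use y familyD in blast)
  then show "y \<in> EH_set n" using y by (simp add: EH_set_def)
qed

lemma EH_diff_EH_set:
  assumes y: "y \<in> EH_set n"
  shows "EH_diff y \<in> EH_set (n + 1)"
  unfolding EH_set_iff
proof (intro conjI allI impI)
  note f = EH_set_family[OF y]
  show "cochain_family (EH_diff y)" by (rule family_diff[OF f])
  fix xs :: "(nat \<times> 'a) list" assume xs: "xs \<noteq> []" "hom_list xs" and n: "int (length xs) + int (deg xs) \<noteq> n + 1 + 1"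
  have z: "family_eval y ys = 0" if "ys \<noteq> []" "hom_list ys" "int (length ys) + int (deg ys) \<noteq> n + 1" for ys
    using y that by (simp add: EH_set_iff)
  have "hoch (family_eval y) xs = hoch (\<lambda>_. 0) xs"
    by (rule hoch_cong_hom[OF xs(2)], rule z) (use n in auto)
  moreover have "Psi (family_eval y) xs = Psi (\<lambda>_. 0) xs"
    by (rule Psi_cong_hom[OF xs(2)], rule z) (use n xs in auto)
  ultimately show "family_eval (EH_diff y) xs = 0" by (simp add: family_eval_diff[OF f xs] hoch_0 Psi_0)
qed

lemma EH_B_EH_set:
  assumes y: "y \<in> EH_set n"
  shows "EH_B y \<in> EH_set (n - 1)"
  unfolding EH_set_iff
proof (intro conjI allI impI)
  note f = EH_set_family[OF y]
  show "cochain_family (EH_B y)" by (rule family_B[OF f])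
  fix xs :: "(nat \<times> 'a) list" assume xs: "xs \<noteq> []" "hom_list xs" and n: "int (length xs) + int (deg xs) \<noteq> n - 1 + 1"
  have z: "family_eval y ys = 0" if "ys \<noteq> []" "hom_list ys" "int (length ys) + int (deg ys) \<noteq> n + 1" for ys
    using y that by (simp add: EH_set_iff)
  have "connes (family_eval y) xs = connes (\<lambda>_. 0) xs"
    by (rule connes_cong_hom[OF xs(2)], rule z) (use n xs in auto)
  then show "family_eval (EH_B y) xs = 0" by (simp add: family_eval_B[OF f xs] connes_0)
qed

lemma EH_set_add: "y \<in> EH_set n \<Longrightarrow> y' \<in> EH_set n \<Longrightarrow> y + y' \<in> EH_set n"
  by (simp add: EH_set_def family_add)

lemma EH_set_scale: "y \<in> EH_set n \<Longrightarrow> fscale c y \<in> EH_set n"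
  using family_scale[of y c] by (auto simp: EH_set_def fun_eq_iff)

lemma EH_set_0: "0 \<in> EH_set n"
  by (simp add: EH_set_def family_0)

lemma EH_set_neg: "n < 0 \<Longrightarrow> y \<in> EH_set n \<Longrightarrow> y = 0"
  by (auto simp: EH_set_def fun_eq_iff)

lemma cochain_complex_EH: "cochain_complex fscale EH_set EH_diff"
proof -
  interpret fs: vector_space "fscale :: 'k \<Rightarrow> (nat \<times> nat \<Rightarrow> ('k, 'a) cochain) \<Rightarrow> _"
    by (rule vector_space_fscale)
  show ?thesis
    by unfold_locales
      (auto intro!: fs.subspaceI EH_set_0 EH_set_add EH_set_scale EH_diff_EH_set simp: EH_diff_add EH_diff_scale EH_diff_diff EH_set_family)
qed

interpretation EH: cochain_complex "fscale :: 'k \<Rightarrow> (nat \<times> nat \<Rightarrow> ('k, 'a) cochain) \<Rightarrow> _" EH_set EH_diff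
  by (rule cochain_complex_EH)

lemma EH_B_0: "EH_B 0 = 0"
  using EH_B_scale[OF family_0, of 0] by (simp add: zero_fun_def)

lemma HH_eq: "HH n = subquotient fscale (EH.cocycles n) (EH.coboundaries n)"
  unfolding HH_def EH_eq[abs_def] by (rule EH.cohom_eq_subquotient)

lemma EH_B_cocycles:
  assumes "y \<in> EH.cocycles n"
  shows "EH_B y \<in> EH.cocycles (n - 1)"
  using assms EH_diff_B[of y] EH_B_EH_set[of y n] EH_set_family[of y n] by (simp add: EH.cocycles_def EH_B_0)

lemma EH_B_coboundaries:
  assumes "y \<in> EH.coboundaries n"
  shows "EH_B y \<in> EH.coboundaries (n - 1)"
proof -
  obtain z where z: "y = EH_diff z" "z \<in> EH_set (n - 1)" using assms by blast
  have B: "EH_B z \<in> EH_set (n - 1 - 1)" by (rule EH_B_EH_set[OF z(2)])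
  have "EH_B y = - EH_diff (EH_B z)"
    using EH_diff_B[OF EH_set_family[OF z(2)]] by (simp add: z(1) eq_neg_iff_add_eq_0 add.commute)
  also have "\<dots> = EH_diff (- EH_B z)" by (simp add: EH.d_neg[OF B])
  finally show ?thesis using EH.subspace_neg[OF EH.subspace_C B] by blast
qed

lemma HH_B_coset:
  assumes x: "x \<in> EH.cocycles n"
  shows "HH_B n (coset (EH.coboundaries n) x) = coset (EH.coboundaries (n - 1)) (EH_B x)"
proof -
  have "HH_B n w = (\<Union>x\<in>w. coset (EH.coboundaries (n - 1)) (EH_B x))" for w
    by (simp add: HH_B_def cohom_map_def cobound_def EH_eq)
  moreover have "(\<Union>x\<in>coset (EH.coboundaries n) x. coset (EH.coboundaries (n - 1)) (EH_B x)) = coset (EH.coboundaries (n - 1)) (EH_B x)"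
    by (rule EH.pair.coset_image[OF EH.subspace_cocycles EH.subspace_coboundaries EH.subspace_coboundaries
          EH.coboundaries_cocycles _ EH_B_coboundaries x])
       (rule EH_B_add, auto simp: EH.cocycles_def dest: EH_set_family)
  ultimately show ?thesis by simp
qed

subsection \<open>The cyclic complex\<close>

text \<open>
  The column of index \<open>p\<close> in the tricomplex, reindexed by \<open>q - p\<close> so as to be a Hochschild cochain.
\<close>

definition level :: "nat \<Rightarrow> (nat \<times> nat \<times> nat \<Rightarrow> ('k, 'a) cochain) \<Rightarrow> nat \<times> nat \<Rightarrow> ('k, 'a) cochain" where
  "level p x = (\<lambda>(a, r). x (p, p + a, r))"

definition at_level :: "nat \<Rightarrow> (nat \<times> nat \<Rightarrow> ('k, 'a) cochain) \<Rightarrow> nat \<times> nat \<times> nat \<Rightarrow> ('k, 'a) cochain" where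
  "at_level p y = (\<lambda>(a, b, c). if a = p \<and> p \<le> b then y (b - p, c) else 0)"

definition EC_set :: "int \<Rightarrow> (nat \<times> nat \<times> nat \<Rightarrow> ('k, 'a) cochain) set" where
  "EC_set n = {x. (\<forall>p. level p x \<in> EH_set (n - 2 * int p)) \<and> (\<forall>p q r. q < p \<longrightarrow> x (p, q, r) = 0)}"

definition Fil :: "int \<Rightarrow> (nat \<times> nat \<times> nat \<Rightarrow> ('k, 'a) cochain) set" where
  "Fil k = {x. \<forall>p q r. int p < k \<longrightarrow> x (p, q, r) = 0}"

lemma level_add [simp]: "level p (x + x') = level p x + level p x'"
  by (auto simp: level_def)

lemma level_scale [simp]: "level p (fscale c x) = fscale c (level p x)"
  by (auto simp: level_def)

lemma level_0 [simp]: "level p 0 = 0"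
  by (auto simp: level_def)

lemma level_diff [simp]: "level p (x - x') = level p x - level p x'"
  by (auto simp: level_def)

lemma level_at_level [simp]: "level k (at_level p y) = (if k = p then y else 0)"
  by (auto simp: level_def at_level_def fun_eq_iff)

lemma EC_eqI:
  assumes "\<And>p. level p x = level p x'" "\<And>p q r. q < p \<Longrightarrow> x (p, q, r) = x' (p, q, r)"
  shows "x = x'"
proof
  fix i :: "nat \<times> nat \<times> nat"
  obtain p q r where i: "i = (p, q, r)" by (cases i)
  show "x i = x' i"
  proof (cases "p \<le> q")
    case True
    then show ?thesis using fun_cong[OF assms(1)[of p], of "(q - p, r)"] by (simp add: level_def i)
  qed (use assms(2) in \<open>simp add: i\<close>)
qed

text \<open>
  Column by column, the cyclic differential is the Hochschild differential plus \<open>B\<close> of the previous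
  column; this form transfers the facts about the Hochschild complex.
\<close>

lemma level_EC_diff:
  "level p (EC_diff x) = EH_diff (level p x) + (if 0 < p then EH_B (level (p - 1) x) else 0)"
proof -
  have "EC_diff x (p, p + a, r) w = (EH_diff (level p x) + (if 0 < p then EH_B (level (p - 1) x) else 0)) (a, r) w" for a r w
    by (cases a; cases p) (simp_all add: EC_diff_def EH_diff_def EH_B_def level_def)
  then show ?thesis by (auto simp: level_def fun_eq_iff)
qed

lemma EC_diff_below: "q < p \<Longrightarrow> EC_diff x (p, q, r) = 0"
  by (auto simp: EC_diff_def fun_eq_iff)

lemma EC_set_level: "x \<in> EC_set n \<Longrightarrow> level p x \<in> EH_set (n - 2 * int p)"
  by (simp add: EC_set_def)

lemma EC_set_below: "x \<in> EC_set n \<Longrightarrow> q < p \<Longrightarrow> x (p, q, r) = 0"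
  by (simp add: EC_set_def)

lemma EC_set_family: "x \<in> EC_set n \<Longrightarrow> cochain_family (level p x)"
  by (rule EH_set_family[OF EC_set_level])

lemma EC_eq: "EC n = vspace (EC_set n) 0 (+) fscale"
proof -
  let ?I = "{(p, q, r). int p + int q + int r = n}"
  have fin: "finite ?I"
    by (rule finite_subset[of _ "{..nat n} \<times> {..nat n} \<times> {..nat n}"]) auto
  have sel: "\<zero>\<^bsub>EC3 i\<^esub> = 0" "add (EC3 i) = (+)" "module.smult (EC3 i) = (\<lambda>c f w. c * f w)" for i
    by (cases i; simp add: EC3_def zero_space_def)+
  have "{x. (\<forall>i\<in>?I. x i \<in> carrier (EC3 i)) \<and> (\<forall>i. i \<notin> ?I \<longrightarrow> x i = \<zero>\<^bsub>EC3 i\<^esub>) \<and> finite {i. x i \<noteq> \<zero>\<^bsub>EC3 i\<^esub>}} = EC_set n" (is "?S = _")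
  proof (intro equalityI subsetI)
    fix x assume x: "x \<in> ?S"
    have z: "x (p, q, r) = 0" if "int p + int q + int r \<noteq> n" for p q r
      using x that by (auto simp: sel)
    have c: "x (p, q, r) \<in> carrier (EC3 (p, q, r))" if "int p + int q + int r = n" for p q r
      using x that by auto
    have "x (p, p + a, r) \<in> carrier (cochains a r)" for p a r
      using c[of p "p + a" r] z[of p "p + a" r] cochains_0 by (cases "int p + int (p + a) + int r = n") (auto simp: EC3_def)
    moreover have "x (p, q, r) = 0" if "q < p" for p q r
      using c[of p q r] z[of p q r] that by (cases "int p + int q + int r = n") (auto simp: EC3_def zero_space_def)
    ultimately show "x \<in> EC_set n" using z by (auto simp: EC_set_def EH_set_def cochain_family_def level_def)
  next
    fix x assume x: "x \<in> EC_set n"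
    have z: "x (p, q, r) = 0" if "int p + int q + int r \<noteq> n" for p q r
    proof (cases "p \<le> q")
      case True
      have "level p x (q - p, r) = 0"
        using EC_set_level[OF x, of p] that True by (auto simp: EH_set_def)
      then show ?thesis using True by (simp add: level_def)
    qed (use EC_set_below[OF x] in simp)
    have "x (p, q, r) \<in> carrier (EC3 (p, q, r))" for p q r
    proof (cases "p \<le> q")
      case True
      have "level p x (q - p, r) \<in> carrier (cochains (q - p) r)"
        by (rule familyD[OF EC_set_family[OF x]])
      then show ?thesis using True by (simp add: level_def EC3_def)
    qed (use EC_set_below[OF x] in \<open>simp add: EC3_def zero_space_def\<close>)
    moreover have "{i. x i \<noteq> 0} \<subseteq> ?I" using z by auto
    then have "finite {i. x i \<noteq> 0}" using fin by (rule finite_subset)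
    ultimately show "x \<in> ?S"
      using z by (auto simp: sel)
  qed
  then show ?thesis
    unfolding EC_def dsum_def by (simp add: sel vspace_def fun_eq_iff zero_fun_def)
qed

lemma EC_set_add: "x \<in> EC_set n \<Longrightarrow> x' \<in> EC_set n \<Longrightarrow> x + x' \<in> EC_set n"
  by (simp add: EC_set_def EH_set_add)

lemma EC_set_scale: "x \<in> EC_set n \<Longrightarrow> fscale c x \<in> EC_set n"
  by (auto simp: EC_set_def EH_set_scale fun_eq_iff)

lemma EC_set_0: "0 \<in> EC_set n"
  by (simp add: EC_set_def EH_set_0)

lemma at_level_EC_set: "y \<in> EH_set (n - 2 * int p) \<Longrightarrow> at_level p y \<in> EC_set n"
  by (auto simp: EC_set_def EH_set_0) (auto simp: at_level_def)

lemma EC_diff_EC_set: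
  assumes x: "x \<in> EC_set n"
  shows "EC_diff x \<in> EC_set (n + 1)"
proof -
  have "level p (EC_diff x) \<in> EH_set (n + 1 - 2 * int p)" for p
  proof -
    have "EH_diff (level p x) \<in> EH_set (n + 1 - 2 * int p)"
      using EH_diff_EH_set[OF EC_set_level[OF x, of p]] by (simp add: algebra_simps)
    moreover have "EH_B (level (p - 1) x) \<in> EH_set (n + 1 - 2 * int p)" if "0 < p"
    proof -
      have "n - 2 * int (p - 1) - 1 = n + 1 - 2 * int p" using that by (simp add: of_nat_diff)
      then show ?thesis using EH_B_EH_set[OF EC_set_level[OF x, of "p - 1"]] by (simp only:)
    qed
    then have "(if 0 < p then EH_B (level (p - 1) x) else 0) \<in> EH_set (n + 1 - 2 * int p)"
      by (simp add: EH_set_0)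
    ultimately show ?thesis unfolding level_EC_diff by (rule EH_set_add)
  qed
  then show ?thesis by (simp add: EC_set_def EC_diff_below)
qed

lemma EC_diff_diff:
  assumes x: "x \<in> EC_set n"
  shows "EC_diff (EC_diff x) = 0"
proof (rule EC_eqI)
  fix p
  note f = EC_set_family[OF x]
  have dd: "EH_diff (EH_diff (level k x)) = 0" for k by (rule EH_diff_diff[OF f])
  have BB: "EH_B (EH_B (level k x)) = 0" for k by (rule EH_B_B[OF f])
  have dB: "EH_diff (EH_B (level k x)) + EH_B (EH_diff (level k x)) = 0" for k by (rule EH_diff_B[OF f])
  consider "p = 0" | "p = 1" | k where "p = Suc (Suc k)" by (metis One_nat_def not0_implies_Suc)
  then show "level p (EC_diff (EC_diff x)) = level p 0"
  proof cases
    case 1 then show ?thesis by (simp add: level_EC_diff dd)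
  next
    case 2
    then show ?thesis
      by (simp add: level_EC_diff EH_diff_add[OF family_diff[OF f] family_B[OF f]] dd dB)
  next
    case 3
    then show ?thesis
      by (simp add: level_EC_diff EH_diff_add[OF family_diff[OF f] family_B[OF f]]
        EH_B_add[OF family_diff[OF f] family_B[OF f]] dd BB dB)
  qed
qed (simp add: EC_diff_below)

lemma EC_diff_add: "x \<in> EC_set n \<Longrightarrow> x' \<in> EC_set n \<Longrightarrow> EC_diff (x + x') = EC_diff x + EC_diff x'"
  by (rule EC_eqI)
     (simp_all add: level_EC_diff EC_diff_below EH_diff_add[OF EC_set_family EC_set_family] EH_B_add[OF EC_set_family EC_set_family])

lemma EC_diff_scale:
  assumes x: "x \<in> EC_set n"
  shows "EC_diff (fscale c x) = fscale c (EC_diff x)"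
proof (rule EC_eqI)
  fix p
  show "level p (EC_diff (fscale c x)) = level p (fscale c (EC_diff x))"
    unfolding level_scale level_EC_diff EH_diff_scale[OF EC_set_family[OF x]] EH_B_scale[OF EC_set_family[OF x]]
    by (auto simp: fun_eq_iff distrib_left)
qed (auto simp: EC_diff_below fun_eq_iff)

lemma EC_set_Fil_iff:
  assumes x: "x \<in> EC_set n"
  shows "x \<in> Fil k \<longleftrightarrow> (\<forall>p. int p < k \<longrightarrow> level p x = 0)"
proof
  assume "x \<in> Fil k"
  then show "\<forall>p. int p < k \<longrightarrow> level p x = 0" by (auto simp: Fil_def level_def)
next
  assume z: "\<forall>p. int p < k \<longrightarrow> level p x = 0"
  have "x (p, q, r) = 0" if "int p < k" for p q r
  proof (cases "p \<le> q")
    case True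
    have "level p x (q - p, r) = 0" using z that by simp
    then show ?thesis using True by (simp add: level_def)
  qed (use EC_set_below[OF x] in simp)
  then show "x \<in> Fil k" by (simp add: Fil_def)
qed

lemma EC_diff_Fil:
  assumes x: "x \<in> EC_set n" "x \<in> Fil k"
  shows "EC_diff x \<in> Fil k"
proof -
  have z: "level p x = 0" if "int p < k" for p using x that by (simp add: EC_set_Fil_iff)
  show ?thesis
    unfolding EC_set_Fil_iff[OF EC_diff_EC_set[OF x(1)]]
  proof (intro allI impI)
    fix p assume p: "int p < k"
    then have "level (p - 1) x = 0" by (intro z) simp
    then show "level p (EC_diff x) = 0" by (simp add: level_EC_diff z[OF p] EH_B_0)
  qed
qed

text \<open>A cochain of total degree \<open>n\<close> lives in filtration degrees \<open>p\<close> with \<open>2 * p \<le> n\<close>, as \<open>p \<le> q\<close>.\<close>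

lemma EC_set_Fil_eq_0:
  assumes "x \<in> EC_set n" "x \<in> Fil k" and n: "n < 2 * k \<or> n < 0"
  shows "x = 0"
proof (rule EC_eqI)
  fix p
  have "level p x = 0"
  proof (cases "int p < k")
    case True then show ?thesis using assms by (simp add: EC_set_Fil_iff)
  next
    case False
    then have "n - 2 * int p < 0" using n by auto
    then show ?thesis using EC_set_level[OF assms(1)] by (rule EH_set_neg)
  qed
  then show "level p x = level p 0" by simp
qed (simp add: EC_set_below[OF assms(1)])

lemma filtered_complex_EC: "filtered_complex fscale EC_set EC_diff Fil"
proof -
  interpret fs: vector_space "fscale :: 'k \<Rightarrow> (nat \<times> nat \<times> nat \<Rightarrow> ('k, 'a) cochain) \<Rightarrow> _"
    by (rule vector_space_fscale)
  show ?thesis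
  proof unfold_locales
    show "fs.subspace (EC_set n)" for n by (rule fs.subspaceI) (auto intro: EC_set_0 EC_set_add EC_set_scale)
    show "fs.subspace (Fil p)" for p by (rule fs.subspaceI) (auto simp: Fil_def fun_eq_iff)
    show "EC_set n \<subseteq> Fil p" if "p \<le> 0" for n p using that by (auto simp: Fil_def)
    show "EC_set n \<inter> Fil p \<subseteq> {0}" if "n < p" for n p using that EC_set_Fil_eq_0[of _ n p] by fastforce
    show "Fil p' \<subseteq> Fil p" if "p \<le> p'" for p p' using that by (fastforce simp: Fil_def)
  qed (auto simp: EC_diff_EC_set EC_diff_Fil EC_diff_add EC_diff_scale EC_diff_diff)
qed

interpretation EC: filtered_complex "fscale :: 'k \<Rightarrow> (nat \<times> nat \<times> nat \<Rightarrow> ('k, 'a) cochain) \<Rightarrow> _" EC_set EC_diff Fil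
  by (rule filtered_complex_EC)

lemma HC_eq: "HC = cohom (\<lambda>n. vspace (EC_set n) 0 (+) fscale) (\<lambda>_. EC_diff)"
  unfolding HC_def EC_eq[abs_def] ..

subsection \<open>The second page\<close>

text \<open>
  Outside of the range of the truncation both sides are zero.  For negative \<open>p\<close> the filtration is
  constant around \<open>p\<close>, so that all of \<open>Z\<^sub>2\<close> is divided out; for \<open>p > q\<close> the degree \<open>p + q\<close> is below \<open>2p\<close>.
\<close>

lemma page_2_iso_outside:
  assumes p: "p < 0 \<or> q < p"
  shows "EC.page 2 p q \<simeq>\<^sub>k cohom (neg_trunc q HH) (trunc_diff q) p"
proof -
  define n where "n = p + q"
  let ?B = "EH.coboundaries (q - p)"
  note sB = EH.subspace_coboundaries[of "q - p"]
  have T: "neg_trunc q HH p = subquotient fscale ?B ?B"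
  proof -
    have "neg_trunc q HH p = (HH (q - p))\<lparr>carrier := {?B}\<rparr>"
      using p by (auto simp: neg_trunc_def zero_space_def HH_eq)
    moreover have "{?B} = coset ?B ` ?B" by (rule EH.coset_image_self[OF sB, symmetric])
    ultimately show ?thesis by (simp only: HH_eq quotient_update)
  qed
  have ker: "a_kernel (neg_trunc q HH p) (neg_trunc q HH (p + 1)) (trunc_diff q p) = coset ?B ` ?B"
    using p by (auto simp: a_kernel_def' trunc_diff_def T)
  have "cobound (neg_trunc q HH) (trunc_diff q) p = (\<lambda>_. ?B) ` carrier (neg_trunc q HH (p - 1))"
    using p by (auto simp: cobound_def trunc_diff_def T)
  moreover have "carrier (neg_trunc q HH (p - 1)) \<noteq> {}"
    using EH.subspace_0[OF EH.subspace_cocycles] by (auto simp: neg_trunc_def zero_space_def HH_eq)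
  ultimately have "cobound (neg_trunc q HH) (trunc_diff q) p = {?B}" by auto
  also have "{?B} = coset ?B ` ?B" by (rule EH.coset_image_self[OF sB, symmetric])
  finally have im: "cobound (neg_trunc q HH) (trunc_diff q) p = coset ?B ` ?B" .
  have R: "subquotient fscale ?B ?B \<simeq>\<^sub>k cohom (neg_trunc q HH) (trunc_diff q) p"
    unfolding cohom_def ker im unfolding T quotient_update
    by (rule EH.subquotient_subquotient(2)[OF sB sB sB order_refl order_refl])
  interpret pair: vector_space_pair "fscale :: 'k \<Rightarrow> (nat \<times> nat \<times> nat \<Rightarrow> ('k, 'a) cochain) \<Rightarrow> _"
    "fscale :: 'k \<Rightarrow> (nat \<times> nat \<Rightarrow> ('k, 'a) cochain) \<Rightarrow> _"
    by (intro vector_space_pair.intro vector_space_fscale)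
  have ZB: "x \<in> EC.Br 2 p n" if x: "x \<in> EC.Zr 2 p n" for x
  proof -
    have c: "x \<in> EC_set n" "x \<in> Fil p" "EC_diff x \<in> Fil (p + 2)" using x by (auto simp: EC.Zr_def)
    show ?thesis
    proof (cases "p < 0")
      case True
      then have "x \<in> Fil (p + 1)" by (auto simp: Fil_def)
      moreover have "p + 1 + (2 - 1) = p + 2" by simp
      ultimately have "x \<in> EC.Zr (2 - 1) (p + 1) n" using c unfolding EC.Zr_def by (simp only: Int_iff mem_Collect_eq simp_thms)
      then show ?thesis by (rule EC.Zr_Br)
    next
      case False
      then have "x = 0" using p by (intro EC_set_Fil_eq_0[OF c(1,2)]) (auto simp: n_def)
      then show ?thesis using EC.subspace_0[OF EC.subspace_Br] by simp
    qed
  qed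
  have "EC.page 2 p q \<simeq>\<^sub>k subquotient fscale ?B ?B"
    unfolding EC.page_def
  proof (rule pair.subquotient_iso[OF EC.subspace_Zr EC.subspace_Br sB EC.Br_Zr, where f = "\<lambda>_. 0"])
    show "0 \<in> ?B" by (rule EH.subspace_0[OF sB])
    show "\<exists>x\<in>EC.Zr (int 2) p (p + q). v - 0 \<in> ?B" if "v \<in> ?B" for v
      using that EC.subspace_0[OF EC.subspace_Zr] by auto
    show "0 \<in> ?B \<longleftrightarrow> x \<in> EC.Br (int 2) p (p + q)" if "x \<in> EC.Zr (int 2) p (p + q)" for x
      using ZB[of x] that EH.subspace_0[OF sB] by (simp add: n_def)
  qed (simp_all add: zero_fun_def)
  then show ?thesis using R by (rule vspace_iso_trans)
qed

lemma EC_diff_level_below: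
  assumes "\<And>k. k < p \<Longrightarrow> level k x = 0"
  shows "k < p \<Longrightarrow> level k (EC_diff x) = 0" and "level p (EC_diff x) = EH_diff (level p x)"
  using assms by (auto simp: level_EC_diff EH_B_0)

lemma EC_ZrI: "x \<in> EC_set n \<Longrightarrow> x \<in> Fil p \<Longrightarrow> EC_diff x \<in> Fil p' \<Longrightarrow> p' = p + r \<Longrightarrow> x \<in> EC.Zr r p n"
  by (simp add: EC.Zr_def)

lemma EC_ZrD:
  assumes "x \<in> EC.Zr r p n"
  shows "x \<in> EC_set n" "x \<in> Fil p" "EC_diff x \<in> Fil (p + r)"
  using assms by (simp_all add: EC.Zr_def)

text \<open>
  The first column \<open>x\<^sub>p\<close> of an element of \<open>Z\<^sub>2\<^sup>p\<close> is a Hochschild cocycle, and \<open>B x\<^sub>p\<close> is a coboundary,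
  as witnessed by the second column; conversely a witness for such a cocycle supplies the second column.
  Divided out are, modulo coboundaries, the cocycles \<open>B u\<close>: these are the first columns of the
  coboundaries of cochains that start one step earlier, with the cocycle \<open>u\<close>.
\<close>

lemma page_2_iso_inside:
  fixes P :: nat
  assumes q: "int P \<le> q"
  shows "EC.page 2 (int P) q \<simeq>\<^sub>k cohom (neg_trunc q HH) (trunc_diff q) (int P)"
proof -
  define n s where "n = int P + q" and "s = q - int P"
  let ?B = "EH.coboundaries" and ?Z = "EH.cocycles"
  \<comment> \<open>\<open>K\<close> and \<open>L\<close> represent the kernel and the image of \<open>B\<close> on Hochschild cohomology in degree \<open>s\<close>;
    no differential of the truncated complex ends at \<open>p = 0\<close>.\<close>
  define K where "K = {y \<in> ?Z s. EH_B y \<in> ?B (s - 1)}"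
  define U where "U = (if 0 < P then EH_B ` ?Z (s + 1) else {0})"
  define L where "L = {u + b | u b. u \<in> U \<and> b \<in> ?B s}"
  note sB = EH.subspace_coboundaries[of s]
  have lev: "n - 2 * int P = s" "n - 2 * int (Suc P) = s - 2" by (simp_all add: n_def s_def)
  have Zc: "cochain_family y" if "y \<in> ?Z k" for y k
    using that EH_set_family by (auto simp: EH.cocycles_def)
  have sU: "EH.subspace U"
  proof (cases "0 < P")
    case True
    have "EH.subspace (EH_B ` ?Z (s + 1))"
      by (rule EH.pair.subspace_image_on[OF EH.subspace_cocycles]) (auto intro: EH_B_add EH_B_scale Zc)
    then show ?thesis using True by (simp add: U_def)
  qed (simp add: U_def)
  have sL: "EH.subspace L" unfolding L_def by (rule EH.subspace_sums[OF sU sB])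
  have sK: "EH.subspace K"
    unfolding K_def
    by (rule EH.pair.subspace_preimage_on[OF EH.subspace_cocycles EH.subspace_coboundaries])
       (auto intro: EH_B_add EH_B_scale Zc)
  have BK: "?B s \<subseteq> K"
    unfolding K_def using EH.coboundaries_cocycles[of s] EH_B_coboundaries by blast
  have UK: "U \<subseteq> K"
  proof (cases "0 < P")
    case True
    have "EH_B u \<in> K" if u: "u \<in> ?Z (s + 1)" for u
      using EH_B_cocycles[OF u] EH_B_B[OF Zc[OF u]] EH.subspace_0[OF EH.subspace_coboundaries, of "s - 1"]
      by (simp add: K_def)
    then show ?thesis using True by (auto simp: U_def)
  qed (use EH.subspace_0[OF sK] in \<open>simp add: U_def\<close>)
  have BL: "?B s \<subseteq> L" unfolding L_def using EH.subspace_0[OF sU] by force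
  have LK: "L \<subseteq> K"
  proof
    fix w assume "w \<in> L"
    then obtain u b where "w = u + b" "u \<in> U" "b \<in> ?B s" unfolding L_def by blast
    then show "w \<in> K" using UK BK EH.subspace_add[OF sK] by blast
  qed

  have T: "neg_trunc q HH (int P) = subquotient fscale (?Z s) (?B s)"
    using q by (simp add: neg_trunc_def HH_eq s_def)
  have td: "trunc_diff q (int P) (coset (?B s) x) = ?B (s - 1) \<longleftrightarrow> EH_B x \<in> ?B (s - 1)" if x: "x \<in> ?Z s" for x
  proof (cases "int P < q")
    case True
    then have "trunc_diff q (int P) (coset (?B s) x) = coset (?B (s - 1)) (EH_B x)"
      using HH_B_coset[OF x] by (simp add: trunc_diff_def s_def)
    then show ?thesis by (simp only: EH.coset_eq_zero[OF EH.subspace_coboundaries])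
  next
    case False
    then have s0: "s = 0" using q by (simp add: s_def)
    have "EH_B x \<in> EH_set (s - 1)" using EH_B_cocycles[OF x] by (simp add: EH.cocycles_def)
    then have "EH_B x = 0" by (rule EH_set_neg[rotated]) (simp add: s0)
    moreover have "trunc_diff q (int P) (coset (?B s) x) = ?B (s - 1)"
      using False by (simp add: trunc_diff_def neg_trunc_def zero_space_def HH_eq s_def algebra_simps)
    ultimately show ?thesis using EH.subspace_0[OF EH.subspace_coboundaries, of "s - 1"] by simp
  qed
  have z: "\<zero>\<^bsub>neg_trunc q HH (int P + 1)\<^esub> = ?B (s - 1)"
    by (simp add: neg_trunc_def zero_space_def HH_eq s_def algebra_simps)
  have ker: "a_kernel (neg_trunc q HH (int P)) (neg_trunc q HH (int P + 1)) (trunc_diff q (int P)) = coset (?B s) ` K"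
  proof -
    have "{w \<in> coset (?B s) ` ?Z s. trunc_diff q (int P) w = ?B (s - 1)} = coset (?B s) ` K"
      unfolding K_def using td by blast
    then show ?thesis unfolding a_kernel_def' z unfolding T carrier_subquotient .
  qed
  have CL: "coset (?B s) ` L = coset (?B s) ` U"
  proof -
    have "coset (?B s) (u + b) = coset (?B s) u" if "b \<in> ?B s" for u b
      using that by (simp only: EH.coset_eq_iff[OF sB]) simp
    then have "coset (?B s) ` L \<subseteq> coset (?B s) ` U" unfolding L_def by blast
    moreover have "U \<subseteq> L"
    proof
      fix u assume "u \<in> U"
      then have "u + 0 \<in> L" unfolding L_def using EH.subspace_0[OF sB] by blast
      then show "u \<in> L" by simp
    qed
    ultimately show ?thesis by blast
  qed
  have im: "cobound (neg_trunc q HH) (trunc_diff q) (int P) = coset (?B s) ` L"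
  proof (cases "0 < P")
    case True
    have c: "(0 \<le> int P - 1 \<and> int P - 1 \<le> q) = True" "(0 \<le> int P - 1 \<and> int P - 1 < q) = True"
      and sum: "q - (int P - 1) = s + 1"
      using True q by (simp_all add: s_def)
    have T1: "neg_trunc q HH (int P - 1) = subquotient fscale (?Z (s + 1)) (?B (s + 1))"
      by (simp only: neg_trunc_def c sum if_True HH_eq)
    have D1: "trunc_diff q (int P - 1) = HH_B (s + 1)"
      by (simp only: trunc_diff_def c sum if_True)
    have "HH_B (s + 1) (coset (?B (s + 1)) x) = coset (?B s) (EH_B x)" if "x \<in> ?Z (s + 1)" for x
      using HH_B_coset[OF that] by simp
    then have "(\<lambda>x. HH_B (s + 1) (coset (?B (s + 1)) x)) ` ?Z (s + 1) = (\<lambda>x. coset (?B s) (EH_B x)) ` ?Z (s + 1)"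
      by (rule image_cong[OF refl])
    then have "HH_B (s + 1) ` coset (?B (s + 1)) ` ?Z (s + 1) = coset (?B s) ` EH_B ` ?Z (s + 1)"
      by (simp only: image_image)
    then show ?thesis unfolding cobound_def T1 D1 CL carrier_subquotient by (simp only: U_def True if_True)
  next
    case False
    then have P: "P = 0" by simp
    have td0: "trunc_diff q (int P - 1) w = ?B s" for w
    proof -
      have "trunc_diff q (int P - 1) w = \<zero>\<^bsub>neg_trunc q HH (int P - 1 + 1)\<^esub>"
        by (simp add: trunc_diff_def P)
      also have "int P - 1 + 1 = int P" by simp
      finally show ?thesis by (simp only: T zero_quotient)
    qed
    have "carrier (neg_trunc q HH (int P - 1)) \<noteq> {}"
      by (simp add: neg_trunc_def zero_space_def P)
    then have "trunc_diff q (int P - 1) ` carrier (neg_trunc q HH (int P - 1)) = {?B s}"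
      using td0 by auto
    then show ?thesis unfolding cobound_def CL by (simp add: U_def P)
  qed
  have R: "subquotient fscale K L \<simeq>\<^sub>k cohom (neg_trunc q HH) (trunc_diff q) (int P)"
    unfolding cohom_def ker im unfolding T quotient_update
    by (rule EH.subquotient_subquotient(2)[OF sB sL sK BL LK])

  interpret pair: vector_space_pair "fscale :: 'k \<Rightarrow> (nat \<times> nat \<times> nat \<Rightarrow> ('k, 'a) cochain) \<Rightarrow> _"
    "fscale :: 'k \<Rightarrow> (nat \<times> nat \<Rightarrow> ('k, 'a) cochain) \<Rightarrow> _"
    by (intro vector_space_pair.intro vector_space_fscale)
  have ZrD: "x \<in> EC_set n \<and> (\<forall>k<P. level k x = 0) \<and> EH_diff (level P x) = 0 \<and>
      EH_diff (level (Suc P) x) + EH_B (level P x) = 0"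
    if x: "x \<in> EC.Zr 2 (int P) n" for x
  proof -
    have c: "x \<in> EC_set n" and F: "x \<in> Fil (int P)" and dF: "EC_diff x \<in> Fil (int P + 2)"
      using x by (auto simp: EC.Zr_def)
    have l: "level k x = 0" if "k < P" for k using F that by (simp add: EC_set_Fil_iff[OF c])
    have d: "level P (EC_diff x) = 0" "level (Suc P) (EC_diff x) = 0"
      using dF by (simp_all add: EC_set_Fil_iff[OF EC_diff_EC_set[OF c]])
    show ?thesis
      using d(1) d(2) EC_diff_level_below(2)[of P x] l c by (simp add: level_EC_diff[of "Suc P"])
  qed
  have "subquotient fscale (EC.Zr 2 (int P) n) (EC.Br 2 (int P) n) \<simeq>\<^sub>k subquotient fscale K L"
  proof (rule pair.subquotient_iso[OF EC.subspace_Zr EC.subspace_Br sL EC.Br_Zr, where f = "level P"])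
    show "level P x \<in> K" if "x \<in> EC.Zr 2 (int P) n" for x
    proof -
      have c: "x \<in> EC_set n" and d0: "EH_diff (level P x) = 0"
        and d1: "EH_diff (level (Suc P) x) + EH_B (level P x) = 0"
        using ZrD[OF that] by blast+
      have w: "level (Suc P) x \<in> EH_set (s - 2)" using EC_set_level[OF c, of "Suc P"] unfolding lev .
      have "EH_B (level P x) = - EH_diff (level (Suc P) x)" using d1 by (rule minus_unique[symmetric])
      also have "\<dots> = EH_diff (- level (Suc P) x)" by (rule EH.d_neg[OF w, symmetric])
      finally have B: "EH_B (level P x) = EH_diff (- level (Suc P) x)" .
      have "s - 1 - 1 = s - 2" by simp
      then have "EH_B (level P x) \<in> ?B (s - 1)"
        unfolding B using EH.subspace_neg[OF EH.subspace_C w] by (simp only: imageI)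
      moreover have "level P x \<in> ?Z s"
        using EC_set_level[OF c, of P] d0 unfolding lev EH.cocycles_def by blast
      ultimately show ?thesis unfolding K_def by blast
    qed
    show "\<exists>x\<in>EC.Zr 2 (int P) n. y - level P x \<in> L" if y: "y \<in> K" for y
    proof -
      obtain w where w: "EH_B y = EH_diff w" "w \<in> EH_set (s - 2)" using y by (auto simp: K_def)
      have yc: "y \<in> EH_set s" "EH_diff y = 0" using y by (auto simp: K_def EH.cocycles_def)
      define x where "x = at_level P y + at_level (Suc P) (- w)"
      have c: "x \<in> EC_set n"
        unfolding x_def using yc(1) EH.subspace_neg[OF EH.subspace_C w(2)]
        by (intro EC_set_add at_level_EC_set) (simp_all only: lev)
      have lx: "level k x = (if k = P then y else if k = Suc P then - w else 0)" for k
        by (simp add: x_def)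
      have "x \<in> Fil (int P)" unfolding EC_set_Fil_iff[OF c] by (simp add: lx)
      moreover have "EC_diff x \<in> Fil (int P + 2)"
        unfolding EC_set_Fil_iff[OF EC_diff_EC_set[OF c]]
      proof (intro allI impI)
        fix k assume "int k < int P + 2"
        then consider "k < P" | "k = P" | "k = Suc P" by linarith
        then show "level k (EC_diff x) = 0"
          by cases (auto simp: level_EC_diff lx yc w(1) EH_B_0 EH.d_neg[OF w(2)])
      qed
      ultimately have "x \<in> EC.Zr 2 (int P) n" by (rule EC_ZrI[OF c]) simp
      moreover have "y - level P x \<in> L" using EH.subspace_0[OF sL] by (simp add: lx)
      ultimately show ?thesis by blast
    qed
    show "level P x \<in> L \<longleftrightarrow> x \<in> EC.Br 2 (int P) n" if x: "x \<in> EC.Zr 2 (int P) n" for x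
    proof
      assume "x \<in> EC.Br 2 (int P) n"
      then obtain y z where yz: "x = y + EC_diff z" "y \<in> EC.Zr (2 - 1) (int P + 1) n"
        "z \<in> EC.Zr (2 - 1) (int P - 2 + 1) (n - 1)"
        unfolding EC.Br_def by blast
      note yc = EC_ZrD(1,2)[OF yz(2)]
      have zc: "z \<in> EC_set (n - 1)" "z \<in> Fil (int P - 1)" and dz: "EC_diff z \<in> Fil (int P)"
        using EC_ZrD[OF yz(3)] by simp_all
      have "level P y = 0" using yc(2) unfolding EC_set_Fil_iff[OF yc(1)] by simp
      then have lx: "level P x = EH_diff (level P z) + (if 0 < P then EH_B (level (P - 1) z) else 0)"
        by (simp add: yz(1) level_EC_diff)
      have "level P z \<in> EH_set (s - 1)"
      proof -
        have "n - 1 - 2 * int P = s - 1" by (simp add: n_def s_def)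
        then show ?thesis using EC_set_level[OF zc(1), of P] by (simp only:)
      qed
      then have b: "EH_diff (level P z) \<in> ?B s" by (rule imageI)
      have u: "(if 0 < P then EH_B (level (P - 1) z) else 0) \<in> U"
      proof (cases P)
        case (Suc P')
        have below: "level k z = 0" if "k < P'" for k
          using zc(2) that Suc unfolding EC_set_Fil_iff[OF zc(1)] by simp
        have "level P' (EC_diff z) = 0"
          using dz Suc unfolding EC_set_Fil_iff[OF EC_diff_EC_set[OF zc(1)]] by simp
        then have "EH_diff (level P' z) = 0" using EC_diff_level_below(2)[of P' z, OF below] by simp
        moreover have "level P' z \<in> EH_set (s + 1)"
        proof -
          have "n - 1 - 2 * int P' = s + 1" by (simp add: n_def s_def Suc)
          then show ?thesis using EC_set_level[OF zc(1), of P'] by (simp only:)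
        qed
        ultimately have "level P' z \<in> ?Z (s + 1)" unfolding EH.cocycles_def by blast
        then show ?thesis using Suc by (simp add: U_def)
      qed (simp add: U_def)
      show "level P x \<in> L" unfolding lx add.commute[of "EH_diff (level P z)"] L_def using b u by blast
    next
      assume "level P x \<in> L"
      then obtain u b where ub: "level P x = u + b" "u \<in> U" "b \<in> ?B s" unfolding L_def by blast
      then obtain v where v: "b = EH_diff v" "v \<in> EH_set (s - 1)" by blast
      \<comment> \<open>\<open>z\<close> has columns \<open>t\<close> and \<open>v\<close> at \<open>P - 1\<close> and \<open>P\<close>, where \<open>u = B t\<close>; column \<open>P - 1\<close> of its
        coboundary is \<open>D t = 0\<close>, and column \<open>P\<close> is \<open>D v + B t\<close>.\<close>
      have "\<exists>z. z \<in> EC_set (n - 1) \<and> (\<forall>k<P. level k (EC_diff z) = 0) \<and> (\<forall>k. k < P - 1 \<longrightarrow> level k z = 0) \<and>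
          level P (EC_diff z) = u + b"
      proof (cases P)
        case 0
        have "n - 1 - 2 * int 0 = s - 1" by (simp add: n_def s_def 0)
        then have "at_level 0 v \<in> EC_set (n - 1)" using v(2) by (intro at_level_EC_set) (simp only:)
        then show ?thesis using ub(2) 0 by (intro exI[of _ "at_level 0 v"]) (simp add: level_EC_diff U_def v(1))
      next
        case (Suc P')
        then obtain t where t: "u = EH_B t" "t \<in> ?Z (s + 1)" using ub(2) by (auto simp: U_def)
        have tc: "t \<in> EH_set (s + 1)" "EH_diff t = 0" using t by (auto simp: EH.cocycles_def)
        let ?z = "at_level P' t + at_level P v"
        have "n - 1 - 2 * int P' = s + 1" "n - 1 - 2 * int P = s - 1" by (simp_all add: n_def s_def Suc)
        then have "?z \<in> EC_set (n - 1)" using v(2) tc(1) by (intro EC_set_add at_level_EC_set) (simp_all only:)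
        moreover have lz: "level k ?z = (if k = P' then t else if k = Suc P' then v else 0)" for k
          by (simp add: Suc)
        have "level k (EC_diff ?z) = 0" if "k < P" for k
        proof -
          have "k < P' \<or> k = P'" using that Suc by auto
          then show ?thesis unfolding level_EC_diff lz by (auto simp: tc EH_B_0)
        qed
        moreover have "level P (EC_diff ?z) = u + b"
          unfolding level_EC_diff lz by (simp add: Suc t(1) v(1) add.commute)
        moreover have "level k ?z = 0" if "k < P - 1" for k unfolding lz using that Suc by auto
        ultimately show ?thesis by blast
      qed
      then obtain z where z: "z \<in> EC_set (n - 1)" "\<And>k. k < P \<Longrightarrow> level k (EC_diff z) = 0"
        "\<And>k. k < P - 1 \<Longrightarrow> level k z = 0" "level P (EC_diff z) = u + b" by blast
      have dzc: "EC_diff z \<in> EC_set n" using EC_diff_EC_set[OF z(1)] by simp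
      have zZ: "z \<in> EC.Zr (2 - 1) (int P - 2 + 1) (n - 1)"
      proof (rule EC_ZrI[OF z(1)])
        show "z \<in> Fil (int P - 2 + 1)" unfolding EC_set_Fil_iff[OF z(1)]
        proof (intro allI impI)
          fix k assume "int k < int P - 2 + 1"
          then show "level k z = 0" by (intro z(3)) linarith
        qed
        show "EC_diff z \<in> Fil (int P)" unfolding EC_set_Fil_iff[OF dzc] using z(2) by simp
      qed simp
      have xc: "x \<in> EC_set n" by (rule EC_ZrD(1)[OF x])
      let ?y = "x - EC_diff z"
      have yc: "?y \<in> EC_set n" by (rule EC.subspace_diff[OF EC.subspace_C xc dzc])
      have "level k ?y = 0" if "k < Suc P" for k
      proof (cases "k = P")
        case True then show ?thesis by (simp add: z(4) ub(1))
      next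
        case False
        then have "k < P" using that by simp
        then show ?thesis using z(2) ZrD[OF x] by simp
      qed
      then have "?y \<in> Fil (int P + 1)" unfolding EC_set_Fil_iff[OF yc] by simp
      moreover have "EC_diff ?y = EC_diff x"
        using EC.d_diff[OF xc dzc] EC.d_d[OF z(1)] by simp
      then have "EC_diff ?y \<in> Fil (int P + 2)" using EC_ZrD(3)[OF x] by (simp only:)
      ultimately have "?y \<in> EC.Zr (2 - 1) (int P + 1) n" by (rule EC_ZrI[OF yc]) simp
      then have "?y + EC_diff z \<in> EC.Br 2 (int P) n" using zZ by (rule EC.BrI)
      then show "x \<in> EC.Br 2 (int P) n" by simp
    qed
  qed simp_all
  then show ?thesis using R by (simp add: EC.page_def n_def) (rule vspace_iso_trans)
qed

theorem cyclic_spectral_sequence: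
  "\<exists>(E :: nat \<Rightarrow> int \<Rightarrow> int \<Rightarrow> ('k, (nat \<times> nat \<times> nat \<Rightarrow> ('k, 'a) cochain) set) module) d.
     spectral_sequence E d \<and>
     (\<forall>p q. E 2 p q \<simeq>\<^sub>k cohom (neg_trunc q HH) (trunc_diff q) p) \<and>
     converges_to E d HC"
proof (intro exI conjI allI)
  show "spectral_sequence EC.page EC.page_diff" by (rule EC.spectral_sequence_pages)
  show "EC.page 2 p q \<simeq>\<^sub>k cohom (neg_trunc q HH) (trunc_diff q) p" for p q
  proof (cases "0 \<le> p \<and> p \<le> q")
    case True
    then show ?thesis using page_2_iso_inside[of "nat p" q] by simp
  qed (intro page_2_iso_outside, linarith)
  show "converges_to EC.page EC.page_diff HC" unfolding HC_eq by (rule EC.pages_converge)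
qed

end

theorem theorem4p10:
  fixes scale :: "'k::field_char_0 \<Rightarrow> 'a::{ring, monoid_mult} \<Rightarrow> 'a"
    and A :: "nat \<Rightarrow> 'a set" and \<phi> :: "'a \<Rightarrow> 'a"
  assumes "dga scale A \<phi>"
  shows "\<exists>(E :: nat \<Rightarrow> int \<Rightarrow> int \<Rightarrow> ('k, (nat \<times> nat \<times> nat \<Rightarrow> ('k, 'a) cochain) set) module) d.
           spectral_sequence E d \<and>
           (\<forall>p q. E 2 p q \<simeq>\<^sub>k
              cohom (neg_trunc q (dga.HH scale A \<phi>)) (dga.trunc_diff scale A \<phi> q) p) \<and>
           converges_to E d (dga.HC scale A \<phi>)"
  using dga.cyclic_spectral_sequence[OF assms] .

end
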